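(* Let $r\geq 3$ and $m_1,\dots,m_r\in\mathbb{Z}_{\ge2}\cup\{\infty\}$, and let $\Gamma=\Gamma(m_1,\dots,m_r)$. The Hecke algebra $\mathcal{H}(\Gamma)$ is free as a left module over $R=\mathbb{C}[t,t^{-1}]$ if and only if $\sum_{j=1}^r(1-1/m_j)\geq 2$ (where $1/\infty=0$).
   Context: $\Gamma(m_1,\dots,m_r)$ is the group with generators $c_1,\dots,c_r$ and defining relations $c_j^{m_j}=1$ (for those $j$ with $m_j<\infty$) and $\prod_{j=1}^r c_j=c_1c_2\cdots c_r=1$. Let $t_{jk}$ ($1\le j\le r$ with $m_j<\infty$, $1\le k\le m_j$) be independent commuting invertible variables, and let $R=\mathbb{C}[t,t^{-1}]$ denote the Laurent polynomial ring $\mathbb{C}[t_{jk}^{\pm1}]$ in all of them. The Hecke algebra $\mathcal{H}(\Gamma)$ is the $R$-algebra with invertible generators $c_1,\dots,c_r$ and defining relations $(c_j-t_{j1})\cdots(c_j-t_{jm_j})=0$ for each $j$ with $m_j<\infty$, and $\prod_{j=1}^r c_j=1$. *)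

theory Defs
  imports
    "Jordan_Normal_Form.Missing_VectorSpace"
    "HOL-Algebra.QuotRing"
    "HOL-Library.Poly_Mapping"
    "HOL-Library.Extended_Real"
begin

section \<open>Laurent polynomials\<close>

text \<open>A finitely supported exponent function \<open>e\<close> stands for the monomial
  \<open>\<Prod>(j,k). t\<^sub>j\<^sub>k ^ e (j,k)\<close>, so that multiplication of monomials is addition of exponents and
  Laurent polynomials form the monoid algebra of the exponents.\<close>

type_synonym laurent = "(nat \<times> nat \<Rightarrow>\<^sub>0 int) \<Rightarrow>\<^sub>0 complex"

definition laurent_ring :: "(nat \<times> nat) set \<Rightarrow> laurent ring" where
  "laurent_ring V =
    \<lparr>carrier = {p. \<forall>e \<in> Poly_Mapping.keys p. Poly_Mapping.keys e \<subseteq> V},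
     mult = (*), one = 1, zero = 0, add = (+)\<rparr>"

definition tvar :: "nat \<Rightarrow> nat \<Rightarrow> laurent" where
  "tvar j k = Poly_Mapping.single (Poly_Mapping.single (j, k) 1) 1"


section \<open>The free algebra\<close>

text \<open>The free monoid is written additively because the convolution product on
  \<open>'a \<Rightarrow>\<^sub>0 'b\<close> uses the addition of \<open>'a\<close>, which need not be commutative.\<close>

datatype 'a free_mon = Free_Mon (letters: "'a list")

instantiation free_mon :: (type) monoid_add
begin

definition "0 = Free_Mon []"

definition "u + v = Free_Mon (letters u @ letters v)"

instance
  by standard (simp_all add: zero_free_mon_def plus_free_mon_def)

end

text \<open>\<open>Inv_Gen j\<close> is a letter for the inverse of the generator \<open>c\<^sub>j\<close>; it becomes an actual inverse
  only modulo the relators below.\<close>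

datatype letter = Gen nat | Inv_Gen nat

type_synonym free_elt = "letter free_mon \<Rightarrow>\<^sub>0 laurent"

definition const :: "laurent \<Rightarrow> free_elt" where
  "const a = Poly_Mapping.single 0 a"

definition gen :: "nat \<Rightarrow> free_elt" where
  "gen j = Poly_Mapping.single (Free_Mon [Gen j]) 1"

definition inv_gen :: "nat \<Rightarrow> free_elt" where
  "inv_gen j = Poly_Mapping.single (Free_Mon [Inv_Gen j]) 1"

definition free_algebra :: "nat \<Rightarrow> (nat \<times> nat) set \<Rightarrow> (laurent, free_elt) module" where
  "free_algebra r V =
    \<lparr>carrier = {x. (\<forall>w \<in> Poly_Mapping.keys x.
                     set (letters w) \<subseteq> Gen ` {1..r} \<union> Inv_Gen ` {1..r}) \<and>
                   (\<forall>w. Poly_Mapping.lookup x w \<in> carrier (laurent_ring V))},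
     mult = (*), one = 1, zero = 0, add = (+), smult = (\<lambda>a x. const a * x)\<rparr>"


section \<open>The Hecke algebra\<close>

definition hecke_vars :: "nat \<Rightarrow> (nat \<Rightarrow> enat) \<Rightarrow> (nat \<times> nat) set" where
  "hecke_vars r m = {(j, k). j \<in> {1..r} \<and> m j \<noteq> \<infinity> \<and> 1 \<le> k \<and> enat k \<le> m j}"

definition hecke_relators :: "nat \<Rightarrow> (nat \<Rightarrow> enat) \<Rightarrow> free_elt set" where
  "hecke_relators r m =
    {gen j * inv_gen j - 1 | j. j \<in> {1..r}} \<union>
    {inv_gen j * gen j - 1 | j. j \<in> {1..r}} \<union>
    {\<Prod>k\<leftarrow>[1..<Suc (the_enat (m j))]. gen j - const (tvar j k) | j. j \<in> {1..r} \<and> m j \<noteq> \<infinity>} \<union>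
    {(\<Prod>j\<leftarrow>[1..<Suc r]. gen j) - 1}"

definition hecke_ideal :: "nat \<Rightarrow> (nat \<Rightarrow> enat) \<Rightarrow> free_elt set" where
  "hecke_ideal r m = genideal (free_algebra r (hecke_vars r m)) (hecke_relators r m)"

text \<open>All cosets in the union below coincide; the style follows \<^const>\<open>rcoset_mult\<close>.\<close>

definition hecke_algebra :: "nat \<Rightarrow> (nat \<Rightarrow> enat) \<Rightarrow> (laurent, free_elt set) module" where
  "hecke_algebra r m =
    (let F = free_algebra r (hecke_vars r m); I = hecke_ideal r m
     in ring.extend (F Quot I) (module.fields (\<lambda>a X. \<Union>x\<in>X. I +>\<^bsub>F\<^esub> (a \<odot>\<^bsub>F\<^esub> x))))"

abbreviation hecke_coeffs :: "nat \<Rightarrow> (nat \<Rightarrow> enat) \<Rightarrow> laurent ring" where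
  "hecke_coeffs r m \<equiv> laurent_ring (hecke_vars r m)"


section \<open>Free modules\<close>

text \<open>\<^const>\<open>LinearCombinations.module.span\<close> and \<^const>\<open>LinearCombinations.module.lin_dep\<close> refer to finite linear combinations of a
  possibly infinite set.\<close>

definition free_module :: "('a, 'b) ring_scheme \<Rightarrow> ('a, 'c, 'd) module_scheme \<Rightarrow> bool" where
  "free_module R M \<longleftrightarrow> Module.module R M \<and>
    (\<exists>B. B \<subseteq> carrier M \<and> LinearCombinations.module.span R M B = carrier M \<and>
      \<not> LinearCombinations.module.lin_dep R M B)"


section \<open>Well-formedness\<close>

lemma laurent_ring_simps [simp]:
  "mult (laurent_ring V) = (*)" "one (laurent_ring V) = 1"
  "zero (laurent_ring V) = 0" "add (laurent_ring V) = (+)"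
  by (simp_all add: laurent_ring_def)

lemma laurent_mult_closed:
  assumes "p \<in> carrier (laurent_ring V)" "q \<in> carrier (laurent_ring V)"
  shows "p * q \<in> carrier (laurent_ring V)"
  unfolding laurent_ring_def
proof (clarsimp)
  fix e x assume "e \<in> Poly_Mapping.keys (p * q)" and x: "x \<in> Poly_Mapping.keys e"
  then obtain a b where ab: "e = a + b" "a \<in> Poly_Mapping.keys p" "b \<in> Poly_Mapping.keys q"
    using keys_mult[of p q] by blast
  moreover have "x \<in> Poly_Mapping.keys a \<union> Poly_Mapping.keys b"
    using x ab(1) keys_add[of a b] by blast
  ultimately show "x \<in> V" using assms by (auto simp: laurent_ring_def)
qed

lemma laurent_closed:
  "0 \<in> carrier (laurent_ring V)" "1 \<in> carrier (laurent_ring V)"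
  "p \<in> carrier (laurent_ring V) \<Longrightarrow> - p \<in> carrier (laurent_ring V)"
  "\<lbrakk>p \<in> carrier (laurent_ring V); q \<in> carrier (laurent_ring V)\<rbrakk> \<Longrightarrow> p + q \<in> carrier (laurent_ring V)"
  "(j, k) \<in> V \<Longrightarrow> tvar j k \<in> carrier (laurent_ring V)"
  using keys_add[of p q] by (auto simp: laurent_ring_def tvar_def)

lemma laurent_sum_closed:
  "(\<And>a. a \<in> A \<Longrightarrow> f a \<in> carrier (laurent_ring V)) \<Longrightarrow> sum f A \<in> carrier (laurent_ring V)"
  by (induction A rule: infinite_finite_induct) (auto simp: laurent_closed)

lemma cring_laurent: "cring (laurent_ring V)"
proof (intro cringI abelian_groupI comm_monoidI)
  fix x assume "x \<in> carrier (laurent_ring V)"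
  then show "\<exists>y\<in>carrier (laurent_ring V). y \<oplus>\<^bsub>laurent_ring V\<^esub> x = \<zero>\<^bsub>laurent_ring V\<^esub>"
    by (intro bexI[of _ "- x"]) (auto simp: laurent_closed)
qed (auto simp: laurent_closed laurent_mult_closed algebra_simps)

lemma free_algebra_simps [simp]:
  "mult (free_algebra r V) = (*)" "one (free_algebra r V) = 1"
  "zero (free_algebra r V) = 0" "add (free_algebra r V) = (+)"
  "smult (free_algebra r V) = (\<lambda>a x. const a * x)"
  by (simp_all add: free_algebra_def)

lemma free_algebra_mult_closed:
  assumes x: "x \<in> carrier (free_algebra r V)" and y: "y \<in> carrier (free_algebra r V)"
  shows "x * y \<in> carrier (free_algebra r V)"
proof -
  have "set (letters w) \<subseteq> Gen ` {1..r} \<union> Inv_Gen ` {1..r}" if w: "w \<in> Poly_Mapping.keys (x * y)" for w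
  proof -
    obtain u v where "w = u + v" "u \<in> Poly_Mapping.keys x" "v \<in> Poly_Mapping.keys y"
      using w keys_mult[of x y] by blast
    with x y show ?thesis by (auto simp: free_algebra_def plus_free_mon_def)
  qed
  moreover have "Poly_Mapping.lookup (x * y) w \<in> carrier (laurent_ring V)" for w
    using x y unfolding lookup_mult Sum_any.expand_set free_algebra_def
    by (auto intro!: laurent_sum_closed laurent_mult_closed laurent_closed simp: when_def)
  ultimately show ?thesis by (simp add: free_algebra_def)
qed

lemma free_algebra_closed:
  "0 \<in> carrier (free_algebra r V)" "1 \<in> carrier (free_algebra r V)"
  "x \<in> carrier (free_algebra r V) \<Longrightarrow> - x \<in> carrier (free_algebra r V)"
  "\<lbrakk>x \<in> carrier (free_algebra r V); y \<in> carrier (free_algebra r V)\<rbrakk>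
    \<Longrightarrow> x + y \<in> carrier (free_algebra r V)"
  "\<lbrakk>x \<in> carrier (free_algebra r V); y \<in> carrier (free_algebra r V)\<rbrakk>
    \<Longrightarrow> x - y \<in> carrier (free_algebra r V)"
  "a \<in> carrier (laurent_ring V) \<Longrightarrow> const a \<in> carrier (free_algebra r V)"
  "j \<in> {1..r} \<Longrightarrow> gen j \<in> carrier (free_algebra r V)"
  "j \<in> {1..r} \<Longrightarrow> inv_gen j \<in> carrier (free_algebra r V)"
proof -
  show add: "x + y \<in> carrier (free_algebra r V)"
    if x: "x \<in> carrier (free_algebra r V)" and y: "y \<in> carrier (free_algebra r V)" for x y
  proof -
    have "set (letters w) \<subseteq> Gen ` {1..r} \<union> Inv_Gen ` {1..r}"
      if "w \<in> Poly_Mapping.keys (x + y)" for w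
    proof -
      from that keys_add[of x y] consider "w \<in> Poly_Mapping.keys x" | "w \<in> Poly_Mapping.keys y"
        by blast
      then show ?thesis using x y by cases (simp_all add: free_algebra_def)
    qed
    then show ?thesis using x y by (simp add: free_algebra_def lookup_add laurent_closed)
  qed
  show neg: "- x \<in> carrier (free_algebra r V)" if "x \<in> carrier (free_algebra r V)" for x
    using that by (simp add: free_algebra_def laurent_closed)
  show "x - y \<in> carrier (free_algebra r V)"
    if "x \<in> carrier (free_algebra r V)" "y \<in> carrier (free_algebra r V)"
    using add[OF that(1) neg[OF that(2)]] by simp
  show "0 \<in> carrier (free_algebra r V)" "1 \<in> carrier (free_algebra r V)"
    by (simp_all add: free_algebra_def lookup_one when_def laurent_closed zero_free_mon_def)
  show "const a \<in> carrier (free_algebra r V)" if "a \<in> carrier (laurent_ring V)"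
    using that
    by (simp add: free_algebra_def const_def lookup_single when_def laurent_closed zero_free_mon_def)
  show "gen j \<in> carrier (free_algebra r V)" "inv_gen j \<in> carrier (free_algebra r V)"
    if "j \<in> {1..r}"
    using that
    by (simp_all add: free_algebra_def gen_def inv_gen_def lookup_single when_def laurent_closed)
qed

lemma free_algebra_prod_list_closed:
  "set xs \<subseteq> carrier (free_algebra r V) \<Longrightarrow> prod_list xs \<in> carrier (free_algebra r V)"
  by (induction xs) (auto simp: free_algebra_closed free_algebra_mult_closed)

lemma ring_free_algebra: "ring (free_algebra r V)"
proof (intro ringI abelian_groupI monoidI)
  fix x assume "x \<in> carrier (free_algebra r V)"
  then show "\<exists>y\<in>carrier (free_algebra r V). y \<oplus>\<^bsub>free_algebra r V\<^esub> x = \<zero>\<^bsub>free_algebra r V\<^esub>"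
    by (intro bexI[of _ "- x"]) (auto simp: free_algebra_closed)
qed (auto simp: free_algebra_closed free_algebra_mult_closed algebra_simps)

lemma const_hom:
  "const 1 = 1" "const (a + b) = const a + const b" "const (a * b) = const a * const b"
  by (simp_all add: const_def single_add mult_single)

lemma const_central: "const a * x = x * const a"
proof (induction x rule: update_induct)
  case (update f k v)
  have "Poly_Mapping.update k v f = f + Poly_Mapping.single k v"
    using update(1) by (intro poly_mapping_eqI)
      (auto simp: lookup_update lookup_add lookup_single when_def in_keys_iff)
  then show ?case
    using update by (simp add: const_def mult_single mult.commute distrib_left distrib_right)
qed simp

lemma hecke_relators_closed:
  "hecke_relators r m \<subseteq> carrier (free_algebra r (hecke_vars r m))"
proof -
  have "tvar j k \<in> carrier (hecke_coeffs r m)"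
    if "j \<in> {1..r}" "m j \<noteq> \<infinity>" "k \<in> {1..<Suc (the_enat (m j))}" for j k
    using that by (intro laurent_closed) (auto simp: hecke_vars_def)
  then have "set (map (\<lambda>k. gen j - const (tvar j k)) [1..<Suc (the_enat (m j))])
      \<subseteq> carrier (free_algebra r (hecke_vars r m))" if "j \<in> {1..r}" "m j \<noteq> \<infinity>" for j
    using that by (auto intro!: free_algebra_closed)
  moreover have "set (map gen [1..<Suc r]) \<subseteq> carrier (free_algebra r (hecke_vars r m))"
    by (auto intro!: free_algebra_closed)
  ultimately show ?thesis
    unfolding hecke_relators_def
    by (intro Un_least subsetI)
      (elim CollectE exE conjE singletonE, simp only:,
       intro free_algebra_closed free_algebra_mult_closed free_algebra_prod_list_closed;
       simp)+
qed

lemma ideal_hecke_ideal: "ideal (hecke_ideal r m) (free_algebra r (hecke_vars r m))"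
  unfolding hecke_ideal_def
  by (rule ring.genideal_ideal[OF ring_free_algebra hecke_relators_closed])

lemma hecke_algebra_simps:
  fixes r m
  defines "F \<equiv> free_algebra r (hecke_vars r m)" and "I \<equiv> hecke_ideal r m"
  shows "carrier (hecke_algebra r m) = carrier (F Quot I)"
    "mult (hecke_algebra r m) = mult (F Quot I)" "one (hecke_algebra r m) = one (F Quot I)"
    "add (hecke_algebra r m) = add (F Quot I)" "zero (hecke_algebra r m) = zero (F Quot I)"
    "smult (hecke_algebra r m) = (\<lambda>a X. \<Union>x\<in>X. I +>\<^bsub>F\<^esub> (a \<odot>\<^bsub>F\<^esub> x))"
  by (simp_all add: hecke_algebra_def F_def I_def Let_def ring.defs module.defs)

lemma ring_hecke_algebra: "ring (hecke_algebra r m)"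
proof -
  let ?Q = "free_algebra r (hecke_vars r m) Quot hecke_ideal r m"
  interpret Q: ring ?Q by (rule ideal.quotient_is_ring[OF ideal_hecke_ideal])
  show ?thesis
  proof (intro ringI abelian_groupI monoidI, unfold hecke_algebra_simps)
    fix x assume "x \<in> carrier ?Q"
    then show "\<exists>y\<in>carrier ?Q. y \<oplus>\<^bsub>?Q\<^esub> x = \<zero>\<^bsub>?Q\<^esub>" using Q.l_neg by blast
  qed (simp_all add: Q.a_ac Q.m_assoc Q.l_distr Q.r_distr)
qed

lemma hecke_smult_coset:
  fixes r m
  defines "F \<equiv> free_algebra r (hecke_vars r m)" and "I \<equiv> hecke_ideal r m"
  assumes a: "a \<in> carrier (hecke_coeffs r m)" and x: "x \<in> carrier F"
  shows "a \<odot>\<^bsub>hecke_algebra r m\<^esub> (I +>\<^bsub>F\<^esub> x) = I +>\<^bsub>F\<^esub> (const a * x)"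
proof -
  interpret ideal I F unfolding I_def F_def by (rule ideal_hecke_ideal)
  have c: "const a \<in> carrier F" using a by (simp add: F_def free_algebra_closed)
  have "I +>\<^bsub>F\<^esub> (a \<odot>\<^bsub>F\<^esub> y) = I +>\<^bsub>F\<^esub> (const a * x)" if y: "y \<in> I +>\<^bsub>F\<^esub> x" for y
  proof -
    have yF: "y \<in> carrier F" using y x a_r_coset_subset_G[OF a_subset] by blast
    have "I +>\<^bsub>F\<^esub> y = I +>\<^bsub>F\<^esub> x" using a_repr_independence[OF y x a_subgroup] by simp
    then have "I +>\<^bsub>F\<^esub> (const a \<otimes>\<^bsub>F\<^esub> y) = I +>\<^bsub>F\<^esub> (const a \<otimes>\<^bsub>F\<^esub> x)"
      using rcoset_mult_add[OF c yF] rcoset_mult_add[OF c x] by simp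
    then show ?thesis by (simp add: F_def)
  qed
  moreover have "x \<in> I +>\<^bsub>F\<^esub> x" by (rule a_rcos_self[OF x])
  ultimately show ?thesis
    unfolding hecke_algebra_simps F_def[symmetric] I_def[symmetric] by blast
qed

lemma module_hecke_algebra: "Module.module (hecke_coeffs r m) (hecke_algebra r m)"
proof -
  let ?F = "free_algebra r (hecke_vars r m)" and ?I = "hecke_ideal r m"
  let ?H = "hecke_algebra r m"
  let ?c = "\<lambda>a. hecke_ideal r m +>\<^bsub>free_algebra r (hecke_vars r m)\<^esub> const a"
  interpret ideal ?I ?F by (rule ideal_hecke_ideal)
  interpret H: ring ?H by (rule ring_hecke_algebra)
  have coset: "\<exists>x \<in> carrier ?F. X = ?I +>\<^bsub>?F\<^esub> x" if "X \<in> carrier ?H" for X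
    using that by (auto simp: hecke_algebra_simps FactRing_def A_RCOSETS_def')
  have cF: "const a \<in> carrier ?F" if "a \<in> carrier (hecke_coeffs r m)" for a
    using that by (simp add: free_algebra_closed)
  have cH: "?c a \<in> carrier ?H" if "a \<in> carrier (hecke_coeffs r m)" for a
    using cF[OF that] by (auto simp: hecke_algebra_simps FactRing_def A_RCOSETS_def')
  have smult: "a \<odot>\<^bsub>?H\<^esub> X = ?c a \<otimes>\<^bsub>?H\<^esub> X"
    if a: "a \<in> carrier (hecke_coeffs r m)" and X: "X \<in> carrier ?H" for a X
  proof -
    obtain x where x: "x \<in> carrier ?F" "X = ?I +>\<^bsub>?F\<^esub> x" using coset[OF X] by blast
    show ?thesis
      using hecke_smult_coset[OF a x(1)] rcoset_mult_add[OF cF[OF a] x(1)] x(2)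
      by (simp add: hecke_algebra_simps FactRing_def)
  qed
  have c_add: "?c (a + b) = ?c a \<oplus>\<^bsub>?H\<^esub> ?c b"
    if "a \<in> carrier (hecke_coeffs r m)" "b \<in> carrier (hecke_coeffs r m)" for a b
    using a_rcos_sum[OF cF[OF that(1)] cF[OF that(2)]]
    by (simp add: hecke_algebra_simps FactRing_def const_hom)
  have c_mult: "?c (a * b) = ?c a \<otimes>\<^bsub>?H\<^esub> ?c b"
    if "a \<in> carrier (hecke_coeffs r m)" "b \<in> carrier (hecke_coeffs r m)" for a b
    using rcoset_mult_add[OF cF[OF that(1)] cF[OF that(2)]]
    by (simp add: hecke_algebra_simps FactRing_def const_hom)
  have c_one: "?c 1 = \<one>\<^bsub>?H\<^esub>" by (simp add: hecke_algebra_simps FactRing_def const_hom)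
  show ?thesis
    by (rule Module.moduleI[OF cring_laurent H.abelian_group_axioms])
      (simp_all add: smult cH c_add c_mult c_one laurent_closed laurent_mult_closed
        H.l_distr H.r_distr H.m_assoc)
qed

end

(*
  Gamma is the rotation subgroup of the group W generated by the reflections s_0, ..., s_(r-1) in the
  sides of an r-gon with angles pi/m_j, with c_j = s_(j-1) s_j.

  Suppose that the angle sum is at most that of a Euclidean polygon. Lifts of the reduced words of
  even length, one for each element of Gamma, span the Hecke algebra over R: two reduced words of the
  same element are related by braid moves, which hold in the Hecke algebra up to shorter words. For
  the independence, specialise t_jk to power series with constant term exp(2 pi i k/m_j) that
  separate the Laurent monomials, and deform the regular representation of C[W] order by order.
  Each c_j deforms through its eigenprojections; the relation c_1...c_r = 1 is restored at
  the next order by conjugating the c_j infinitesimally. The obstruction to this vanishes because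
  some g in Gamma has infinite order, so that x - g x g^(-1) takes all values on the operators on C[W].
  Then an R-linear relation between the lifts has a lowest order term which contradicts the linear
  independence of the elements of W.

  In the spherical cases r = 3 and (m_j) is a permutation of (2,2,n), (2,3,3), (2,3,4), (2,3,5). At a
  suitable point of the torus the relations read x^2 = 1, y^2 = 1 or y^3 = 1, (x y)^n = scalar, and a
  dihedral computation, respectively filling the faces of a tetrahedron, cube or dodecahedron one by
  one, shows that a scalar different from 1 equals 1.
  So a fibre vanishes, whereas the Hecke algebra itself does not, and it cannot be free.
*)

theory Submission
  imports Defs "HOL-Computational_Algebra.Computational_Algebra" "HOL-Library.Countable_Set"
begin

section \<open>Words in Coxeter groups\<close>

text \<open>The combinatorics live in W because b_i = c_1...c_i plays the part of s_0 s_i, so that a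
  word of even length in the reflections lifts to an alternating product of b_i^-1 and b_k. The
  deformed braid relation of s_(j-1) and s_j is then the Hecke relation of c_j itself: its leading
  coefficient is 1 and its constant coefficient is a unit, so either side of the braid can be
  expressed through the other and shorter words. Convergence never enters. A linear relation is
  tested at one order of the power series, so a deformation truncated at that order suffices.
  Infinite order is essential to the method: on a finite-dimensional space x - g x g^(-1) has trace
  0, and taking determinants in c_1...c_r = 1 constrains the t_jk. The spherical cases exploit such
  a constraint: t is chosen with c_s^n = 2, and 2 is not a root of unity. The geometric
  representation of W serves two purposes only: the exact order of s_i s_j, and an element of
  infinite order when all angles of a triangle are positive.\<close>

fun alt :: "'a \<Rightarrow> 'a \<Rightarrow> nat \<Rightarrow> 'a list" where
  "alt i j 0 = []"
| "alt i j (Suc n) = i # alt j i n"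

lemma length_alt [simp]: "length (alt i j n) = n"
  by (induction n arbitrary: i j) auto

lemma set_alt: "set (alt i j n) \<subseteq> {i, j}"
  by (induction n arbitrary: i j) auto

lemma alt_append: "alt i j (a + b) = alt i j a @ (if even a then alt i j b else alt j i b)"
  by (induction a arbitrary: i j) auto

lemma rev_alt: "rev (alt i j n) = (if even n then alt j i n else alt i j n)"
proof (induction n arbitrary: i j)
  case (Suc n)
  show ?case
    using alt_append[of i j n 1] alt_append[of j i n 1] by (simp add: Suc.IH)
qed simp

lemma alt_Suc_snoc: "alt i j (Suc n) = alt i j n @ [if even n then i else j]"
  using alt_append[of i j n 1] by simp

text \<open>The Coxeter presentation, where the value 0 of \<open>M i j\<close> stands for infinite
  order and disables the braid clause. Every natural number is a letter, whatever alphabet a given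
  word uses.\<close>

inductive ceq :: "(nat \<Rightarrow> nat \<Rightarrow> nat) \<Rightarrow> nat list \<Rightarrow> nat list \<Rightarrow> bool" for M where
  ceq_refl [simp, intro!]: "ceq M u u"
| ceq_sym: "ceq M u v \<Longrightarrow> ceq M v u"
| ceq_trans [trans]: "ceq M u v \<Longrightarrow> ceq M v w \<Longrightarrow> ceq M u w"
| ceq_app: "ceq M u v \<Longrightarrow> ceq M (p @ u @ q) (p @ v @ q)"
| ceq_cancel: "ceq M [i, i] []"
| ceq_braid: "i \<noteq> j \<Longrightarrow> M i j > 0 \<Longrightarrow> ceq M (alt i j (M i j)) (alt j i (M i j))"

lemma ceq_parity: "ceq M u v \<Longrightarrow> even (length u) = even (length v)"
  by (induction rule: ceq.induct) auto

lemma ceq_Cons: "ceq M u v \<Longrightarrow> ceq M (i # u) (i # v)"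
  using ceq_app[of M u v "[i]" "[]"] by simp

lemma ceq_appL: "ceq M u v \<Longrightarrow> ceq M (p @ u) (p @ v)"
  using ceq_app[of M u v p "[]"] by simp

lemma ceq_appR: "ceq M u v \<Longrightarrow> ceq M (u @ q) (v @ q)"
  using ceq_app[of M u v "[]" q] by simp

lemma ceq_append: "ceq M u u' \<Longrightarrow> ceq M v v' \<Longrightarrow> ceq M (u @ v) (u' @ v')"
  using ceq_appL ceq_appR ceq_trans by blast

lemma ceq_cancel2: "ceq M (i # i # u) u"
  using ceq_appR[OF ceq_cancel] by simp

lemma ceq_rev_left: "ceq M (rev u @ u) []"
proof (induction u)
  case (Cons i u)
  have "ceq M (rev u @ (i # i # u)) (rev u @ u)" by (intro ceq_appL ceq_cancel2)
  then show ?case using Cons ceq_trans by fastforce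
qed simp

lemma ceq_rev_right: "ceq M (u @ rev u) []"
  using ceq_rev_left[of M "rev u"] by simp

lemma ceq_Cons_iff: "ceq M (i # u) (i # v) \<longleftrightarrow> ceq M u v"
  by (meson ceq_Cons ceq_cancel2 ceq_sym ceq_trans)

lemma ceq_Cons_swap: "ceq M (i # u) v \<longleftrightarrow> ceq M u (i # v)"
  by (meson ceq_Cons ceq_cancel2 ceq_sym ceq_trans)

lemma ceq_append_left_iff: "ceq M (p @ u) (p @ v) \<longleftrightarrow> ceq M u v"
  by (induction p) (simp_all add: ceq_Cons_iff)

lemma ceq_append_left_swap: "ceq M (p @ u) v \<longleftrightarrow> ceq M u (rev p @ v)"
  by (induction p arbitrary: v) (simp_all add: ceq_Cons_swap)

lemma ceq_append_right_iff: "ceq M (u @ p) (v @ p) \<longleftrightarrow> ceq M u v"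
proof
  assume "ceq M (u @ p) (v @ p)"
  then have "ceq M ((u @ p) @ rev p) ((v @ p) @ rev p)" by (rule ceq_appR)
  moreover have "ceq M ((w @ p) @ rev p) w" for w
    using ceq_appL[OF ceq_rev_right, of M w p] by simp
  ultimately show "ceq M u v" by (meson ceq_sym ceq_trans)
qed (rule ceq_appR)

section \<open>Parity of the reflections along a word\<close>

locale coxeter =
  fixes M :: "nat \<Rightarrow> nat \<Rightarrow> nat"
  assumes M_sym: "M i j = M j i"
    and M_ne1: "i \<noteq> j \<Longrightarrow> M i j \<noteq> 1"
begin

abbreviation eqv (infix "\<approx>" 50) where "u \<approx> v \<equiv> ceq M u v"

text \<open>Whether the reflection \<open>t\<close> occurs an odd number of times among the
  \<open>s\<^sub>1\<dots>s\<^sub>k\<^sub>-\<^sub>1 s\<^sub>k s\<^sub>k\<^sub>-\<^sub>1\<dots>s\<^sub>1\<close> attached to the letters of a word: unlike the list of these reflections,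
  the parity is an invariant of the group element.\<close>

fun par :: "nat list \<Rightarrow> nat list \<Rightarrow> bool" where
  "par [] t = False"
| "par (i # w) t = ((t \<approx> [i]) \<noteq> par w (i # t @ [i]))"

lemma par_cong: "t \<approx> t' \<Longrightarrow> par w t = par w t'"
proof (induction w arbitrary: t t')
  case (Cons i w)
  have "i # t @ [i] \<approx> i # t' @ [i]" using Cons.prems by (intro ceq_Cons ceq_appR)
  moreover have "t \<approx> [i] \<longleftrightarrow> t' \<approx> [i]" using Cons.prems ceq_sym ceq_trans by blast
  ultimately show ?case using Cons.IH by auto
qed simp

lemma par_append: "par (u @ v) t = (par u t \<noteq> par v (rev u @ t @ u))"
  by (induction u arbitrary: t) auto

text \<open>Conjugating \<open>alt j i (2 * p + 1)\<close> by \<open>i\<close> gives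
  \<open>alt i j (2 * p + 3)\<close>. The reflections attached to the letters of an alternating word
  are therefore its alternating words of odd length.\<close>

lemma par_alt: "par (alt i j k) t = odd (card {p. p < k \<and> t \<approx> alt i j (2 * p + 1)})"
proof (induction k arbitrary: i j t)
  case (Suc k)
  have step: "i # t @ [i] \<approx> alt j i (2 * p + 1) \<longleftrightarrow> t \<approx> alt i j (2 * p + 3)" for p
  proof -
    have "i # t @ [i] \<approx> alt j i (2 * p + 1) \<longleftrightarrow> t @ [i] \<approx> i # alt j i (2 * p + 1)"
      by (rule ceq_Cons_swap)
    also have "\<dots> \<longleftrightarrow> (t @ [i]) @ [i] \<approx> (i # alt j i (2 * p + 1)) @ [i]"
      by (rule ceq_append_right_iff[symmetric])
    also have "(i # alt j i (2 * p + 1)) @ [i] = alt i j (2 * p + 3)"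
      using alt_Suc_snoc[of i j "2 * p + 2"] by (simp add: numeral_3_eq_3)
    also have "(t @ [i]) @ [i] \<approx> alt i j (2 * p + 3) \<longleftrightarrow> t \<approx> alt i j (2 * p + 3)"
      using ceq_appL[OF ceq_cancel, of M t i] by (auto intro: ceq_trans ceq_sym)
    finally show ?thesis .
  qed
  let ?A = "{p. p < Suc k \<and> t \<approx> alt i j (2 * p + 1)}"
  let ?B = "{p. p < k \<and> t \<approx> alt i j (2 * p + 3)}"
  have A: "?A = (if t \<approx> [i] then {0} else {}) \<union> Suc ` ?B"
  proof (intro Set.set_eqI)
    fix p show "p \<in> ?A \<longleftrightarrow> p \<in> (if t \<approx> [i] then {0} else {}) \<union> Suc ` ?B"
      by (cases p) (auto simp: numeral_3_eq_3)
  qed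
  have "card ?A = (if t \<approx> [i] then 1 else 0) + card ?B"
    by (subst A, subst card_Un_disjoint) (auto simp: card_image)
  then show ?case using Suc.IH[of j i "i # t @ [i]"] step by auto
qed simp

text \<open>A walk around the dihedral 2m-gon: going one way or the other leads to the same vertex.
  For \<open>a\<close> at least \<open>M i j\<close> a braid move on the first letters is followed
  by cancellation; the remaining case is the mirror image.\<close>

lemma alt_flip:
  assumes "i \<noteq> j" "M i j > 0" "a \<le> 2 * M i j"
  shows "alt i j a \<approx> alt j i (2 * M i j - a)"
proof -
  let ?m = "M i j"
  have *: "alt i j a \<approx> alt j i (2 * M i j - a)" if "a \<ge> M i j" "a \<le> 2 * M i j" "i \<noteq> j" "M i j > 0" for i j a
  proof -
    let ?m = "M i j" and ?b = "a - M i j"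
    have "alt i j (?m + ?b) = alt i j ?m @ (if even ?m then alt i j ?b else alt j i ?b)"
      by (rule alt_append)
    also have "\<dots> \<approx> alt j i ?m @ (if even ?m then alt i j ?b else alt j i ?b)"
      using that by (intro ceq_appR ceq_braid)
    also have "alt j i ?m = alt j i (?m - ?b) @ (if even (?m - ?b) then alt j i ?b else alt i j ?b)"
      using alt_append[of j i "?m - ?b" ?b] that by simp
    also have "(alt j i (?m - ?b) @ (if even (?m - ?b) then alt j i ?b else alt i j ?b)) @
        (if even ?m then alt i j ?b else alt j i ?b) =
        alt j i (?m - ?b) @ ((if even (?m - ?b) then alt j i ?b else alt i j ?b) @
         rev (if even (?m - ?b) then alt j i ?b else alt i j ?b))"
      using that by (auto simp: rev_alt)
    also have "\<dots> \<approx> alt j i (?m - ?b) @ []" by (intro ceq_appL ceq_rev_right)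
    finally show ?thesis using that by (simp add: mult_2)
  qed
  show ?thesis
  proof (cases "a \<ge> ?m")
    case True then show ?thesis using * assms by blast
  next
    case False
    then show ?thesis using *[of j i "2 * ?m - a"] assms by (auto simp: M_sym[of j i] intro: ceq_sym)
  qed
qed

text \<open>By \<open>alt_flip\<close>, both sides of the braid relation run through the same
  reflections in opposite order, so p and m - 1 - p correspond.\<close>

lemma par_braid:
  assumes "i \<noteq> j" "M i j > 0"
  shows "par (alt i j (M i j)) t = par (alt j i (M i j)) t"
proof -
  let ?m = "M i j"
  have *: "t \<approx> alt j i (2 * (M i j - 1 - p) + 1)" if "p < M i j" "t \<approx> alt i j (2 * p + 1)"
    "i \<noteq> j" "M i j > 0" for p i j
  proof -
    have "alt i j (2 * p + 1) \<approx> alt j i (2 * M i j - (2 * p + 1))"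
      using that by (intro alt_flip) linarith+
    moreover have "2 * M i j - (2 * p + 1) = 2 * (M i j - 1 - p) + 1" using that by simp
    ultimately show ?thesis using that(2) ceq_trans by metis
  qed
  have "bij_betw (\<lambda>p. ?m - 1 - p) {p. p < ?m \<and> t \<approx> alt i j (2 * p + 1)}
     {p. p < ?m \<and> t \<approx> alt j i (2 * p + 1)}"
    using *[of _ i j] *[of _ j i] assms
    by (intro bij_betw_byWitness[where f' = "\<lambda>p. ?m - 1 - p"]) (auto simp: M_sym[of j i])
  then show ?thesis by (simp add: par_alt bij_betw_same_card)
qed

lemma par_eqv: "u \<approx> v \<Longrightarrow> par u t = par v t"
proof (induction arbitrary: t rule: ceq.induct)
  case (ceq_app u v p q)
  have "rev u @ x @ u \<approx> rev v @ x @ v" for x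
  proof -
    have "rev u \<approx> rev v"
      using ceq_app.hyps by (metis append.right_neutral append_Nil ceq_append_left_swap ceq_rev_right ceq_sym ceq_trans rev_rev_ident ceq_append_right_iff)
    then show ?thesis using ceq_app.hyps by (intro ceq_append) auto
  qed
  then have "par q (rev u @ x @ u) = par q (rev v @ x @ v)" for x by (rule par_cong)
  from this[of "rev p @ t @ p"] show ?case using ceq_app.IH by (simp add: par_append)
next
  case (ceq_cancel i)
  have "t \<approx> [i] \<longleftrightarrow> i # t @ [i] \<approx> [i]"
    by (metis append_Nil append_Cons ceq_Cons_iff ceq_append_right_iff ceq_Cons_swap)
  then show ?case by simp
next
  case (ceq_braid i j)
  then show ?case by (rule par_braid)
qed simp_all

section \<open>Length and the exchange condition\<close>

definition len :: "nat list \<Rightarrow> nat" where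
  "len w = (LEAST n. \<exists>u. u \<approx> w \<and> length u = n)"

definition reduced :: "nat list \<Rightarrow> bool" where
  "reduced w \<longleftrightarrow> length w = len w"

lemma len_attained: "\<exists>u. u \<approx> w \<and> length u = len w"
  unfolding len_def by (rule LeastI_ex) blast

lemma len_le: "u \<approx> w \<Longrightarrow> len w \<le> length u"
  unfolding len_def by (rule Least_le) blast

lemma len_eqv: "u \<approx> w \<Longrightarrow> len u = len w"
  by (metis antisym ceq_sym ceq_trans len_attained len_le)

lemma len_parity: "even (len w) = even (length w)"
  using len_attained ceq_parity by metis

lemma len_Cons_ne: "len (i # w) \<noteq> len w"
  using len_parity[of w] len_parity[of "i # w"] by auto

lemma reducedI: "u \<approx> w \<Longrightarrow> length u \<le> len w \<Longrightarrow> reduced u"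
  using len_eqv len_le[of u w] by (simp add: reduced_def)

lemma reduced_append1: "reduced (u @ v) \<Longrightarrow> reduced u"
proof -
  assume r: "reduced (u @ v)"
  obtain u' where u': "u' \<approx> u" "length u' = len u" using len_attained by blast
  have "length (u @ v) \<le> length (u' @ v)" using r len_le[of "u' @ v" "u @ v"] u'(1) ceq_appR
    by (simp add: reduced_def)
  then show ?thesis using u' len_le[of u u] by (simp add: reduced_def)
qed

lemma reduced_append2: "reduced (u @ v) \<Longrightarrow> reduced v"
proof -
  assume r: "reduced (u @ v)"
  obtain v' where v': "v' \<approx> v" "length v' = len v" using len_attained by blast
  have "length (u @ v) \<le> length (u @ v')" using r len_le[of "u @ v'" "u @ v"] v'(1) ceq_appL
    by (simp add: reduced_def)
  then show ?thesis using v' len_le[of v v] by (simp add: reduced_def)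
qed

lemma not_reduced_double: "\<not> reduced (u @ i # i # v)"
proof
  assume "reduced (u @ i # i # v)"
  moreover have "u @ v \<approx> u @ i # i # v" by (intro ceq_appL ceq_sym[OF ceq_cancel2])
  ultimately show False using len_le[of "u @ v" "u @ i # i # v"] by (simp add: reduced_def)
qed

text \<open>Odd parity means that \<open>t\<close> is attached to some letter of \<open>w\<close>,
  and multiplying by the reflection attached to a letter removes that letter.\<close>

lemma par_imp_delete: "par w t \<Longrightarrow> \<exists>a k b. w = a @ k # b \<and> t @ w \<approx> a @ b"
proof (induction w arbitrary: t)
  case (Cons i w)
  show ?case
  proof (cases "t \<approx> [i]")
    case True
    then have "t @ i # w \<approx> [i] @ i # w" by (rule ceq_appR)
    then have "t @ i # w \<approx> w" by (metis append_Cons append_Nil ceq_cancel2 ceq_trans)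
    then show ?thesis by (intro exI[of _ "[]"]) auto
  next
    case False
    then have "par w (i # t @ [i])" using Cons.prems by simp
    then obtain a k b where "w = a @ k # b" "(i # t @ [i]) @ w \<approx> a @ b"
      using Cons.IH by blast
    then show ?thesis by (intro exI[of _ "i # a"] exI[of _ k] exI[of _ b]) (auto simp: ceq_Cons_swap)
  qed
qed simp

text \<open>If the reflection \<open>i\<close> is odd along \<open>w\<close>, a letter can be
  deleted. Otherwise it is odd along \<open>i # w\<close>, hence along a shortest word
  \<open>u\<close> for that element; deleting a letter of \<open>u\<close> would give a word for
  \<open>w\<close> shorter than \<open>len w\<close>.\<close>

lemma exchange:
  assumes "reduced w" "len (i # w) < len w"
  shows "\<exists>a k b. w = a @ k # b \<and> i # w \<approx> a @ b"
proof (cases "par w [i]")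
  case True
  then show ?thesis using par_imp_delete[of w "[i]"] by simp
next
  case False
  have "[i, i, i] \<approx> [i]" by (rule ceq_cancel2)
  then have *: "par (i # w) [i]" using False par_cong[of "[i, i, i]" "[i]" w] by simp
  obtain u where u: "u \<approx> i # w" "length u = len (i # w)" using len_attained by blast
  then obtain a k b where ab: "u = a @ k # b" "[i] @ u \<approx> a @ b"
    using * par_eqv[OF u(1)] par_imp_delete by blast
  have "w \<approx> i # u" using u(1) ceq_sym ceq_Cons_swap by blast
  then have "len w \<le> length (a @ b)" using ab(2) len_le ceq_sym ceq_trans by (metis append_Cons append_Nil)
  then show ?thesis using ab(1) u(2) assms by simp
qed

text \<open>\<open>len\<close> minimises over words in all letters, and equivalences may pass
  through foreign ones. Exchange only deletes letters, so the minimum is already attained over the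
  letters of the given word.\<close>

lemma reduced_subword: "\<exists>u. u \<approx> w \<and> reduced u \<and> set u \<subseteq> set w"
proof (induction w)
  case Nil
  have "reduced []" using len_le[of "[]" "[]"] by (simp add: reduced_def)
  then show ?case by (intro exI[of _ "[]"]) auto
next
  case (Cons i w)
  then obtain u where u: "u \<approx> w" "reduced u" "set u \<subseteq> set w" by blast
  have iu: "i # u \<approx> i # w" using u(1) by (rule ceq_Cons)
  consider "len (i # u) < len u" | "len (i # u) > len u" using len_Cons_ne[of i u] by linarith
  then show ?case
  proof cases
    case 1
    then obtain a k b where ab: "u = a @ k # b" "i # u \<approx> a @ b" using exchange u(2) by blast
    have "a @ b \<approx> i # w" using ab(2) iu ceq_sym ceq_trans by blast
    moreover have "len w \<le> Suc (len (i # w))"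
    proof -
      obtain x where x: "x \<approx> i # w" "length x = len (i # w)" using len_attained by blast
      then have "i # x \<approx> w" using ceq_Cons_swap by blast
      then show ?thesis using len_le x(2) by fastforce
    qed
    ultimately have "reduced (a @ b)" using u ab(1) len_eqv[OF u(1)]
      by (intro reducedI) (auto simp: reduced_def)
    then show ?thesis using \<open>a @ b \<approx> i # w\<close> u(3) ab(1) by (intro exI[of _ "a @ b"]) auto
  next
    case 2
    then have "reduced (i # u)" using u(2) len_le[of "i # u" "i # u"] by (simp add: reduced_def)
    then show ?thesis using iu u(3) by (intro exI[of _ "i # u"]) auto
  qed
qed

end

section \<open>The contragredient reflection representation\<close>

lemma cis_power_eq_1:
  assumes "m > 0" "cis (2 * pi / real m) ^ n = 1"
  shows "m dvd n"
proof -
  have "cos (real n * (2 * pi / real m)) = 1"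
    using arg_cong[OF assms(2), of Re] by (simp add: DeMoivre)
  then obtain k :: int where "real n * (2 * pi / real m) = of_int k * 2 * pi"
    unfolding cos_one_2pi_int by blast
  then have "real n = of_int k * real m" using assms(1) by (simp add: field_simps)
  then have "real_of_int (int n) = real_of_int (k * int m)" by simp
  then have "int n = k * int m" by (simp only: of_int_eq_iff)
  then show ?thesis by (metis dvd_triv_right int_dvd_int_iff)
qed

context coxeter
begin

text \<open>The contragredient of Tits' reflection representation; since only finitely many coordinates
  interact at a time, it makes sense for infinitely many generators.\<close>

definition cf :: "nat \<Rightarrow> nat \<Rightarrow> real" where
  "cf i j = 2 * cos (pi / real (M i j))"

definition act :: "nat \<Rightarrow> (nat \<Rightarrow> real) \<Rightarrow> nat \<Rightarrow> real" where
  "act i v = (\<lambda>j. if j = i then - v i else v j + cf i j * v i)"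

lemma cf_sym: "cf i j = cf j i"
  by (simp add: cf_def M_sym)

lemma act_act [simp]: "act i (act i v) = v"
  by (auto simp: act_def)

lemma foldr_act_rev: "foldr act u (foldr act (rev u) v) = v"
  by (induction u arbitrary: v) auto

lemma foldr_act_alt: "foldr act (alt i j (2 * n)) v = ((\<lambda>v. act i (act j v)) ^^ n) v"
  by (induction n) auto

context
  fixes i j :: nat and m :: nat and c :: real and \<zeta> :: complex
  assumes ij: "i \<noteq> j"
  defines "m \<equiv> M i j" and "c \<equiv> cf i j" and "\<zeta> \<equiv> cis (2 * pi / real (M i j))"
begin

abbreviation "rot \<equiv> (\<lambda>v. act i (act j v))"

lemma rot_i: "rot v i = - (v i + c * v j)"
  and rot_j: "rot v j = - v j + c * (v i + c * v j)"
  and rot_other: "k \<noteq> i \<Longrightarrow> k \<noteq> j \<Longrightarrow> rot v k = v k + cf j k * v j + cf i k * (v i + c * v j)"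
  using ij by (auto simp: act_def c_def cf_sym[of j i])

lemma c_square: "complex_of_real (c * c) * \<zeta> = (1 + \<zeta>) ^ 2"
proof -
  let ?x = "pi / real (M i j)"
  have z: "\<zeta> = cis ?x * cis ?x" unfolding \<zeta>_def cis_mult by (rule arg_cong[of _ _ cis]) simp
  have "complex_of_real c = cis ?x + cis (- ?x)"
    by (simp add: c_def cf_def complex_eq_iff)
  then have "complex_of_real c * cis ?x = \<zeta> + 1"
    by (simp add: z distrib_right cis_mult)
  then have "(complex_of_real c * cis ?x) ^ 2 = (1 + \<zeta>) ^ 2" by (simp add: add.commute)
  then show ?thesis by (simp add: z power2_eq_square mult_ac)
qed

text \<open>The hypothesis is the characteristic equation of the rotation on the coordinates
  \<open>i\<close> and \<open>j\<close> (trace c^2 - 2, determinant 1), and c v_i + (1 + z) v_j is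
  the corresponding left eigenvector. The roots are \<open>\<zeta>\<close> and its inverse.\<close>

lemma psi_rot:
  assumes "z * z - (complex_of_real (c * c) - 2) * z + 1 = 0"
  shows "complex_of_real c * of_real (rot v i) + (1 + z) * of_real (rot v j) =
    z * (complex_of_real c * of_real (v i) + (1 + z) * of_real (v j))"
proof -
  have "complex_of_real c * of_real (rot v i) + (1 + z) * of_real (rot v j) -
    z * (complex_of_real c * of_real (v i) + (1 + z) * of_real (v j)) =
    - (z * z - (complex_of_real (c * c) - 2) * z + 1) * of_real (v j)"
    by (simp only: rot_i rot_j of_real_add of_real_mult of_real_minus) (simp add: algebra_simps)
  also have "\<dots> = 0" unfolding assms by simp
  finally show ?thesis by simp
qed

lemma zeta_root: "\<zeta> * \<zeta> - (complex_of_real (c * c) - 2) * \<zeta> + 1 = 0"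
  using c_square by (simp add: algebra_simps power2_eq_square)

lemma zeta_inv_root: "inverse \<zeta> * inverse \<zeta> - (complex_of_real (c * c) - 2) * inverse \<zeta> + 1 = 0"
proof -
  have "\<zeta> \<noteq> 0" by (simp add: \<zeta>_def)
  then have "inverse \<zeta> * inverse \<zeta> - (complex_of_real (c * c) - 2) * inverse \<zeta> + 1 =
    (\<zeta> * \<zeta> - (complex_of_real (c * c) - 2) * \<zeta> + 1) * inverse \<zeta> * inverse \<zeta>"
    by (simp add: field_simps)
  then show ?thesis using zeta_root by simp
qed

lemma psi_rot_pow:
  assumes "z * z - (complex_of_real (c * c) - 2) * z + 1 = 0"
  shows "complex_of_real c * of_real ((rot ^^ n) v i) + (1 + z) * of_real ((rot ^^ n) v j) =
    z ^ n * (complex_of_real c * of_real (v i) + (1 + z) * of_real (v j))"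
proof (induction n)
  case (Suc n)
  show ?case
    unfolding funpow.simps o_apply psi_rot[OF assms] Suc by simp
qed simp

lemma rot_order:
  assumes "\<And>v. (rot ^^ n) v = v"
  shows "m dvd n"
proof -
  define v where "v = (\<lambda>k. if k = j then 1 else 0 :: real)"
  have v: "v i = 0" "v j = 1" using ij by (auto simp: v_def)
  consider "m = 0" | "m = 2" | "m > 2" using M_ne1[OF ij] m_def by force
  then show ?thesis
  proof cases
    case 1
    \<comment> \<open>Division by 0 turns the angle into 0, which gives c = 2: the rotation is
      unipotent but not trivial on the two coordinates, and v_j grows linearly.\<close>
    then have c: "c = 2" by (simp add: c_def cf_def m_def)
    have "(rot ^^ n) v i + (rot ^^ n) v j = 1 \<and> (rot ^^ n) v j = 1 + 2 * real n" for n
    proof (induction n)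
      case (Suc n)
      then show ?case unfolding funpow.simps o_apply rot_i rot_j c by simp
    qed (simp add: v)
    from this[of n] show ?thesis unfolding assms v by simp
  next
    case 2
    \<comment> \<open>Here \<open>\<zeta>\<close> is -1 and the eigenfunctional c v_i + (1 + z) v_j
      is zero, so the coordinate \<open>j\<close> is followed directly.\<close>
    then have c: "c = 0" by (simp add: c_def cf_def m_def)
    have "(rot ^^ n) v j = (- 1) ^ n" for n
    proof (induction n)
      case (Suc n)
      then show ?case unfolding funpow.simps o_apply rot_j c by simp
    qed (simp add: v)
    from this[of n] show ?thesis unfolding assms v 2 by (metis neg_one_odd_power one_neq_neg_one)
  next
    case 3
    have "1 + \<zeta> \<noteq> 0"
    proof
      assume "1 + \<zeta> = 0"
      then have "\<zeta> = - 1" by (simp add: add_eq_0_iff)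
      then have "\<zeta> ^ 2 = 1" by simp
      then have "m dvd 2" using 3 cis_power_eq_1[of m 2] by (simp add: \<zeta>_def m_def)
      then show False using 3 by (auto dest: dvd_imp_le)
    qed
    moreover have "1 + \<zeta> = \<zeta> ^ n * (1 + \<zeta>)"
      using psi_rot_pow[OF zeta_root, of n v] unfolding assms v by simp
    ultimately have "\<zeta> ^ n = 1" by simp
    then show ?thesis using 3 cis_power_eq_1[of m n] by (simp add: \<zeta>_def m_def)
  qed
qed

text \<open>On the coordinates \<open>i\<close> and \<open>j\<close> the eigenvalues are m-th roots
  of unity. Any other coordinate changes at each step by a fixed combination of these two, so its
  total change is a sum over a full period, which vanishes as a geometric sum.\<close>

lemma rot_pow_eq_id:
  assumes "m > 0"
  shows "(rot ^^ m) v = v"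
proof -
  have zm: "\<zeta> ^ m = 1" using assms by (simp add: \<zeta>_def m_def DeMoivre)
  have main: "(rot ^^ m) v i = v i \<and> (rot ^^ m) v j = v j \<and>
     (\<Sum>n<m. (rot ^^ n) v i) = 0 \<and> (\<Sum>n<m. (rot ^^ n) v j) = 0"
  proof (cases "m = 2")
    case True
    then have c: "c = 0" by (simp add: c_def cf_def m_def)
    show ?thesis unfolding True
      by (simp add: numeral_2_eq_2 lessThan_Suc rot_i rot_j c del: funpow.simps) (simp add: rot_i rot_j c)
  next
    case False
    then have m: "m > 2" using M_ne1[OF ij] m_def assms by force
    have z0: "\<zeta> \<noteq> 0" by (simp add: \<zeta>_def)
    have z1: "\<zeta> ^ 2 \<noteq> 1"
    proof
      assume "\<zeta> ^ 2 = 1"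
      then have "m dvd 2" using m cis_power_eq_1[of m 2] by (simp add: \<zeta>_def m_def)
      then show False using m by (auto dest: dvd_imp_le)
    qed
    then have zne: "\<zeta> \<noteq> inverse \<zeta>" using z0 by (auto simp: power2_eq_square field_simps)
    have cne: "complex_of_real c \<noteq> 0"
    proof
      assume "complex_of_real c = 0"
      then have "\<zeta> = - 1" using c_square by (simp add: add_eq_0_iff)
      then show False using z1 by simp
    qed
    have solve: "x = x' \<and> y = y'"
      if "complex_of_real c * of_real x + (1 + \<zeta>) * of_real y = complex_of_real c * of_real x' + (1 + \<zeta>) * of_real y'"
        "complex_of_real c * of_real x + (1 + inverse \<zeta>) * of_real y = complex_of_real c * of_real x' + (1 + inverse \<zeta>) * of_real y'"
      for x y x' y' :: real
    proof -
      have "(\<zeta> - inverse \<zeta>) * (of_real y - of_real y') = 0" using that by Groebner_Basis.algebra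
      then have "y = y'" using zne by simp
      then show ?thesis using that(1) cne by simp
    qed
    have 1: "(rot ^^ m) v i = v i \<and> (rot ^^ m) v j = v j"
      by (rule solve) (simp_all add: psi_rot_pow[OF zeta_root] psi_rot_pow[OF zeta_inv_root] zm power_inverse)
    have gs: "(\<Sum>n<m. z ^ n) = 0" if "z ^ m = 1" "z \<noteq> 1" for z :: complex
      using that by (simp add: geometric_sum)
    have sums: "complex_of_real c * of_real (\<Sum>n<m. (rot ^^ n) v i) + (1 + z) * of_real (\<Sum>n<m. (rot ^^ n) v j) = 0"
      if "z * z - (complex_of_real (c * c) - 2) * z + 1 = 0" "z ^ m = 1" "z \<noteq> 1" for z
    proof -
      have "complex_of_real c * of_real (\<Sum>n<m. (rot ^^ n) v i) + (1 + z) * of_real (\<Sum>n<m. (rot ^^ n) v j) =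
        (\<Sum>n<m. z ^ n * (complex_of_real c * of_real (v i) + (1 + z) * of_real (v j)))"
        unfolding of_real_sum sum_distrib_left sum.distrib[symmetric] psi_rot_pow[OF that(1)] ..
      also have "\<dots> = 0" unfolding sum_distrib_right[symmetric] gs[OF that(2,3)] by simp
      finally show ?thesis .
    qed
    have "\<zeta> \<noteq> 1" using z1 by auto
    then have 2: "(\<Sum>n<m. (rot ^^ n) v i) = 0 \<and> (\<Sum>n<m. (rot ^^ n) v j) = 0"
      using zm by (intro solve) (simp_all only: sums[OF zeta_root] sums[OF zeta_inv_root] power_inverse
        inverse_1 inverse_eq_1_iff of_real_0 mult_zero_right add_0_right not_False_eq_True)
    show ?thesis using 1 2 by blast
  qed
  have "(rot ^^ m) v k = v k" if "k \<noteq> i" "k \<noteq> j" for k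
  proof -
    have "(rot ^^ m) v k - v k = (\<Sum>n<m. (rot ^^ Suc n) v k - (rot ^^ n) v k)"
      using sum_lessThan_telescope[of "\<lambda>n. (rot ^^ n) v k" m] by simp
    also have "\<dots> = (\<Sum>n<m. cf j k * (rot ^^ n) v j + cf i k * ((rot ^^ n) v i + c * (rot ^^ n) v j))"
      unfolding funpow.simps o_apply rot_other[OF that] by (simp add: algebra_simps)
    also have "\<dots> = cf j k * (\<Sum>n<m. (rot ^^ n) v j) + cf i k * ((\<Sum>n<m. (rot ^^ n) v i) + c * (\<Sum>n<m. (rot ^^ n) v j))"
      by (simp only: sum.distrib sum_distrib_left distrib_left)
    finally show ?thesis using main by simp
  qed
  then show ?thesis using main by (intro ext) metis
qed

end

lemma foldr_act_eqv: "u \<approx> w \<Longrightarrow> foldr act u v = foldr act w v"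
proof (induction arbitrary: v rule: ceq.induct)
  case (ceq_braid i j)
  let ?m = "M i j"
  have "alt i j ?m @ rev (alt j i ?m) = alt i j (2 * ?m)"
    using alt_append[of i j ?m ?m] by (simp add: rev_alt mult_2)
  then have *: "foldr act (alt i j ?m) (foldr act (rev (alt j i ?m)) x) = x" for x
    using rot_pow_eq_id[OF ceq_braid(1,2), of x] by (metis foldr_act_alt foldr_append)
  then show ?case using foldr_act_rev[of "rev (alt j i ?m)" v] by (metis rev_rev_ident)
qed auto

lemma alt_order: "i \<noteq> j \<Longrightarrow> alt i j (2 * n) \<approx> [] \<Longrightarrow> M i j dvd n"
  by (rule rot_order) (use foldr_act_eqv[of "alt i j (2 * n)" "[]"] in \<open>auto simp: foldr_act_alt\<close>)

text \<open>Among the words for \<open>w\<close> take one with the longest alternating prefix in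
  \<open>i\<close> and \<open>j\<close>. Prepending the other letter must delete a letter of this
  prefix, since otherwise the prefix could be extended; reducedness makes it the last one. Hence the
  prefix of length p equals its mirror image, so \<open>M i j\<close> divides p, and p cannot exceed
  it because longer alternating words are not reduced. The set \<open>S\<close> keeps the alphabet
  under control.\<close>

lemma two_descents:
  assumes w: "reduced w" "set w \<subseteq> S" and ij: "i \<in> S" "j \<in> S" "i \<noteq> j"
    and desc: "len (i # w) < len w" "len (j # w) < len w"
  shows "M i j > 0 \<and> (\<exists>v. set v \<subseteq> S \<and> w \<approx> alt i j (M i j) @ v \<and> length v + M i j = length w)"
proof -
  define P where "P p \<longleftrightarrow> (\<exists>v x y. set v \<subseteq> S \<and> {x, y} = {i, j} \<and> w \<approx> alt x y p @ v \<and> length v + p = length w)" for p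
  have PI: "P p" if "set v \<subseteq> S" "{x, y} = {i, j}" "w \<approx> alt x y p @ v" "length v + p = length w" for p v x y
    using that unfolding P_def by blast
  have "P 1"
  proof -
    obtain a k b where ab: "w = a @ k # b" "i # w \<approx> a @ b" using exchange w desc by blast
    have "w \<approx> i # (a @ b)" using ab(2) ceq_Cons_swap by blast
    then show ?thesis using w(2) ab(1) by (intro PI[of "a @ b" i j]) auto
  qed
  moreover have bound: "\<forall>p. P p \<longrightarrow> p \<le> length w" by (auto simp: P_def)
  ultimately have gr: "P (Greatest P)" "\<And>p. P p \<Longrightarrow> p \<le> Greatest P"
    using GreatestI_nat[of P 1 "length w"] Greatest_le_nat[of P _ "length w"] by blast+
  define p where "p = Greatest P"
  have p1: "p \<ge> 1" using gr(2) \<open>P 1\<close> p_def by simp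
  obtain v x y where v: "set v \<subseteq> S" "{x, y} = {i, j}" "w \<approx> alt x y p @ v" "length v + p = length w"
    using gr(1) unfolding p_def P_def by blast
  have xy: "x \<noteq> y" "M x y = M i j" using v(2) ij(3) M_sym by (auto simp: doubleton_eq_iff)
  let ?u = "alt x y p @ v"
  have ru: "reduced ?u" using v w(1) ceq_sym by (intro reducedI[of _ w]) (auto simp: reduced_def)
  have "len (y # w) < len w" using v(2) desc by (auto simp: doubleton_eq_iff)
  then have "len (y # ?u) < len ?u" using len_eqv[OF v(3)] len_eqv[OF ceq_Cons[OF v(3)], of y] by simp
  then obtain a k b where ab: "?u = a @ k # b" "y # ?u \<approx> a @ b" using exchange ru by blast
  have "length a < p"
  proof (rule ccontr)
    assume "\<not> length a < p"
    then have ap: "p \<le> length a" by simp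
    define a' where "a' = drop p a"
    have "alt x y p = take p a" "v = a' @ k # b"
      using arg_cong[OF ab(1), of "take p"] arg_cong[OF ab(1), of "drop p"] ap by (simp_all add: a'_def)
    then have a': "a = alt x y p @ a'" "v = a' @ k # b" by (simp_all add: a'_def)
    have "y # ?u \<approx> alt x y p @ a' @ b" using ab(2) a' by simp
    then have "?u \<approx> y # alt x y p @ a' @ b" by (simp only: ceq_Cons_swap)
    from ceq_trans[OF v(3) this] have "w \<approx> alt y x (Suc p) @ a' @ b" by simp
    then have "P (Suc p)" using v a'(2) by (intro PI[of "a' @ b" y x]) auto
    then show False using gr(2) p_def by fastforce
  qed
  define q where "q = length a"
  define x' y' where "x' = (if even q then x else y)" and "y' = (if even q then y else x)"
  have q: "q < p" using \<open>length a < p\<close> q_def by simp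
  have "alt x y p = alt x y q @ alt x' y' (p - q)"
    using alt_append[of x y q "p - q"] q by (simp add: x'_def y'_def)
  also have "\<dots> = alt x y q @ x' # alt y' x' (p - q - 1)" using q by (cases "p - q") auto
  finally have split: "alt x y p = alt x y q @ x' # alt y' x' (p - q - 1)" .
  let ?b = "alt y' x' (p - q - 1)"
  have a: "a = alt x y q" and b: "b = ?b @ v"
  proof -
    have "alt x y q @ (x' # ?b @ v) = a @ (k # b)" using ab(1) split by simp
    moreover have "length (alt x y q) = length a" by (simp add: q_def)
    ultimately show "a = alt x y q" "b = ?b @ v" by (auto dest: append_eq_append_conv[THEN iffD1, rotated])
  qed
  have "alt x y p @ v \<approx> (y # alt x y q @ ?b) @ v"
    using ab(2) unfolding a b by (simp add: ceq_Cons_swap)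
  then have eq: "alt x y p \<approx> y # alt x y q @ ?b" by (simp only: ceq_append_right_iff)
  have red: "reduced (y # alt x y q @ ?b)"
    using reduced_append1[OF ru] q by (intro reducedI[OF ceq_sym[OF eq]]) (simp add: reduced_def)
  \<comment> \<open>Deleting any other letter of the prefix would leave two equal neighbours after
    \<open>y\<close> is put in front.\<close>
  have qp: "q = p - 1"
  proof (rule ccontr)
    assume "q \<noteq> p - 1"
    then obtain n where n: "p - q - 1 = Suc n" using q by (cases "p - q - 1") auto
    show False
    proof (cases q)
      case 0
      then show False using red n not_reduced_double[of "[]" y] by (simp add: y'_def)
    next
      case (Suc q')
      then have "alt x y q = alt x y q' @ [y']" using alt_Suc_snoc[of x y q'] by (simp add: y'_def)
      then show False using red n not_reduced_double[of "y # alt x y q'" y'] by simp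
    qed
  qed
  then have flip: "alt x y p \<approx> alt y x p" using eq p1 by (cases p) auto
  have "alt x y (2 * p) \<approx> []"
  proof -
    have "alt x y (2 * p) = alt x y p @ rev (alt y x p)"
      using alt_append[of x y p p] by (simp add: rev_alt mult_2)
    also have "\<dots> \<approx> alt y x p @ rev (alt y x p)" using flip by (rule ceq_appR)
    also have "\<dots> \<approx> []" by (rule ceq_rev_right)
    finally show ?thesis .
  qed
  then have dvd: "M x y dvd p" using alt_order xy(1) by blast
  then have pos: "M x y > 0" and le: "M x y \<le> p" using p1 by (auto intro: Nat.gr0I dest: dvd_imp_le)
  have "\<not> M x y < p"
  proof
    assume lt: "M x y < p"
    have "reduced (alt x y (Suc (M x y)))"
    proof -
      have "alt x y p = alt x y (Suc (M x y)) @ (if even (Suc (M x y)) then alt x y (p - Suc (M x y)) else alt y x (p - Suc (M x y)))"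
        using alt_append[of x y "Suc (M x y)" "p - Suc (M x y)"] lt by (simp del: alt.simps)
      then show ?thesis using reduced_append1[OF ru] reduced_append1 by metis
    qed
    moreover have "alt x y (Suc (M x y)) \<approx> alt y x (2 * M x y - Suc (M x y))"
      using pos by (intro alt_flip[OF xy(1)]) linarith+
    ultimately show False using len_le[OF ceq_sym, of "alt x y (Suc (M x y))" "alt y x (2 * M x y - Suc (M x y))"] pos
      by (simp add: reduced_def del: alt.simps)
  qed
  then have pm: "p = M x y" using le by simp
  have "w \<approx> alt i j p @ v"
  proof (cases "x = i")
    case True
    then show ?thesis using v(2,3) ij(3) by (auto simp: doubleton_eq_iff)
  next
    case False
    then have "x = j" "y = i" using v(2) by (auto simp: doubleton_eq_iff)
    then show ?thesis using v(3) ceq_appR[OF flip] ceq_trans by blast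
  qed
  then show ?thesis using v(1,4) pm pos xy(2) by auto
qed

end

section \<open>Polygon groups\<close>

text \<open>1 minus the left side is the determinant of the Gram matrix of the three sides. It
  vanishes for Euclidean triangles, and shrinking an angle only increases the cosines.\<close>

lemma cos_triangle_le_pi:
  fixes A B C :: real
  assumes "0 \<le> A" "A \<le> pi / 2" "0 \<le> B" "B \<le> pi / 2" "0 \<le> C" "C \<le> pi / 2" "A + B + C \<le> pi"
  shows "(cos A)\<^sup>2 + (cos B)\<^sup>2 + (cos C)\<^sup>2 + 2 * cos A * cos B * cos C \<ge> 1"
proof (cases "A + B \<ge> pi / 2")
  case True
  \<comment> \<open>The cosine of the third angle of the Euclidean triangle with angles
    \<open>A\<close> and \<open>B\<close>.\<close>
  define z where "z = sin A * sin B - cos A * cos B"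
  have z: "z = cos (pi - (A + B))" by (simp add: z_def cos_add cos_diff)
  have "z \<ge> 0" unfolding z using True assms by (intro cos_ge_zero) auto
  moreover have "cos C \<ge> z" unfolding z using assms by (intro cos_monotone_0_pi_le) auto
  moreover have "cos A \<ge> 0" "cos B \<ge> 0" using assms by (auto intro!: cos_ge_zero)
  ultimately have "(cos C - z) * (cos C + z + 2 * (cos A * cos B)) \<ge> 0" by simp
  moreover have "z * (z + 2 * (cos A * cos B)) = 1 - (cos A)\<^sup>2 - (cos B)\<^sup>2"
  proof -
    have "z * (z + 2 * (cos A * cos B)) = (sin A)\<^sup>2 * (sin B)\<^sup>2 - (cos A)\<^sup>2 * (cos B)\<^sup>2"
      by (simp add: z_def algebra_simps power2_eq_square)
    then show ?thesis by (simp add: sin_squared_eq algebra_simps)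
  qed
  ultimately show ?thesis by (simp add: algebra_simps power2_eq_square)
next
  case False
  have "sin A = cos (pi / 2 - A)" by (simp add: cos_diff)
  also have "\<dots> \<le> cos B" using False assms by (intro cos_monotone_0_pi_le) auto
  finally have "(sin A)\<^sup>2 \<le> (cos B)\<^sup>2" using assms by (intro power_mono) (auto intro!: sin_ge_zero)
  moreover have "cos A \<ge> 0" "cos B \<ge> 0" "cos C \<ge> 0" using assms by (auto intro!: cos_ge_zero)
  then have "cos A * cos B * cos C \<ge> 0" by simp
  ultimately show ?thesis using zero_le_power2[of "cos C"]
    unfolding sin_squared_eq mult.assoc by linarith
qed

text \<open>T at least 2 makes the increments nondecreasing as long as the terms are
  nonnegative.\<close>

lemma linear_recurrence_strict_mono:
  fixes w :: "nat \<Rightarrow> real"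
  assumes "\<And>n. w (n + 2) = T * w (n + 1) - w n" "T \<ge> 2" "w 0 \<ge> 0" "w 1 > w 0"
  shows "strict_mono w"
proof -
  have "w n \<ge> 0 \<and> w (Suc n) > w n" for n
  proof (induction n)
    case (Suc n)
    have "T * w (Suc n) \<ge> 2 * w (Suc n)" using Suc assms(2) by (intro mult_right_mono) auto
    then show ?case using Suc assms(1)[of n] by (simp only: Suc_eq_plus1 add_2_eq_Suc') linarith
  qed (use assms in auto)
  then show ?thesis by (simp add: strict_mono_Suc_iff)
qed

context coxeter
begin

text \<open>The product of the three reflections acts on the coordinates \<open>i\<close>,
  \<open>j\<close>, \<open>k\<close> with characteristic polynomial (x + 1)(x^2 - T x + 1), where T
  is \<open>?T\<close>. Adding consecutive terms of an orbit removes the eigenvalue -1. The Gram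
  determinant condition says that T is at least 2, so the resulting sequence increases strictly and
  the orbit never returns.\<close>

lemma coxeter_element_infinite_order:
  fixes i j k :: nat
  defines "a \<equiv> cf i j" and "b \<equiv> cf j k" and "c \<equiv> cf i k"
  assumes ijk: "i \<noteq> j" "j \<noteq> k" "i \<noteq> k"
    and T: "a * a + b * b + c * c + a * b * c \<ge> 4"
    and nonneg: "a \<ge> 0" "b \<ge> 0" "c \<ge> 0" and pos: "c > 0 \<or> a > 0 \<and> b > 0"
    and triv: "concat (replicate n [k, j, i]) \<approx> []"
  shows "n = 0"
proof -
  let ?h = "\<lambda>v. act k (act j (act i v))"
  let ?T = "a * a + b * b + c * c + a * b * c - 2"
  note sym = cf_sym[of j i] cf_sym[of k j] cf_sym[of k i]
  have h: "?h v i = - v i + a * (v j + a * v i) + c * (v k + c * v i + b * (v j + a * v i))"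
     "?h v j = - (v j + a * v i) + b * (v k + c * v i + b * (v j + a * v i))"
     "?h v k = - (v k + c * v i + b * (v j + a * v i))" for v
    using ijk by (simp_all add: act_def a_def b_def c_def sym)
  define v where "v = (\<lambda>l. if l = k then 1 else 0 :: real)"
  define y where "y n = (?h ^^ n) v i" for n
  define w where "w n = y n + y (Suc n)" for n
  have rec: "?h (?h (?h u)) i = (?T - 1) * (?h (?h u) i + ?h u i) - u i" for u
  proof -
    define x1 x2 x3 where "x1 = u i" and "x2 = u j" and "x3 = u k"
    define y1 y2 y3 where "y1 = ?h u i" and "y2 = ?h u j" and "y3 = ?h u k"
    define z1 z2 z3 where "z1 = ?h (?h u) i" and "z2 = ?h (?h u) j" and "z3 = ?h (?h u) k"
    have y: "y1 = - x1 + a * (x2 + a * x1) + c * (x3 + c * x1 + b * (x2 + a * x1))"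
      "y2 = - (x2 + a * x1) + b * (x3 + c * x1 + b * (x2 + a * x1))"
      "y3 = - (x3 + c * x1 + b * (x2 + a * x1))"
      unfolding y1_def y2_def y3_def x1_def x2_def x3_def by (rule h)+
    have z: "z1 = - y1 + a * (y2 + a * y1) + c * (y3 + c * y1 + b * (y2 + a * y1))"
      "z2 = - (y2 + a * y1) + b * (y3 + c * y1 + b * (y2 + a * y1))"
      "z3 = - (y3 + c * y1 + b * (y2 + a * y1))"
      unfolding y1_def y2_def y3_def z1_def z2_def z3_def by (rule h)+
    have "?h (?h (?h u)) i = - z1 + a * (z2 + a * z1) + c * (z3 + c * z1 + b * (z2 + a * z1))"
      unfolding z1_def z2_def z3_def by (rule h)
    also have "\<dots> = (?T - 1) * (z1 + y1) - x1" using y z by Groebner_Basis.algebra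
    finally show ?thesis by (simp only: z1_def y1_def x1_def)
  qed
  have "w (n + 2) = ?T * w (n + 1) - w n" for n
    using rec[of "(?h ^^ n) v"] by (simp add: w_def y_def numeral_2_eq_2 algebra_simps)
  moreover have "y 0 = 0" using ijk by (simp add: y_def v_def)
  moreover have "y 1 = c" using ijk h(1)[of v] by (simp add: y_def v_def)
  moreover have "y 2 = c * ?T + a * b"
    unfolding y_def numeral_2_eq_2 funpow.simps o_apply id_apply h using ijk
    by (simp add: v_def algebra_simps)
  moreover have "c * ?T + a * b > 0"
  proof -
    have "c * ?T \<ge> c * 2" using T nonneg by (intro mult_left_mono) auto
    then show ?thesis using pos nonneg by (smt (verit) mult_nonneg_nonneg mult_pos_pos)
  qed
  ultimately have "strict_mono w" using T nonneg
    by (intro linear_recurrence_strict_mono[of w ?T]) (auto simp: w_def numeral_2_eq_2)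
  have id: "(?h ^^ n) u = u" for u
  proof -
    have "(?h ^^ n) u = foldr act (concat (replicate n [k, j, i])) u" by (induction n) auto
    then show ?thesis using foldr_act_eqv[OF triv] by simp
  qed
  have "w n = w 0" by (simp add: w_def y_def id)
  then show "n = 0" using \<open>strict_mono w\<close> strict_mono_eq by blast
qed

end

lemma angle_term:
  "1 - 1 / ereal_of_enat e = (case e of enat n \<Rightarrow> if n = 0 then -\<infinity> else ereal (1 - 1 / real n) | \<infinity> \<Rightarrow> 1)"
  by (cases e) (auto simp: one_ereal_def zero_ereal_def[symmetric])

text \<open>Every summand is at least 1/2, so four of them, or one equal to 1 together with two
  others, already reach 2.\<close>

lemma angle_sum_ge_2_iff:
  fixes m :: "nat \<Rightarrow> enat"
  assumes r: "r \<ge> 3" and m: "\<And>j. j \<in> {1..r} \<Longrightarrow> m j \<ge> 2"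
  shows "(\<Sum>j=1..r. 1 - 1 / ereal_of_enat (m j)) \<ge> 2 \<longleftrightarrow>
    r \<ge> 4 \<or> (\<exists>j\<in>{1..r}. m j = \<infinity>) \<or>
    1 / real (the_enat (m 1)) + 1 / real (the_enat (m 2)) + 1 / real (the_enat (m 3)) \<le> 1"
proof -
  define x where "x j = (if m j = \<infinity> then 1 else 1 - 1 / real (the_enat (m j)))" for j
  have "1 - 1 / ereal_of_enat (m j) = ereal (x j)" if "j \<in> {1..r}" for j
    using m[OF that] unfolding angle_term x_def
    by (cases "m j") (auto simp: one_ereal_def numeral_eq_enat)
  then have sum: "(\<Sum>j=1..r. 1 - 1 / ereal_of_enat (m j)) = ereal (\<Sum>j=1..r. x j)"
    by simp
  have x: "x j \<ge> 1 / 2" if "j \<in> {1..r}" for j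
    using m[OF that] by (cases "m j") (auto simp: x_def numeral_eq_enat field_simps)
  have le: "(\<Sum>j\<in>A. 1 / 2) \<le> (\<Sum>j\<in>A. x j)" if "A \<subseteq> {1..r}" for A
    using that x by (intro sum_mono) blast
  show ?thesis
  proof (cases "r \<ge> 4 \<or> (\<exists>j\<in>{1..r}. m j = \<infinity>)")
    case True
    have "(\<Sum>j=1..r. x j) \<ge> 2"
    proof (cases "r \<ge> 4")
      case True
      then show ?thesis using le[of "{1..r}"] by simp
    next
      case False
      then obtain j where j: "j \<in> {1..r}" "m j = \<infinity>" using True by blast
      have "(\<Sum>j=1..r. x j) = x j + (\<Sum>j\<in>{1..r} - {j}. x j)"
        using j(1) by (simp add: sum.remove)
      then show ?thesis using le[of "{1..r} - {j}"] j r by (simp add: x_def)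
    qed
    then show ?thesis using True unfolding sum by (metis ereal_less_eq(3) numeral_eq_ereal)
  next
    case False
    then have "r = 3" using r by simp
    moreover from this have "{1..r} = {1, 2, 3}" by auto
    ultimately have "(\<Sum>j=1..r. x j) = 3 - (1 / real (the_enat (m 1)) + 1 / real (the_enat (m 2)) + 1 / real (the_enat (m 3)))"
      using False by (auto simp: x_def)
    then have "(\<Sum>j=1..r. x j) \<ge> 2 \<longleftrightarrow> 1 / real (the_enat (m 1)) + 1 / real (the_enat (m 2)) + 1 / real (the_enat (m 3)) \<le> 1"
      by auto
    then show ?thesis using False unfolding sum by (metis ereal_less_eq(3) numeral_eq_ereal)
  qed
qed

text \<open>\<open>0\<close> encodes an infinite order.\<close>

definition enat_order :: "enat \<Rightarrow> nat" where
  "enat_order e = (if e = \<infinity> then 0 else the_enat e)"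

text \<open>The group generated by the reflections in the sides \<open>0, \<dots>, r - 1\<close> of an \<open>r\<close>-gon, where the
  sides \<open>j - 1\<close> and \<open>j mod r\<close> enclose the angle \<open>\<pi> / m\<^sub>j\<close>; its rotation subgroup is \<open>\<Gamma>\<close> with
  \<open>c\<^sub>j = s\<^sub>j\<^sub>-\<^sub>1 s\<^sub>j\<close>.\<close>

definition polygon_matrix :: "nat \<Rightarrow> (nat \<Rightarrow> enat) \<Rightarrow> nat \<Rightarrow> nat \<Rightarrow> nat" where
  "polygon_matrix r m i k =
    (if i < r \<and> k < r then
       if k = Suc i then enat_order (m k) else if i = Suc k then enat_order (m i)
       else if i = 0 \<and> Suc k = r \<or> k = 0 \<and> Suc i = r then enat_order (m r) else 0
     else 0)"

locale polygon =
  fixes r :: nat and m :: "nat \<Rightarrow> enat"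
  assumes r3: "r \<ge> 3" and m2: "\<And>j. j \<in> {1..r} \<Longrightarrow> m j \<ge> 2"
begin

abbreviation "M \<equiv> polygon_matrix r m"

sublocale coxeter M
proof
  have "enat_order (m j) \<noteq> 1" if "j \<in> {1..r}" for j
    using m2[OF that] by (cases "m j") (auto simp: enat_order_def numeral_eq_enat)
  then show "M i j \<noteq> 1" for i j by (auto simp: polygon_matrix_def)
  show "M i j = M j i" for i j using r3 by (auto simp: polygon_matrix_def)
qed

abbreviation polygon_eqv (infix "\<approx>" 50) where "u \<approx> v \<equiv> ceq M u v"

lemma polygon_matrix_edge:
  "j \<in> {1..r} \<Longrightarrow> M (j - 1) (j mod r) = enat_order (m j)"
  using r3 by (cases "j = r") (auto simp: polygon_matrix_def)

lemma polygon_matrix_pos: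
  assumes "M i k > 0"
  obtains j where "j \<in> {1..r}" "{i, k} = {j - 1, j mod r}" "m j = enat (M i k)"
proof -
  have fin: "m j = enat (enat_order (m j))" if "enat_order (m j) > 0" for j
    using that by (cases "m j") (auto simp: enat_order_def)
  consider "k = Suc i" "k < r" "M i k = enat_order (m k)" | "i = Suc k" "i < r" "M i k = enat_order (m i)"
    | "{i, k} = {0, r - 1}" "M i k = enat_order (m r)"
    using assms by (auto simp: polygon_matrix_def insert_commute split: if_splits)
  then show ?thesis
  proof cases
    case 1 then show ?thesis using that[of k] fin[of k] assms by auto
  next
    case 2 then show ?thesis using that[of i] fin[of i] assms by auto
  next
    case 3 then show ?thesis using that[of r] fin[of r] assms r3 by auto
  qed
qed

lemma concat_replicate_alt: "concat (replicate n [i, k]) = alt i k (2 * n)"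
  by (induction n) auto

text \<open>Two sides that are not adjacent, or that enclose the angle 0, have a product of infinite
  order. This leaves triangles with three positive angles, where a Coxeter element is used.\<close>

lemma infinite_order_word:
  assumes "(\<Sum>j=1..r. 1 - 1 / ereal_of_enat (m j)) \<ge> 2"
  shows "\<exists>g. set g \<subseteq> {..<r} \<and> even (length g) \<and> (\<forall>n. concat (replicate n g) \<approx> [] \<longrightarrow> n = 0)"
proof -
  have two: ?thesis if "i < r" "k < r" "i \<noteq> k" "M i k = 0" for i k
    using alt_order[OF that(3)] that by (intro exI[of _ "[i, k]"]) (auto simp: concat_replicate_alt)
  consider "r \<ge> 4" | j where "j \<in> {1..r}" "m j = \<infinity>" |
    "r = 3" "\<forall>j\<in>{1..r}. m j \<noteq> \<infinity>"
      "1 / real (the_enat (m 1)) + 1 / real (the_enat (m 2)) + 1 / real (the_enat (m 3)) \<le> 1"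
  proof -
    have "r \<ge> 4 \<or> (\<exists>j\<in>{1..r}. m j = \<infinity>) \<or>
      1 / real (the_enat (m 1)) + 1 / real (the_enat (m 2)) + 1 / real (the_enat (m 3)) \<le> 1"
      using angle_sum_ge_2_iff[of r m] assms r3 m2 by blast
    moreover have "r \<ge> 4 \<or> r = 3" using r3 by linarith
    ultimately show thesis using that by blast
  qed
  then show ?thesis
  proof cases
    case 1
    then show ?thesis by (intro two[of 0 2]) (auto simp: polygon_matrix_def)
  next
    case 2
    have "M (j - 1) (j mod r) = 0" using polygon_matrix_edge[OF 2(1)] 2(2) by (simp add: enat_order_def)
    moreover have "j - 1 \<noteq> j mod r" "j - 1 < r" "j mod r < r" using 2(1) r3 by (cases "j = r"; auto)+
    ultimately show ?thesis by (intro two[of "j - 1" "j mod r"])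
  next
    case 3
    define p where "p j = the_enat (m j)" for j
    have p: "p j \<ge> 2" "enat_order (m j) = p j" if "j \<in> {1..3}" for j
      using m2[of j] that 3(1,2) by (cases "m j"; auto simp: p_def enat_order_def numeral_eq_enat)+
    have M: "M 0 1 = p 1" "M 1 2 = p 2" "M 0 2 = p 3"
      using p by (simp_all add: polygon_matrix_def 3(1))
    define A where "A j = pi / real (p j)" for j
    have A: "0 \<le> A j" "A j \<le> pi / 2" if "j \<in> {1..3}" for j
      using p[OF that] frac_le[of pi pi 2 "real (p j)"] by (auto simp: A_def)
    have sum: "A 1 + A 2 + A 3 \<le> pi"
    proof -
      have "A 1 + A 2 + A 3 = pi * (1 / real (p 1) + 1 / real (p 2) + 1 / real (p 3))"
        by (simp add: A_def algebra_simps)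
      also have "\<dots> \<le> pi * 1" using 3(3) by (intro mult_left_mono) (auto simp: p_def)
      finally show ?thesis by simp
    qed
    have cf: "cf 0 1 = 2 * cos (A 1)" "cf 1 2 = 2 * cos (A 2)" "cf 0 2 = 2 * cos (A 3)"
      by (simp_all add: cf_def M[unfolded One_nat_def] A_def)
    have pos: "cos (A j) > 0" if "j \<in> {1..3}" "p j \<noteq> 2" for j
    proof -
      have "A j < pi / 2" using p(1)[OF that(1)] that(2) frac_less2[of pi pi 2 "real (p j)"] by (auto simp: A_def)
      then show ?thesis using A[OF that(1)] by (intro cos_gt_zero_pi) auto
    qed
    have "cos (A 3) > 0 \<or> cos (A 1) > 0 \<and> cos (A 2) > 0"
    proof (cases "p 3 = 2")
      case True
      have "1 / real (p 1) > 0" "1 / real (p 2) > 0" using p(1)[of 1] p(1)[of 2] by auto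
      then have "p 1 \<noteq> 2" "p 2 \<noteq> 2" using 3(3) True by (auto simp: p_def)
      then show ?thesis using pos by simp
    next
      case False then show ?thesis using pos by simp
    qed
    moreover have "cos (A j) \<ge> 0" if "j \<in> {1..3}" for j
      using A[OF that] by (intro cos_ge_zero) auto
    moreover have "1 \<le> (cos (A 1))\<^sup>2 + (cos (A 2))\<^sup>2 + (cos (A 3))\<^sup>2 + 2 * cos (A 1) * cos (A 2) * cos (A 3)"
      using A sum by (intro cos_triangle_le_pi) auto
    ultimately have inf: "n = 0" if "concat (replicate n [2, 1, 0]) \<approx> []" for n
      by (intro coxeter_element_infinite_order[OF _ _ _ _ _ _ _ _ that])
        (auto simp: cf[unfolded One_nat_def] power2_eq_square)
    have "n = 0" if "concat (replicate n [2, 1, 0, 2, 1, 0]) \<approx> []" for n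
    proof -
      have "concat (replicate n [2, 1, 0, 2, 1, 0 :: nat]) = concat (replicate (2 * n) [2, 1, 0])"
        by (induction n) auto
      then have "2 * n = 0" using inf that by metis
      then show ?thesis by simp
    qed
    \<comment> \<open>The Coxeter element has odd length, so its square is taken.\<close>
    then show ?thesis using 3(1) by (intro exI[of _ "[2, 1, 0, 2, 1, 0]"]) auto
  qed
qed

end

section \<open>Formal deformation of a product relation\<close>

unbundle fps_syntax

lemma fps_unit_nc:
  fixes f :: "'e :: ring_1 fps"
  assumes "a * f $ 0 = 1" "f $ 0 * a = 1"
  obtains g where "g * f = 1" "f * g = 1" "g $ 0 = a"
proof -
  let ?l = "fps_left_inverse f a" and ?r = "fps_right_inverse f a"
  have l: "?l * f = 1" by (rule fps_left_inverse[OF assms(1)])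
  have r: "f * ?r = 1" by (rule fps_right_inverse[OF assms(2)])
  have "?l = ?l * (f * ?r)" by (simp only: r mult_1_right)
  also have "\<dots> = ?r" by (simp only: mult.assoc[symmetric] l mult_1_left)
  finally have "?l = ?r" .
  then show ?thesis using that[of ?l] l r by simp
qed

text \<open>Two changes made at order N multiply to a term of order 2N, which exceeds N because N is
  positive. The coefficient at N therefore changes linearly.\<close>

lemma fps_mult_nth_perturb:
  fixes A B :: "'e :: ring_1 fps"
  assumes N: "N \<ge> 1"
    and A: "\<And>i. i < N \<Longrightarrow> A' $ i = A $ i" "A' $ N = A $ N + a"
    and B: "\<And>i. i < N \<Longrightarrow> B' $ i = B $ i" "B' $ N = B $ N + b"
  shows "\<And>i. i < N \<Longrightarrow> (A' * B') $ i = (A * B) $ i"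
    and "(A' * B') $ N = (A * B) $ N + a * B $ 0 + A $ 0 * b"
proof -
  show "(A' * B') $ i = (A * B) $ i" if "i < N" for i
    unfolding fps_mult_nth using that A B by (intro sum.cong) auto
  have split: "(F * G) $ N = F $ 0 * G $ N + (\<Sum>i=1..N - 1. F $ i * G $ (N - i)) + F $ N * G $ 0" for F G :: "'e fps"
  proof -
    obtain n where n: "N = Suc n" using N by (cases N) auto
    show ?thesis unfolding fps_mult_nth n
      by (simp add: sum.atLeast_Suc_atMost[of 0] sum.cl_ivl_Suc del: sum.cl_ivl_Suc) (simp add: add_ac)
  qed
  have "(\<Sum>i=1..N - 1. A' $ i * B' $ (N - i)) = (\<Sum>i=1..N - 1. A $ i * B $ (N - i))"
    using A B by (intro sum.cong) auto
  then show "(A' * B') $ N = (A * B) $ N + a * B $ 0 + A $ 0 * b"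
    unfolding split using A B N by (simp add: algebra_simps)
qed

text \<open>The noncommutative Leibniz rule: the derivative of the product of the \<open>c j\<close>
  in the direction \<open>d\<close>.\<close>

fun perturb :: "('i \<Rightarrow> 'e :: ring_1) \<Rightarrow> ('i \<Rightarrow> 'e) \<Rightarrow> 'i list \<Rightarrow> 'e" where
  "perturb c d [] = 0"
| "perturb c d (j # js) = d j * prod_list (map c js) + c j * perturb c d js"

lemma perturb_cong:
  "(\<And>j. j \<in> set js \<Longrightarrow> c j = c' j \<and> d j = d' j) \<Longrightarrow> perturb c d js = perturb c' d' js"
proof (induction js)
  case (Cons j js)
  have "map c js = map c' js" using Cons.prems by (intro map_cong) auto
  then show ?case using Cons by (auto simp del: map_eq_conv)
qed simp

lemma prod_list_fps_nth_0: "prod_list (map C js) $ 0 = prod_list (map (\<lambda>j. C j $ 0) js)"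
  for C :: "'i \<Rightarrow> 'e :: ring_1 fps"
  by (induction js) simp_all

lemma prod_list_nth_perturb:
  fixes C C' :: "'i \<Rightarrow> 'e :: ring_1 fps"
  assumes N: "N \<ge> 1"
    and C: "\<And>j i. j \<in> set js \<Longrightarrow> i < N \<Longrightarrow> C' j $ i = C j $ i"
    "\<And>j. j \<in> set js \<Longrightarrow> C' j $ N = C j $ N + d j"
  shows "(\<forall>i<N. prod_list (map C' js) $ i = prod_list (map C js) $ i) \<and>
    prod_list (map C' js) $ N = prod_list (map C js) $ N + perturb (\<lambda>j. C j $ 0) d js"
  using C
proof (induction js)
  case (Cons j js)
  have IH: "\<forall>i<N. prod_list (map C' js) $ i = prod_list (map C js) $ i"
     "prod_list (map C' js) $ N = prod_list (map C js) $ N + perturb (\<lambda>j. C j $ 0) d js"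
    using Cons by auto
  have j: "\<And>i. i < N \<Longrightarrow> C' j $ i = C j $ i" "C' j $ N = C j $ N + d j" using Cons.prems by auto
  show ?case
    using fps_mult_nth_perturb[OF N j, of "prod_list (map C' js)" "prod_list (map C js)"
        "perturb (\<lambda>j. C j $ 0) d js"] IH
    by (simp add: prod_list_fps_nth_0 algebra_simps)
qed simp

text \<open>Conjugation by \<open>U\<close> = 1 + x X^N, whose inverse is 1 - x X^N up to order N:
  to lowest order this adds a commutator.\<close>

lemma conj_nth_perturb:
  fixes C :: "'e :: ring_1 fps"
  assumes N: "N \<ge> 1"
  obtains U V where "U * V = 1" "V * U = 1" "\<And>i. i < N \<Longrightarrow> (U * C * V) $ i = C $ i"
    "(U * C * V) $ N = C $ N + (x * C $ 0 - C $ 0 * x)"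
proof -
  define U where "U = 1 + fps_const x * fps_X ^ N"
  have U: "U $ i = (if i = 0 then 1 else if i = N then x else 0)" for i
    using N by (auto simp: U_def fps_X_power_nth)
  obtain V where V: "V * U = 1" "U * V = 1" "V $ 0 = 1"
    using fps_unit_nc[of 1 U] U by auto
  have V_lt: "V $ i = (1 :: 'e fps) $ i" if "i < N" for i
  proof -
    have "(1 * V) $ i = (U * V) $ i" unfolding fps_mult_nth using that U
      by (intro sum.cong) auto
    then show ?thesis using V by simp
  qed
  have V_N: "V $ N = 0 - x"
  proof -
    have "(U * V) $ N = (1 * V) $ N + x * V $ 0 + 1 $ 0 * 0"
      by (rule fps_mult_nth_perturb(2)[OF N]) (use U N in auto)
    then show ?thesis using V N by (simp add: eq_neg_iff_add_eq_0)
  qed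
  have UC: "(U * C) $ i = C $ i" if "i < N" for i
    using fps_mult_nth_perturb(1)[OF N, of U 1 x C C 0] U N that by simp
  have UCN: "(U * C) $ N = C $ N + x * C $ 0"
    using fps_mult_nth_perturb(2)[OF N, of U 1 x C C 0] U N by simp
  show ?thesis
  proof (rule that[OF V(2,1)])
    show "(U * C * V) $ i = C $ i" if "i < N" for i
      using fps_mult_nth_perturb(1)[OF N, of "U * C" C "x * C $ 0" V 1 "- x"] UC UCN V_lt V_N N that by simp
    show "(U * C * V) $ N = C $ N + (x * C $ 0 - C $ 0 * x)"
      using fps_mult_nth_perturb(2)[OF N, of "U * C" C "x * C $ 0" V 1 "- x"] UC UCN V_lt V_N N by simp
  qed
qed

text \<open>The obstruction to extending the relation \<open>\<Prod>C\<^sub>j = 1\<close> by one order is killed by conjugating the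
  factors, which does not affect any relation that involves a single factor.\<close>

lemma deform_product_relation:
  fixes C0 :: "'i \<Rightarrow> 'e :: ring_1 fps" and c :: "'i \<Rightarrow> 'e"
  assumes Q: "\<And>j U C V. j \<in> set js \<Longrightarrow> U * V = 1 \<Longrightarrow> V * U = 1 \<Longrightarrow> Q j C \<Longrightarrow> Q j (U * C * V)"
    and C0: "\<And>j. j \<in> set js \<Longrightarrow> Q j (C0 j)" "\<And>j. j \<in> set js \<Longrightarrow> C0 j $ 0 = c j"
    and prod: "prod_list (map c js) = 1"
    and surj: "\<And>y. \<exists>x. perturb c (\<lambda>j. x j * c j - c j * x j) js = y"
  shows "\<exists>C. (\<forall>j\<in>set js. Q j (C j) \<and> C j $ 0 = c j) \<and> (\<forall>i\<le>N. prod_list (map C js) $ i = 1 $ i)"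
proof (induction N)
  case 0
  have "map (\<lambda>j. C0 j $ 0) js = map c js" using C0(2) by simp
  then have "prod_list (map C0 js) $ 0 = 1" using prod by (simp only: prod_list_fps_nth_0)
  then show ?case using C0 by (intro exI[of _ C0]) simp
next
  case (Suc N)
  then obtain C where C: "\<And>j. j \<in> set js \<Longrightarrow> Q j (C j) \<and> C j $ 0 = c j"
    "\<And>i. i \<le> N \<Longrightarrow> prod_list (map C js) $ i = 1 $ i" by blast
  obtain x where x: "perturb c (\<lambda>j. x j * c j - c j * x j) js = - (prod_list (map C js) $ Suc N)"
    using surj by blast
  have "\<exists>C'. (j \<in> set js \<longrightarrow> Q j C') \<and> (\<forall>i<Suc N. C' $ i = C j $ i) \<and>
    C' $ Suc N = C j $ Suc N + (x j * C j $ 0 - C j $ 0 * x j)" for j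
  proof -
    obtain U V where "U * V = 1" "V * U = 1" "\<And>i. i < Suc N \<Longrightarrow> (U * C j * V) $ i = C j $ i"
      "(U * C j * V) $ Suc N = C j $ Suc N + (x j * C j $ 0 - C j $ 0 * x j)"
      using conj_nth_perturb[of "Suc N" "C j" "x j"] by auto
    then show ?thesis using Q C(1) by (intro exI[of _ "U * C j * V"]) blast
  qed
  then obtain C' where C': "\<And>j. j \<in> set js \<Longrightarrow> Q j (C' j)" "\<And>j i. i < Suc N \<Longrightarrow> C' j $ i = C j $ i"
    "\<And>j. C' j $ Suc N = C j $ Suc N + (x j * C j $ 0 - C j $ 0 * x j)"
    by metis
  have "perturb (\<lambda>j. C j $ 0) (\<lambda>j. x j * C j $ 0 - C j $ 0 * x j) js = - (prod_list (map C js) $ Suc N)"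
    unfolding x[symmetric] using C(1) by (intro perturb_cong) auto
  then have "prod_list (map C' js) $ i = 1 $ i" if "i \<le> Suc N" for i
    using prod_list_nth_perturb[of "Suc N" js C' C "\<lambda>j. x j * C j $ 0 - C j $ 0 * x j"] C' C(2) that
    by (cases "i = Suc N") auto
  then show ?case using C'(1,2) C(1) by (intro exI[of _ C']) auto
qed

text \<open>Partial products telescope, since c_j s_j = s_(j-1). The infinitesimal conjugation of
  the k-th factor then contributes the difference of the conjugates of x_k by two neighbouring
  reflections. The induction prepends factors, starting from the empty product, where
  \<open>cyc\<close> is used.\<close>

lemma perturb_polygon:
  fixes s :: "nat \<Rightarrow> 'e :: ring_1"
  assumes inv: "\<And>i. s i * s i = 1" and cyc: "s r = s 0"
  defines "c \<equiv> \<lambda>j. s (j - 1) * s j"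
  assumes "1 \<le> j" "j \<le> Suc r"
  shows "prod_list (map c [j..<Suc r]) = s (j - 1) * s 0 \<and>
    perturb c (\<lambda>k. x k * c k - c k * x k) [j..<Suc r] =
      s (j - 1) * (\<Sum>k=j..r. s (k - 1) * x k * s (k - 1) - s k * x k * s k) * s 0"
  using assms(5,4)
proof (induction j rule: inc_induct)
  case base
  then show ?case using inv[of 0] cyc by simp
next
  case (step j)
  have inv': "s i * (s i * y) = y" for i y using inv[of i] by (simp add: mult.assoc[symmetric])
  define S where "S = (\<Sum>k=Suc j..r. s (k - 1) * x k * s (k - 1) - s k * x k * s k)"
  have upt: "[j..<Suc r] = j # [Suc j..<Suc r]" using step.hyps by (intro upt_conv_Cons)
  have IH: "prod_list (map c [Suc j..<Suc r]) = s j * s 0"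
    "perturb c (\<lambda>k. x k * c k - c k * x k) [Suc j..<Suc r] = s j * S * s 0"
    using step.IH by (simp_all add: S_def)
  have cs: "c j * s j = s (j - 1)" using inv by (simp add: c_def mult.assoc)
  have "prod_list (map c [j..<Suc r]) = c j * s j * s 0"
    unfolding upt by (simp add: IH mult.assoc del: upt_Suc)
  then have 1: "prod_list (map c [j..<Suc r]) = s (j - 1) * s 0" by (simp only: cs)
  have "perturb c (\<lambda>k. x k * c k - c k * x k) [j..<Suc r] =
    (x j * c j - c j * x j) * (s j * s 0) + c j * (s j * S * s 0)"
    unfolding upt by (simp add: IH del: upt_Suc)
  also have "\<dots> = x j * (c j * s j) * s 0 - c j * x j * s j * s 0 + (c j * s j) * S * s 0"
    by (simp only: left_diff_distrib right_diff_distrib mult.assoc)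
  also have "\<dots> = s (j - 1) * (s (j - 1) * x j * s (j - 1)) * s 0 -
      s (j - 1) * (s j * x j * s j) * s 0 + s (j - 1) * S * s 0"
    unfolding cs by (simp add: c_def mult.assoc inv')
  also have "\<dots> = s (j - 1) * ((s (j - 1) * x j * s (j - 1) - s j * x j * s j) + S) * s 0"
    by (simp only: left_diff_distrib right_diff_distrib distrib_left distrib_right)
  also have "(s (j - 1) * x j * s (j - 1) - s j * x j * s j) + S =
    (\<Sum>k=j..r. s (k - 1) * x k * s (k - 1) - s k * x k * s k)"
    unfolding S_def using step.hyps by (simp add: sum.atLeast_Suc_atMost)
  finally show ?case using 1 by blast
qed

text \<open>The image of the derivative is, up to the outer factors s_0, an additive group
  \<open>L\<close> containing all differences of conjugates of an element by neighbouring
  reflections. Walking along the sides, and then along a word of even length, puts g y g^(-1) - y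
  into \<open>L\<close>; for the given \<open>g\<close> these elements are everything.\<close>

lemma perturb_polygon_surj:
  fixes s :: "nat \<Rightarrow> 'e :: ring_1"
  assumes inv: "\<And>i. s i * s i = 1" and cyc: "s r = s 0"
  defines "c \<equiv> \<lambda>j. s (j - 1) * s j"
  assumes g: "set g \<subseteq> {..<r}" "even (length g)"
    and surj: "\<And>y. \<exists>x. prod_list (map s g) * x * prod_list (map s (rev g)) - x = y"
  shows "\<exists>x. perturb c (\<lambda>k. x k * c k - c k * x k) [1..<Suc r] = y"
proof -
  define D where "D x = (\<Sum>k=1..r. s (k - 1) * x k * s (k - 1) - s k * x k * s k)" for x
  define L where "L = range D"
  have L_zero: "0 \<in> L" unfolding L_def by (rule range_eqI[of _ D "\<lambda>_. 0"]) (simp add: D_def)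
  have L_add: "a + b \<in> L" if "a \<in> L" "b \<in> L" for a b
  proof -
    from that obtain x y where "a = D x" "b = D y" by (auto simp: L_def)
    then have "a + b = D (\<lambda>k. x k + y k)"
      by (simp add: D_def sum.distrib[symmetric] algebra_simps)
    then show ?thesis by (simp add: L_def)
  qed
  have L_neg: "- a \<in> L" if "a \<in> L" for a
  proof -
    from that obtain x where "a = D x" by (auto simp: L_def)
    then have "- a = D (\<lambda>k. - x k)" by (simp add: D_def sum_negf[symmetric])
    then show ?thesis by (simp add: L_def)
  qed
  have L_step: "s (k - 1) * y * s (k - 1) - s k * y * s k \<in> L" if "k \<in> {1..r}" for k y
  proof -
    have "D (\<lambda>l. if l = k then y else 0) =
      (\<Sum>l=1..r. if l = k then s (k - 1) * y * s (k - 1) - s k * y * s k else 0)"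
      unfolding D_def by (intro sum.cong) auto
    also have "\<dots> = s (k - 1) * y * s (k - 1) - s k * y * s k" using that by simp
    finally show ?thesis unfolding L_def by (metis rangeI)
  qed
  have L0: "s 0 * y * s 0 - s i * y * s i \<in> L" if "i \<le> r" for i y
    using that
  proof (induction i)
    case 0
    show ?case using L_zero by simp
  next
    case (Suc i)
    then have "s 0 * y * s 0 - s i * y * s i \<in> L" "s i * y * s i - s (Suc i) * y * s (Suc i) \<in> L"
      using L_step[of "Suc i" y] by auto
    from L_add[OF this] show ?case by simp
  qed
  have L_diff: "s i * y * s i - s k * y * s k \<in> L" if "i < r" "k < r" for i k y
    using L_add[OF L_neg[OF L0[of i y]] L0[of k y]] that by simp
  have L_word: "prod_list (map s w) * y * prod_list (map s (rev w)) - y \<in> L"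
    if "set w \<subseteq> {..<r}" "even (length w)" for w y
    using that
  proof (induction w rule: induct_list012)
    case 1
    show ?case using L0[of 0 y] by simp
  next
    case (3 i k w)
    let ?z = "prod_list (map s w) * y * prod_list (map s (rev w))"
    have "s i * (s k * ?z * s k) * s i - s k * (s k * ?z * s k) * s k \<in> L"
      using 3 by (intro L_diff) auto
    moreover have "s k * (s k * ?z * s k) * s k = (s k * s k) * ?z * (s k * s k)"
      by (simp only: mult.assoc)
    then have "s k * (s k * ?z * s k) * s k = ?z" by (simp only: inv mult_1_left mult_1_right)
    ultimately have "s i * (s k * ?z * s k) * s i - ?z \<in> L" by simp
    moreover have "?z - y \<in> L" using 3 by auto
    ultimately have "(s i * (s k * ?z * s k) * s i - ?z) + (?z - y) \<in> L" by (rule L_add)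
    moreover have "prod_list (map s (i # k # w)) * y * prod_list (map s (rev (i # k # w))) =
        s i * (s k * ?z * s k) * s i" by (simp add: mult.assoc)
    ultimately show ?case by simp
  qed simp
  \<comment> \<open>The derivative is s_0 D s_0, so D has to reach s_0 y s_0.\<close>
  obtain z where z: "prod_list (map s g) * z * prod_list (map s (rev g)) - z = s 0 * y * s 0"
    using surj by blast
  then have "s 0 * y * s 0 \<in> L" using L_word[OF g, of z] by simp
  then obtain x where x: "s 0 * y * s 0 = D x" by (auto simp: L_def)
  have "perturb c (\<lambda>k. x k * c k - c k * x k) [1..<Suc r] = s 0 * (s 0 * y * s 0) * s 0"
    using perturb_polygon[of s r 1 x] inv cyc unfolding c_def x D_def by auto
  also have "\<dots> = (s 0 * s 0) * y * (s 0 * s 0)" by (simp only: mult.assoc)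
  also have "\<dots> = y" using inv by simp
  finally show ?thesis by blast
qed

section \<open>Evaluation of monoid algebras\<close>

lemma update_eq_add_single:
  "k \<notin> Poly_Mapping.keys f \<Longrightarrow> Poly_Mapping.update k v f = f + Poly_Mapping.single k v"
  by (intro poly_mapping_eqI) (auto simp: lookup_update lookup_add lookup_single when_def in_keys_iff)

lemma poly_mapping_add_induct [case_names zero add]:
  fixes p :: "'m \<Rightarrow>\<^sub>0 'a :: monoid_add"
  assumes "P 0" "\<And>f k v. P f \<Longrightarrow> P (f + Poly_Mapping.single k v)"
  shows "P p"
  by (induction p rule: update_induct) (use assms in \<open>auto simp: update_eq_add_single\<close>)

text \<open>The universal property of a monoid algebra whose monoid need not be commutative. It
  serves for Laurent polynomials with complex values, with power series values, and for the free
  algebra.\<close>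

locale mapping_eval =
  fixes \<phi> :: "'a :: ring_1 \<Rightarrow> 'b :: ring_1" and \<chi> :: "'m :: monoid_add \<Rightarrow> 'b"
  assumes \<phi>_add: "\<phi> (a + b) = \<phi> a + \<phi> b" and \<phi>_mult: "\<phi> (a * b) = \<phi> a * \<phi> b" and \<phi>_one: "\<phi> 1 = 1"
    and \<chi>_zero: "\<chi> 0 = 1" and \<chi>_add: "\<chi> (k + l) = \<chi> k * \<chi> l" and commute: "\<phi> a * \<chi> k = \<chi> k * \<phi> a"
begin

definition eval_map :: "('m \<Rightarrow>\<^sub>0 'a) \<Rightarrow> 'b" where
  "eval_map p = (\<Sum>k\<in>Poly_Mapping.keys p. \<phi> (Poly_Mapping.lookup p k) * \<chi> k)"

lemma \<phi>_zero: "\<phi> 0 = 0"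
  using \<phi>_add[of 0 0] by simp

lemma eval_map_superset:
  "finite A \<Longrightarrow> Poly_Mapping.keys p \<subseteq> A \<Longrightarrow> eval_map p = (\<Sum>k\<in>A. \<phi> (Poly_Mapping.lookup p k) * \<chi> k)"
  unfolding eval_map_def by (intro sum.mono_neutral_left) (auto simp: in_keys_iff \<phi>_zero)

lemma eval_map_zero [simp]: "eval_map 0 = 0"
  by (simp add: eval_map_def)

lemma eval_map_single [simp]: "eval_map (Poly_Mapping.single k a) = \<phi> a * \<chi> k"
  by (simp add: eval_map_def \<phi>_zero)

lemma eval_map_add: "eval_map (p + q) = eval_map p + eval_map q"
proof -
  let ?A = "Poly_Mapping.keys p \<union> Poly_Mapping.keys q"
  show ?thesis
    using eval_map_superset[of ?A "p + q"] eval_map_superset[of ?A p] eval_map_superset[of ?A q] keys_add[of p q]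
    by (simp add: lookup_add \<phi>_add distrib_right sum.distrib)
qed

lemma eval_map_one [simp]: "eval_map 1 = 1"
  unfolding single_one[symmetric] by (simp add: \<phi>_one \<chi>_zero del: single_one)

lemma eval_map_mult: "eval_map (p * q) = eval_map p * eval_map q"
proof (induction p rule: poly_mapping_add_induct)
  case (add f k v)
  have "eval_map (Poly_Mapping.single k v * q) = \<phi> v * \<chi> k * eval_map q"
  proof (induction q rule: poly_mapping_add_induct)
    case (add g l w)
    have "\<phi> (v * w) * \<chi> (k + l) = (\<phi> v * \<chi> k) * (\<phi> w * \<chi> l)"
      by (metis \<phi>_mult \<chi>_add commute mult.assoc)
    then show ?case using add by (simp add: distrib_left eval_map_add mult_single)
  qed simp
  then show ?case using add by (simp add: distrib_right eval_map_add)
qed simp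

lemma eval_map_uminus: "eval_map (- p) = - eval_map p"
  using eval_map_add[of p "- p"] by (simp add: eq_neg_iff_add_eq_0 add.commute)

lemma eval_map_diff: "eval_map (p - q) = eval_map p - eval_map q"
  using eval_map_add[of p "- q"] by (simp add: eval_map_uminus)

lemma eval_map_sum: "eval_map (sum f A) = (\<Sum>x\<in>A. eval_map (f x))"
  by (induction A rule: infinite_finite_induct) (auto simp: eval_map_add)

lemma eval_map_prod_list: "eval_map (prod_list xs) = prod_list (map eval_map xs)"
  by (induction xs) (auto simp: eval_map_mult)

end

section \<open>Linear operators on a free vector space\<close>

definition pm_scale :: "complex \<Rightarrow> ('x \<Rightarrow>\<^sub>0 complex) \<Rightarrow> ('x \<Rightarrow>\<^sub>0 complex)" where
  "pm_scale z p = Poly_Mapping.map ((*) z) p"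

lemma lookup_pm_scale [simp]: "Poly_Mapping.lookup (pm_scale z p) k = z * Poly_Mapping.lookup p k"
  by (auto simp: pm_scale_def Poly_Mapping.map.rep_eq when_def)

lemma pm_scale_simps:
  "pm_scale z (p + q) = pm_scale z p + pm_scale z q" "pm_scale (a + b) p = pm_scale a p + pm_scale b p"
  "pm_scale a (pm_scale b p) = pm_scale (a * b) p" "pm_scale 1 p = p" "pm_scale 0 p = 0"
  "pm_scale z (0 :: 'x \<Rightarrow>\<^sub>0 complex) = 0" "pm_scale z (- p) = - pm_scale z p"
  "pm_scale z (p - q) = pm_scale z p - pm_scale z q"
  "pm_scale z (Poly_Mapping.single x w) = Poly_Mapping.single x (z * w)"
  by (intro poly_mapping_eqI; simp add: lookup_add lookup_minus algebra_simps lookup_single when_def)+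

text \<open>A type instead of a carrier set, so that power series with operator coefficients form a
  ring. No finiteness is imposed: the images of the basis vectors are arbitrary, which
  \<open>perm_op_conj_surj\<close> relies on.\<close>

typedef 'x linop = "{f :: ('x \<Rightarrow>\<^sub>0 complex) \<Rightarrow> ('x \<Rightarrow>\<^sub>0 complex).
    (\<forall>p q. f (p + q) = f p + f q) \<and> (\<forall>z p. f (pm_scale z p) = pm_scale z (f p))}"
  morphisms apply_op Abs_linop
  by (rule exI[of _ id]) simp

setup_lifting type_definition_linop

lemma apply_op_add: "apply_op f (p + q) = apply_op f p + apply_op f q"
  and apply_op_scale: "apply_op f (pm_scale z p) = pm_scale z (apply_op f p)"
  using apply_op[of f] by auto

instantiation linop :: (type) ring_1
begin

lift_definition zero_linop :: "'x linop" is "\<lambda>p. 0" by (simp add: pm_scale_simps)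
lift_definition one_linop :: "'x linop" is "\<lambda>p. p" by simp
lift_definition plus_linop :: "'x linop \<Rightarrow> 'x linop \<Rightarrow> 'x linop" is "\<lambda>f g p. f p + g p"
  by (auto simp: pm_scale_simps algebra_simps)
lift_definition uminus_linop :: "'x linop \<Rightarrow> 'x linop" is "\<lambda>f p. - f p"
  by (auto simp: pm_scale_simps)
lift_definition minus_linop :: "'x linop \<Rightarrow> 'x linop \<Rightarrow> 'x linop" is "\<lambda>f g p. f p - g p"
  by (auto simp: pm_scale_simps algebra_simps)
lift_definition times_linop :: "'x linop \<Rightarrow> 'x linop \<Rightarrow> 'x linop" is "\<lambda>f g p. f (g p)"
  by auto

instance
proof
  show "(0 :: 'x linop) \<noteq> 1"
  proof (transfer, rule notI)
    assume "(\<lambda>p. 0) = (\<lambda>p :: 'x \<Rightarrow>\<^sub>0 complex. p)"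
    from fun_cong[OF this, of "Poly_Mapping.single undefined 1"]
    have "Poly_Mapping.lookup (Poly_Mapping.single (undefined :: 'x) (1 :: complex)) undefined = 0"
      by (metis lookup_zero)
    then show False by simp
  qed
qed (transfer; auto simp: algebra_simps fun_eq_iff)+

end

lift_definition scalar_op :: "complex \<Rightarrow> 'x linop" is "\<lambda>z p. pm_scale z p"
  by (simp add: pm_scale_simps mult.commute)

lemma scalar_op_hom:
  "scalar_op 1 = 1" "scalar_op (a + b) = scalar_op a + scalar_op b"
  "scalar_op (a * b) = scalar_op a * scalar_op b" "scalar_op 0 = 0"
  by (transfer; simp add: pm_scale_simps fun_eq_iff)+

lemma scalar_op_central: "scalar_op z * f = f * scalar_op z"
  by transfer (auto simp: fun_eq_iff)

lemma apply_op_zero [simp]: "apply_op f 0 = 0"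
  using apply_op_add[of f 0 0] by simp

lemma linop_eqI:
  assumes "\<And>x. apply_op f (Poly_Mapping.single x 1) = apply_op g (Poly_Mapping.single x 1)"
  shows "f = g"
proof -
  have "apply_op f p = apply_op g p" for p
  proof (induction p rule: poly_mapping_add_induct)
    case (add h k v)
    have "Poly_Mapping.single k v = pm_scale v (Poly_Mapping.single k 1)" by (simp add: pm_scale_simps)
    then show ?case using add assms by (simp add: apply_op_add apply_op_scale)
  qed simp
  then show ?thesis by (intro apply_op_inject[THEN iffD1] ext)
qed

lift_definition op_of :: "('x \<Rightarrow> ('x \<Rightarrow>\<^sub>0 complex)) \<Rightarrow> 'x linop" is
  "\<lambda>f p. \<Sum>x\<in>Poly_Mapping.keys p. pm_scale (Poly_Mapping.lookup p x) (f x)"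
proof (intro conjI allI)
  fix f :: "'x \<Rightarrow> ('x \<Rightarrow>\<^sub>0 complex)" and p q :: "'x \<Rightarrow>\<^sub>0 complex" and z
  have sup: "(\<Sum>x\<in>Poly_Mapping.keys p. pm_scale (Poly_Mapping.lookup p x) (f x)) =
     (\<Sum>x\<in>A. pm_scale (Poly_Mapping.lookup p x) (f x))" if "finite A" "Poly_Mapping.keys p \<subseteq> A" for p A
    using that by (intro sum.mono_neutral_left) (auto simp: in_keys_iff pm_scale_simps)
  show "(\<Sum>x\<in>Poly_Mapping.keys (p + q). pm_scale (Poly_Mapping.lookup (p + q) x) (f x)) =
    (\<Sum>x\<in>Poly_Mapping.keys p. pm_scale (Poly_Mapping.lookup p x) (f x)) +
    (\<Sum>x\<in>Poly_Mapping.keys q. pm_scale (Poly_Mapping.lookup q x) (f x))"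
  proof -
    let ?A = "Poly_Mapping.keys p \<union> Poly_Mapping.keys q"
    have A: "finite ?A" "Poly_Mapping.keys p \<subseteq> ?A" "Poly_Mapping.keys q \<subseteq> ?A" by auto
    show ?thesis
      unfolding sup[OF A(1) keys_add] sup[OF A(1,2)] sup[OF A(1,3)]
      by (simp add: lookup_add pm_scale_simps sum.distrib)
  qed
  have sc: "pm_scale z (sum h A) = (\<Sum>x\<in>A. pm_scale z (h x))" for h :: "'x \<Rightarrow> ('x \<Rightarrow>\<^sub>0 complex)" and A
    by (induction A rule: infinite_finite_induct) (auto simp: pm_scale_simps)
  have "Poly_Mapping.keys (pm_scale z p) \<subseteq> Poly_Mapping.keys p" by (auto simp: in_keys_iff)
  then show "(\<Sum>x\<in>Poly_Mapping.keys (pm_scale z p). pm_scale (Poly_Mapping.lookup (pm_scale z p) x) (f x)) =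
    pm_scale z (\<Sum>x\<in>Poly_Mapping.keys p. pm_scale (Poly_Mapping.lookup p x) (f x))"
    unfolding sup[OF finite_keys \<open>Poly_Mapping.keys (pm_scale z p) \<subseteq> Poly_Mapping.keys p\<close>] by (simp add: sc pm_scale_simps)
qed

lemma apply_op_of [simp]: "apply_op (op_of f) (Poly_Mapping.single x 1) = f x"
  by transfer (simp add: pm_scale_simps)

lemma apply_op_simps:
  "apply_op (f * g) p = apply_op f (apply_op g p)" "apply_op 1 p = p"
  "apply_op (f + g) p = apply_op f p + apply_op g p" "apply_op (f - g) p = apply_op f p - apply_op g p"
  "apply_op 0 p = 0" "apply_op (scalar_op z) p = pm_scale z p"
  by (transfer; simp)+

definition perm_op :: "('x \<Rightarrow> 'x) \<Rightarrow> 'x linop" where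
  "perm_op \<pi> = op_of (\<lambda>x. Poly_Mapping.single (\<pi> x) 1)"

lemma apply_perm_op [simp]: "apply_op (perm_op \<pi>) (Poly_Mapping.single x 1) = Poly_Mapping.single (\<pi> x) 1"
  by (simp add: perm_op_def)

lemma perm_op_comp: "perm_op \<pi> * perm_op \<rho> = perm_op (\<lambda>x. \<pi> (\<rho> x))"
  by (rule linop_eqI) (simp add: apply_op_simps)

lemma perm_op_id: "perm_op (\<lambda>x. x) = 1"
  by (rule linop_eqI) (simp add: apply_op_simps)

text \<open>Without finite orbits, values may be prescribed along one representative of each orbit and then
  propagated in both directions.\<close>

lemma orbit_recursion:
  fixes \<pi> :: "'x \<Rightarrow> 'x" and F :: "'x \<Rightarrow> 'v \<Rightarrow> 'v"
  assumes \<pi>: "bij \<pi>" and free: "\<And>n x. n > 0 \<Longrightarrow> (\<pi> ^^ n) x \<noteq> x" and F: "\<And>x. surj (F x)"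
  shows "\<exists>\<eta>. \<forall>x. \<eta> (\<pi> x) = F x (\<eta> x)"
proof -
  have inj: "(\<pi> ^^ n) x = (\<pi> ^^ n) y \<Longrightarrow> x = y" for n x y
    using inj_fn[of \<pi> n] \<pi> by (simp add: bij_def inj_eq)
  have uniq: "n = n'" if "(\<pi> ^^ n) x = (\<pi> ^^ n') x" for n n' x
  proof -
    have *: "n \<le> n' \<Longrightarrow> (\<pi> ^^ n) x = (\<pi> ^^ n') x \<Longrightarrow> n = n'" for n n'
    proof -
      assume le: "n \<le> n'" and eq: "(\<pi> ^^ n) x = (\<pi> ^^ n') x"
      have "(\<pi> ^^ n') x = (\<pi> ^^ n) ((\<pi> ^^ (n' - n)) x)"
        using funpow_add[of n "n' - n" \<pi>] le by simp
      then have "x = (\<pi> ^^ (n' - n)) x" using eq inj by metis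
      then show "n = n'" using free[of "n' - n" x] le by (cases "n' - n = 0") auto
    qed
    show ?thesis using *[of n n'] *[of n' n] that by (cases "n \<le> n'") auto
  qed
  define conn where "conn x y \<longleftrightarrow> (\<exists>n. (\<pi> ^^ n) x = y \<or> (\<pi> ^^ n) y = x)" for x y
  have conn_step: "conn (\<pi> x) y \<longleftrightarrow> conn x y" for x y
  proof
    assume "conn (\<pi> x) y"
    then obtain n where "(\<pi> ^^ n) (\<pi> x) = y \<or> (\<pi> ^^ n) y = \<pi> x" by (auto simp: conn_def)
    then show "conn x y"
    proof
      assume "(\<pi> ^^ n) (\<pi> x) = y"
      then have "(\<pi> ^^ Suc n) x = y" by (simp add: funpow_swap1)
      then show ?thesis unfolding conn_def by blast
    next
      assume *: "(\<pi> ^^ n) y = \<pi> x"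
      show ?thesis
      proof (cases n)
        case 0
        then have "(\<pi> ^^ 1) x = y" using * by simp
        then show ?thesis unfolding conn_def by blast
      next
        case (Suc k)
        then have "(\<pi> ^^ k) y = x" using * \<pi> by (auto simp: bij_def inj_eq)
        then show ?thesis unfolding conn_def by blast
      qed
    qed
  next
    assume "conn x y"
    then obtain n where "(\<pi> ^^ n) x = y \<or> (\<pi> ^^ n) y = x" by (auto simp: conn_def)
    then show "conn (\<pi> x) y"
    proof
      assume "(\<pi> ^^ n) y = x"
      then have "(\<pi> ^^ Suc n) y = \<pi> x" by simp
      then show ?thesis unfolding conn_def by blast
    next
      assume *: "(\<pi> ^^ n) x = y"
      show ?thesis
      proof (cases n)
        case 0
        then have "(\<pi> ^^ 1) y = \<pi> x" using * by simp
        then show ?thesis unfolding conn_def by blast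
      next
        case (Suc k)
        then have "(\<pi> ^^ k) (\<pi> x) = y" using * by (simp add: funpow_swap1)
        then show ?thesis unfolding conn_def by blast
      qed
    qed
  qed
  define rep where "rep x = (SOME y. conn x y)" for x
  have rep_step: "rep (\<pi> x) = rep x" for x by (simp add: rep_def conn_step)
  have "conn x x" for x unfolding conn_def by (intro exI[of _ 0]) simp
  then have conn_rep: "conn x (rep x)" for x unfolding rep_def by (rule someI)
  \<comment> \<open>The value at the representative is free, hence \<open>undefined\<close> in both
    directions. \<open>fw\<close> applies \<open>F\<close> along the orbit; \<open>bw\<close> goes
    backwards by choosing preimages.\<close>
  define fw where "fw y n = rec_nat (undefined :: 'v) (\<lambda>k v. F ((\<pi> ^^ k) y) v) n" for y n
  define bw where "bw n = rec_nat (\<lambda>x. undefined :: 'v) (\<lambda>k h x. inv_into UNIV (F x) (h (\<pi> x))) n" for n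
  have fw: "fw y 0 = undefined" "fw y (Suc n) = F ((\<pi> ^^ n) y) (fw y n)" for y n by (simp_all add: fw_def)
  have bw: "bw 0 x = undefined" "bw (Suc n) x = inv_into UNIV (F x) (bw n (\<pi> x))" for x n by (simp_all add: bw_def)
  define \<eta> where "\<eta> x = (if \<exists>n. (\<pi> ^^ n) (rep x) = x then fw (rep x) (THE n. (\<pi> ^^ n) (rep x) = x)
     else bw (THE n. (\<pi> ^^ n) x = rep x) x)" for x
  have \<eta>_fw: "\<eta> x = fw (rep x) n" if "(\<pi> ^^ n) (rep x) = x" for x n
  proof -
    have "(THE n. (\<pi> ^^ n) (rep x) = x) = n" using that uniq by (intro the_equality) metis+
    then show ?thesis using that by (auto simp: \<eta>_def)
  qed
  have \<eta>_bw: "\<eta> x = bw n x" if n: "(\<pi> ^^ n) x = rep x" for x n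
  proof (cases "n = 0")
    case True
    then show ?thesis using \<eta>_fw[of 0 x] that by (simp add: fw bw)
  next
    case False
    have "(\<pi> ^^ k) (rep x) \<noteq> x" for k
    proof
      assume "(\<pi> ^^ k) (rep x) = x"
      then have "(\<pi> ^^ (k + n)) x = x" using n by (simp add: funpow_add)
      then show False using free[of "k + n" x] False by simp
    qed
    moreover have "(THE n. (\<pi> ^^ n) x = rep x) = n" using n uniq by (intro the_equality) metis+
    ultimately show ?thesis by (simp add: \<eta>_def)
  qed
  have "\<eta> (\<pi> x) = F x (\<eta> x)" for x
  proof -
    obtain n where "(\<pi> ^^ n) (rep x) = x \<or> (\<pi> ^^ n) x = rep x" using conn_rep[of x] unfolding conn_def by blast
    then show ?thesis
    proof
      assume n: "(\<pi> ^^ n) (rep x) = x"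
      then have "(\<pi> ^^ Suc n) (rep (\<pi> x)) = \<pi> x" by (simp add: rep_step)
      from \<eta>_fw[OF this] show ?thesis using \<eta>_fw[OF n] n by (simp add: fw rep_step)
    next
      assume n: "(\<pi> ^^ n) x = rep x"
      show ?thesis
      proof (cases n)
        case 0
        then have "(\<pi> ^^ 1) (rep (\<pi> x)) = \<pi> x" "(\<pi> ^^ 0) (rep x) = x" using n by (simp_all add: rep_step)
        from this[THEN \<eta>_fw] show ?thesis using 0 n by (simp add: fw rep_step)
      next
        case (Suc k)
        then have "(\<pi> ^^ k) (\<pi> x) = rep (\<pi> x)" using n by (simp add: funpow_swap1 rep_step)
        from \<eta>_bw[OF this] show ?thesis using \<eta>_bw[OF n] Suc F by (simp add: bw surj_f_inv_f)
      qed
    qed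
  qed
  then show ?thesis by blast
qed

text \<open>On the basis vector of \<open>\<pi> x\<close> the equation determines the image of that
  vector from the image of the vector of \<open>x\<close>, through the surjective map
  \<open>F x\<close>. Since no orbit closes up, this recursion meets no consistency
  condition.\<close>

lemma perm_op_conj_surj:
  assumes \<pi>: "bij \<pi>" and free: "\<And>n x. n > 0 \<Longrightarrow> (\<pi> ^^ n) x \<noteq> x" and \<rho>: "\<And>x. \<pi> (\<rho> x) = x"
  shows "\<exists>f. perm_op \<pi> * f * perm_op \<rho> - f = g"
proof -
  have \<rho>': "\<rho> (\<pi> x) = x" for x using \<pi> \<rho>[of "\<pi> x"] by (auto simp: bij_def inj_eq)
  define F where "F x v = apply_op (perm_op \<pi>) v - apply_op g (Poly_Mapping.single (\<pi> x) 1)" for x v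
  have "surj (F x)" for x
  proof (rule surjI)
    fix v
    have "apply_op (perm_op \<pi>) (apply_op (perm_op \<rho>) w) = w" for w
      by (simp add: apply_op_simps(1)[symmetric] perm_op_comp \<rho> perm_op_id apply_op_simps(2))
    then show "F x (apply_op (perm_op \<rho>) (v + apply_op g (Poly_Mapping.single (\<pi> x) 1))) = v"
      by (simp add: F_def)
  qed
  then obtain \<eta> where \<eta>: "\<And>x. \<eta> (\<pi> x) = F x (\<eta> x)"
    using orbit_recursion[OF \<pi> free, where F = F] by blast
  have "perm_op \<pi> * op_of \<eta> * perm_op \<rho> - op_of \<eta> = g"
  proof (rule linop_eqI)
    fix x
    have "\<eta> x = apply_op (perm_op \<pi>) (\<eta> (\<rho> x)) - apply_op g (Poly_Mapping.single x 1)"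
      using \<eta>[of "\<rho> x"] by (simp add: \<rho> F_def)
    then show "apply_op (perm_op \<pi> * op_of \<eta> * perm_op \<rho> - op_of \<eta>) (Poly_Mapping.single x 1) =
        apply_op g (Poly_Mapping.single x 1)"
      by (simp add: apply_op_simps)
  qed
  then show ?thesis by blast
qed

section \<open>Deforming the regular representation\<close>

definition scalar_fps :: "complex fps \<Rightarrow> 'x linop fps" where
  "scalar_fps f = Abs_fps (\<lambda>n. scalar_op (f $ n))"

lemma scalar_fps_nth [simp]: "scalar_fps f $ n = scalar_op (f $ n)"
  by (simp add: scalar_fps_def)

lemma scalar_op_sum: "scalar_op (sum f A) = (\<Sum>x\<in>A. scalar_op (f x))"
  by (induction A rule: infinite_finite_induct) (auto simp: scalar_op_hom)

lemma scalar_fps_hom: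
  "scalar_fps 1 = 1" "scalar_fps (f + g) = scalar_fps f + scalar_fps g"
  "scalar_fps (f * g) = scalar_fps f * scalar_fps g" "scalar_fps 0 = 0"
  by (auto simp: fps_eq_iff scalar_op_hom scalar_op_sum fps_mult_nth)

lemma scalar_fps_diff: "scalar_fps (f - g) = scalar_fps f - scalar_fps g"
  using scalar_fps_hom(2)[of "f - g" g] by (metis add_diff_cancel_right' diff_add_cancel)

lemma scalar_fps_central: "scalar_fps f * F = F * scalar_fps f"
proof (rule fps_ext)
  fix n
  have "(F * scalar_fps f) $ n = (\<Sum>i=0..n. F $ (n - i) * scalar_op (f $ i))"
    unfolding fps_mult_nth scalar_fps_nth
    by (rule sum.reindex_bij_witness[of _ "\<lambda>i. n - i" "\<lambda>i. n - i"]) auto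
  then show "(scalar_fps f * F) $ n = (F * scalar_fps f) $ n"
    unfolding fps_mult_nth by (simp add: scalar_op_central)
qed

lemma sum_roots_of_unity:
  fixes y :: complex
  assumes "y ^ m = 1" "y \<noteq> 1"
  shows "(\<Sum>i<m. y ^ i) = 0"
  using assms by (simp add: geometric_sum)

text \<open>\<open>e k\<close> is the discrete Fourier projection (1/m) times the sum of
  \<zeta>^(-ki) c^i. All three properties reduce to the vanishing sums of powers of nontrivial roots
  of unity.\<close>

lemma finite_order_idempotents:
  fixes c :: "'x linop" and m :: nat
  assumes m: "m > 0" and c: "c ^ m = 1"
  defines "\<zeta> \<equiv> cis (2 * pi / real m)"
  obtains e where "\<And>k. c * e k = scalar_op (\<zeta> ^ k) * e k" "(\<Sum>k=1..m. e k) = 1"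
    "\<And>k l. k \<in> {1..m} \<Longrightarrow> l \<in> {1..m} \<Longrightarrow> e k * e l = (if k = l then e l else 0)"
proof -
  have z0: "\<zeta> \<noteq> 0" by (simp add: \<zeta>_def)
  have zm: "\<zeta> ^ m = 1" using m by (simp add: \<zeta>_def DeMoivre)
  have z1: "m dvd k" if "\<zeta> ^ k = 1" for k using that cis_power_eq_1[OF m, of k] by (simp add: \<zeta>_def)
  have pw: "(\<zeta> ^ k) ^ m = 1" for k by (metis mult.commute power_mult power_one zm)
  define e where "e k = scalar_op (1 / of_nat m) * (\<Sum>i<m. scalar_op (inverse (\<zeta> ^ k) ^ i) * c ^ i)" for k
  have ce: "c * e k = scalar_op (\<zeta> ^ k) * e k" for k
  proof -
    define x where "x = inverse (\<zeta> ^ k)"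
    have xm: "x ^ m = 1" by (simp add: x_def power_inverse pw)
    have "\<zeta> ^ k * x = 1" using z0 by (simp add: x_def)
    define f where "f i = scalar_op (x ^ i) * c ^ i" for i
    have "f m = f 0" by (simp add: f_def xm c)
    have "(\<Sum>i<m. f (Suc i)) + f 0 = (\<Sum>i<m. f i) + f m"
      using sum.lessThan_Suc_shift[of f m] by (simp add: add.commute)
    then have shift: "(\<Sum>i<m. f (Suc i)) = (\<Sum>i<m. f i)" using \<open>f m = f 0\<close> by simp
    have "c * f i = scalar_op (\<zeta> ^ k) * f (Suc i)" for i
    proof -
      have "scalar_op (\<zeta> ^ k) * f (Suc i) = scalar_op ((\<zeta> ^ k * x) * x ^ i) * (c * c ^ i)"
        by (simp only: f_def power_Suc scalar_op_hom mult.assoc)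
      also have "\<dots> = c * f i"
        unfolding \<open>\<zeta> ^ k * x = 1\<close> f_def mult_1_left
        by (simp only: mult.assoc[symmetric] scalar_op_central[of "x ^ i" c])
      finally show ?thesis by simp
    qed
    then have "c * (\<Sum>i<m. f i) = scalar_op (\<zeta> ^ k) * (\<Sum>i<m. f (Suc i))"
      by (simp add: sum_distrib_left)
    then have "c * (\<Sum>i<m. f i) = scalar_op (\<zeta> ^ k) * (\<Sum>i<m. f i)" unfolding shift .
    moreover have ek: "e k = scalar_op (1 / of_nat m) * (\<Sum>i<m. f i)" by (simp only: e_def f_def x_def)
    have "c * e k = scalar_op (1 / of_nat m) * (c * (\<Sum>i<m. f i))"
      unfolding ek by (simp only: mult.assoc[symmetric] scalar_op_central[of "1 / of_nat m" c])
    moreover have "scalar_op (1 / of_nat m) * (scalar_op (\<zeta> ^ k) * (\<Sum>i<m. f i)) = scalar_op (\<zeta> ^ k) * e k"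
      unfolding ek by (simp only: mult.assoc[symmetric] scalar_op_central[of "1 / of_nat m" "scalar_op (\<zeta> ^ k)"])
    ultimately show ?thesis by simp
  qed
  have cpow: "c ^ i * e l = scalar_op ((\<zeta> ^ l) ^ i) * e l" for i l
  proof (induction i)
    case (Suc i)
    have "c ^ Suc i * e l = c * (c ^ i * e l)" by (simp add: mult.assoc)
    also have "\<dots> = scalar_op ((\<zeta> ^ l) ^ i) * (c * e l)"
      unfolding Suc by (simp only: mult.assoc[symmetric] scalar_op_central[of "(\<zeta> ^ l) ^ i" c])
    also have "\<dots> = scalar_op ((\<zeta> ^ l) ^ i * \<zeta> ^ l) * e l"
      unfolding ce by (simp add: scalar_op_hom mult.assoc)
    finally show ?case by (simp add: mult.commute)
  qed (simp add: scalar_op_hom)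
  have orth: "e k * e l = (if k = l then e l else 0)" if kl: "k \<in> {1..m}" "l \<in> {1..m}" for k l
  proof -
    define y where "y = inverse (\<zeta> ^ k) * \<zeta> ^ l"
    have "e k * e l = scalar_op (1 / of_nat m) * (\<Sum>i<m. scalar_op (inverse (\<zeta> ^ k) ^ i) * (c ^ i * e l))"
      unfolding e_def[of k] by (simp add: sum_distrib_right mult.assoc)
    also have "\<dots> = scalar_op (1 / of_nat m) * (scalar_op (\<Sum>i<m. y ^ i) * e l)"
      unfolding cpow by (simp add: y_def power_mult_distrib scalar_op_hom(3) scalar_op_sum sum_distrib_right mult.assoc)
    also have "\<dots> = scalar_op (1 / of_nat m * (\<Sum>i<m. y ^ i)) * e l"
      by (simp only: scalar_op_hom(3) mult.assoc)
    also have "\<dots> = (if k = l then e l else 0)"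
    proof (cases "k = l")
      case True
      then have "y = 1" using z0 by (simp add: y_def)
      then show ?thesis using m True by (simp add: scalar_op_hom)
    next
      case False
      have "y ^ m = 1" by (simp add: y_def power_mult_distrib power_inverse pw)
      moreover have "y \<noteq> 1"
      proof
        assume "y = 1"
        then have eq: "\<zeta> ^ l = \<zeta> ^ k" using z0 by (simp add: y_def field_simps)
        have "\<zeta> ^ (max k l - min k l) = 1"
          using eq z0 power_diff[of \<zeta> "min k l" "max k l"] by (auto simp: max_def min_def)
        then have "m dvd max k l - min k l" by (rule z1)
        moreover have "0 < max k l - min k l" "max k l - min k l < m" using False kl by auto
        ultimately show False by (auto dest: dvd_imp_le)
      qed
      ultimately show ?thesis using False sum_roots_of_unity[of y m] by (simp add: scalar_op_hom)
    qed
    finally show ?thesis .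
  qed
  have "(\<Sum>k=1..m. e k) = 1"
  proof -
    have inner: "(\<Sum>k=1..m. inverse (\<zeta> ^ k) ^ i) = (if i = 0 then of_nat m else 0)" if "i < m" for i
    proof (cases "i = 0")
      case False
      define y where "y = inverse (\<zeta> ^ i)"
      have "y ^ m = 1" by (simp add: y_def power_inverse pw)
      moreover have "y \<noteq> 1"
      proof
        assume "y = 1"
        then have "\<zeta> ^ i = 1" using z0 by (simp add: y_def field_simps)
        then show False using z1[of i] False that by (auto dest: dvd_imp_le)
      qed
      ultimately have "(\<Sum>k<m. y ^ k) = 0" by (rule sum_roots_of_unity)
      have "(\<Sum>k=1..m. inverse (\<zeta> ^ k) ^ i) = (\<Sum>k=1..m. y ^ k)"
        by (intro sum.cong) (simp_all add: y_def power_inverse mult.commute flip: power_mult)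
      also have "\<dots> = (\<Sum>k<m. y ^ Suc k)"
        by (rule sum.reindex_bij_witness[of _ Suc "\<lambda>k. k - 1"]) auto
      also have "\<dots> = y * (\<Sum>k<m. y ^ k)" by (simp add: sum_distrib_left)
      finally show ?thesis using False \<open>(\<Sum>k<m. y ^ k) = 0\<close> by simp
    qed simp
    have "(\<Sum>k=1..m. e k) = scalar_op (1 / of_nat m) * (\<Sum>k=1..m. \<Sum>i<m. scalar_op (inverse (\<zeta> ^ k) ^ i) * c ^ i)"
      unfolding e_def by (simp add: sum_distrib_left)
    also have "(\<Sum>k=1..m. \<Sum>i<m. scalar_op (inverse (\<zeta> ^ k) ^ i) * c ^ i) =
        (\<Sum>i<m. scalar_op (\<Sum>k=1..m. inverse (\<zeta> ^ k) ^ i) * c ^ i)"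
      by (subst sum.swap) (simp add: scalar_op_sum sum_distrib_right)
    also have "\<dots> = (\<Sum>i<m. if i = 0 then scalar_op (of_nat m) else 0)"
      by (intro sum.cong refl) (use inner in \<open>simp add: scalar_op_hom\<close>)
    also have "\<dots> = scalar_op (of_nat m)" using m by simp
    also have "scalar_op (1 / of_nat m) * scalar_op (of_nat m) = 1"
      unfolding scalar_op_hom(3)[symmetric] using m by (simp add: scalar_op_hom)
    finally show ?thesis .
  qed
  then show ?thesis using that[of e] ce orth by blast
qed

text \<open>The eigenprojections stay constant and only the eigenvalues move. The projections sum to
  1, so the relation can be checked after multiplication by each of them, where one factor becomes
  \<tau>_l - \<tau>_l.\<close>

lemma finite_order_deformation:
  fixes c :: "'x linop" and m :: nat and \<tau> :: "nat \<Rightarrow> complex fps"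
  assumes m: "m > 0" and c: "c ^ m = 1"
    and \<tau>: "\<And>k. k \<in> {1..m} \<Longrightarrow> \<tau> k $ 0 = cis (2 * pi / real m) ^ k"
  obtains C where "C $ 0 = c" "(\<Prod>k\<leftarrow>[1..<Suc m]. C - scalar_fps (\<tau> k)) = 0"
proof -
  let ?\<zeta> = "cis (2 * pi / real m)"
  obtain e where e: "\<And>k. c * e k = scalar_op (?\<zeta> ^ k) * e k" "(\<Sum>k=1..m. e k) = 1"
    "\<And>k l. k \<in> {1..m} \<Longrightarrow> l \<in> {1..m} \<Longrightarrow> e k * e l = (if k = l then e l else 0)"
    using finite_order_idempotents[OF m c] by blast
  define C where "C = (\<Sum>k=1..m. scalar_fps (\<tau> k) * fps_const (e k))"
  have "C $ 0 = (\<Sum>k=1..m. c * e k)"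
    unfolding C_def fps_sum_nth by (intro sum.cong) (auto simp: e(1) \<tau>)
  then have C0: "C $ 0 = c" by (simp only: sum_distrib_left[symmetric] e(2) mult_1_right)
  have CE: "C * fps_const (e l) = scalar_fps (\<tau> l) * fps_const (e l)" if "l \<in> {1..m}" for l
  proof -
    have "C * fps_const (e l) = (\<Sum>k=1..m. scalar_fps (\<tau> k) * fps_const (e k * e l))"
      unfolding C_def sum_distrib_right by (simp add: mult.assoc)
    also have "\<dots> = (\<Sum>k=1..m. if k = l then scalar_fps (\<tau> l) * fps_const (e l) else 0)"
      using that by (intro sum.cong) (auto simp: e(3))
    finally show ?thesis using that by simp
  qed
  have prodE: "(\<Prod>k\<leftarrow>ks. C - scalar_fps (\<tau> k)) * fps_const (e l) =
    scalar_fps (\<Prod>k\<leftarrow>ks. \<tau> l - \<tau> k) * fps_const (e l)" if "l \<in> {1..m}" for l ks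
  proof (induction ks)
    case (Cons k ks)
    have "(\<Prod>k\<leftarrow>k # ks. C - scalar_fps (\<tau> k)) * fps_const (e l) =
      (C - scalar_fps (\<tau> k)) * (scalar_fps (\<Prod>k\<leftarrow>ks. \<tau> l - \<tau> k) * fps_const (e l))"
      using Cons by (simp add: mult.assoc)
    also have "\<dots> = scalar_fps (\<Prod>k\<leftarrow>ks. \<tau> l - \<tau> k) * ((C - scalar_fps (\<tau> k)) * fps_const (e l))"
      by (simp only: mult.assoc[symmetric] scalar_fps_central[of _ "C - scalar_fps (\<tau> k)"])
    also have "(C - scalar_fps (\<tau> k)) * fps_const (e l) = scalar_fps (\<tau> l - \<tau> k) * fps_const (e l)"
      using CE[OF that] by (simp add: scalar_fps_diff left_diff_distrib)
    also have "scalar_fps (\<Prod>k\<leftarrow>ks. \<tau> l - \<tau> k) * (scalar_fps (\<tau> l - \<tau> k) * fps_const (e l)) =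
      scalar_fps (\<Prod>k\<leftarrow>k # ks. \<tau> l - \<tau> k) * fps_const (e l)"
      by (simp only: list.map prod_list.Cons scalar_fps_hom(3) mult.assoc[symmetric]
        scalar_fps_central[of "\<Prod>k\<leftarrow>ks. \<tau> l - \<tau> k" "scalar_fps (\<tau> l - \<tau> k)"])
    finally show ?case .
  qed (simp add: scalar_fps_hom)
  have "(\<Prod>k\<leftarrow>[1..<Suc m]. C - scalar_fps (\<tau> k)) =
     (\<Sum>l=1..m. (\<Prod>k\<leftarrow>[1..<Suc m]. C - scalar_fps (\<tau> k)) * fps_const (e l))"
  proof -
    have "(\<Sum>l=1..m. fps_const (e l)) = 1" using e(2) by (simp add: fps_eq_iff fps_sum_nth sum.If_cases)
    then show ?thesis by (simp only: sum_distrib_left[symmetric] mult_1_right)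
  qed
  also have "\<dots> = (\<Sum>l=1..m. 0)"
  proof (intro sum.cong refl)
    fix l assume l: "l \<in> {1..m}"
    then have "(\<Prod>k\<leftarrow>[1..<Suc m]. \<tau> l - \<tau> k) = 0"
      by (auto simp: prod_list_zero_iff image_iff simp del: upt_Suc)
    then show "(\<Prod>k\<leftarrow>[1..<Suc m]. C - scalar_fps (\<tau> k)) * fps_const (e l) = 0"
      using prodE[OF l] by (simp add: scalar_fps_hom del: upt_Suc)
  qed
  finally show ?thesis using that C0 by simp
qed

context coxeter
begin

lemma alt_eqv_Nil: "i \<noteq> j \<Longrightarrow> M i j > 0 \<Longrightarrow> alt i j (2 * M i j) \<approx> []"
  using alt_flip[of i j "2 * M i j"] by simp

end

section \<open>The regular representation of W and its truncated deformation\<close>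

context polygon
begin

text \<open>The condition depends on \<open>w\<close> only through its class, so the choice is the
  same for equivalent words and \<open>NF\<close> is a model of W.\<close>

definition nf :: "nat list \<Rightarrow> nat list" where
  "nf w = (SOME u. u \<approx> w \<and> reduced u \<and> set u \<subseteq> {..<r})"

definition NF :: "nat list set" where
  "NF = nf ` {w. set w \<subseteq> {..<r}}"

lemma nf:
  assumes "set w \<subseteq> {..<r}"
  shows "nf w \<approx> w" "reduced (nf w)" "set (nf w) \<subseteq> {..<r}"
proof -
  have "\<exists>u. u \<approx> w \<and> reduced u \<and> set u \<subseteq> {..<r}" using reduced_subword[of w] assms by blast
  from someI_ex[OF this] show "nf w \<approx> w" "reduced (nf w)" "set (nf w) \<subseteq> {..<r}"
    unfolding nf_def by auto
qed

lemma nf_eqv: "u \<approx> w \<Longrightarrow> nf u = nf w"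
proof -
  assume "u \<approx> w"
  then have "v \<approx> u \<longleftrightarrow> v \<approx> w" for v using ceq_sym ceq_trans by blast
  then show ?thesis by (simp add: nf_def)
qed

lemma nf_eq_iff: "set u \<subseteq> {..<r} \<Longrightarrow> set w \<subseteq> {..<r} \<Longrightarrow> nf u = nf w \<longleftrightarrow> u \<approx> w"
  using nf(1)[of u] nf(1)[of w] nf_eqv ceq_sym ceq_trans by metis

lemma nf_in_NF [simp]: "set w \<subseteq> {..<r} \<Longrightarrow> nf w \<in> NF"
  by (auto simp: NF_def)

lemma NF_props:
  assumes "w \<in> NF"
  shows "set w \<subseteq> {..<r}" "reduced w" "nf w = w"
proof -
  obtain u where u: "w = nf u" "set u \<subseteq> {..<r}" using assms by (auto simp: NF_def)
  then show "set w \<subseteq> {..<r}" "reduced w" "nf w = w" using nf[of u] nf_eqv by auto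
qed

text \<open>Elements of W are numbered so that the operators act on one fixed type. As
  \<open>NF\<close> turns out to be infinite, this is a bijection onto the natural numbers.\<close>

definition pos :: "nat list \<Rightarrow> nat" where
  "pos = to_nat_on NF"

definition refl_perm :: "nat \<Rightarrow> nat \<Rightarrow> nat" where
  "refl_perm i n = pos (nf (i # from_nat_into NF n))"

text \<open>The index is taken modulo \<open>r\<close> so that side \<open>r\<close> is side 0
  again, as c_r = s_(r-1) s_0 requires.\<close>

definition refl_op :: "nat \<Rightarrow> nat linop" where
  "refl_op i = perm_op (refl_perm (i mod r))"

context
  assumes infinite_order: "\<exists>g. set g \<subseteq> {..<r} \<and> even (length g) \<and> (\<forall>n. concat (replicate n g) \<approx> [] \<longrightarrow> n = 0)"
begin

lemma infinite_NF: "infinite NF"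
proof -
  obtain g where g: "set g \<subseteq> {..<r}" "\<And>n. concat (replicate n g) \<approx> [] \<Longrightarrow> n = 0"
    using infinite_order by blast
  let ?f = "\<lambda>n. concat (replicate n g)"
  have sub: "set (?f n) \<subseteq> {..<r}" for n using g(1) by auto
  have "n \<le> k \<Longrightarrow> nf (?f n) = nf (?f k) \<Longrightarrow> n = k" for n k
  proof -
    assume le: "n \<le> k" and eq: "nf (?f n) = nf (?f k)"
    have "replicate k g = replicate n g @ replicate (k - n) g"
      using le by (simp flip: replicate_add)
    moreover have "?f n \<approx> ?f k" using eq nf_eq_iff[OF sub sub] by blast
    ultimately have "?f n @ [] \<approx> ?f n @ ?f (k - n)" by simp
    then have "[] \<approx> ?f (k - n)" by (simp only: ceq_append_left_iff)
    then have "?f (k - n) \<approx> []" by (rule ceq_sym)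
    then show "n = k" using g(2) le by fastforce
  qed
  then have "inj (\<lambda>n. nf (?f n))" by (intro linorder_injI) (metis less_imp_le less_irrefl)
  moreover have "range (\<lambda>n. nf (?f n)) \<subseteq> NF" using sub by auto
  ultimately show ?thesis using range_inj_infinite infinite_super by metis
qed

lemma bij_pos: "bij_betw pos NF UNIV"
  unfolding pos_def by (intro to_nat_on_infinite countableI_type infinite_NF)

lemma pos_cases: obtains u where "set u \<subseteq> {..<r}" "n = pos (nf u)"
proof -
  have "n \<in> pos ` NF" using bij_pos by (simp add: bij_betw_def)
  then obtain u where "u \<in> NF" "n = pos u" by blast
  then show ?thesis using that[of u] NF_props[of u] by simp
qed

lemma pos_eq_iff: "set u \<subseteq> {..<r} \<Longrightarrow> set w \<subseteq> {..<r} \<Longrightarrow> pos (nf u) = pos (nf w) \<longleftrightarrow> u \<approx> w"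
  using bij_pos nf_eq_iff nf_in_NF by (metis bij_betw_def inj_onD)

lemma refl_perm_pos:
  assumes "i < r" "set u \<subseteq> {..<r}"
  shows "refl_perm i (pos (nf u)) = pos (nf (i # u))"
proof -
  have "from_nat_into NF (pos (nf u)) = nf u"
    unfolding pos_def using assms(2) by (intro from_nat_into_to_nat_on countableI_type nf_in_NF)
  moreover have "nf (i # nf u) = nf (i # u)" using nf(1)[OF assms(2)] by (intro nf_eqv ceq_Cons)
  ultimately show ?thesis by (simp add: refl_perm_def)
qed

lemma foldr_refl_perm_pos:
  "set w \<subseteq> {..<r} \<Longrightarrow> set u \<subseteq> {..<r} \<Longrightarrow> foldr refl_perm w (pos (nf u)) = pos (nf (w @ u))"
  by (induction w) (auto simp: refl_perm_pos)

lemma foldr_refl_perm_eqv: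
  assumes "u \<approx> w" "set u \<subseteq> {..<r}" "set w \<subseteq> {..<r}"
  shows "foldr refl_perm u = foldr refl_perm w"
proof
  fix n
  obtain v where v: "set v \<subseteq> {..<r}" "n = pos (nf v)" by (rule pos_cases)
  then show "foldr refl_perm u n = foldr refl_perm w n"
    using nf_eqv[OF ceq_appR[OF assms(1), of v]] assms by (simp add: foldr_refl_perm_pos)
qed

lemma prod_list_refl_op:
  "set w \<subseteq> {..<r} \<Longrightarrow> prod_list (map refl_op w) = perm_op (foldr refl_perm w)"
  by (induction w) (auto simp: perm_op_id[unfolded id_def[symmetric]] refl_op_def perm_op_comp o_def)

lemma refl_op_square: "refl_op i * refl_op i = 1"
proof -
  have "i mod r < r" using r3 by simp
  then have "foldr refl_perm [i mod r, i mod r] = foldr refl_perm []"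
    by (intro foldr_refl_perm_eqv ceq_cancel) auto
  then show ?thesis by (simp add: refl_op_def perm_op_comp fun_eq_iff perm_op_id)
qed

lemma refl_op_cycle: "refl_op r = refl_op 0"
  by (simp add: refl_op_def)

lemma refl_op_order:
  assumes j: "j \<in> {1..r}" and m: "m j \<noteq> \<infinity>"
  shows "(refl_op (j - 1) * refl_op j) ^ the_enat (m j) = 1"
proof -
  let ?i = "j - 1" and ?k = "j mod r"
  have ik: "?i < r" "?k < r" "?i \<noteq> ?k" using j r3 by (cases "j = r"; auto)+
  have M: "M ?i ?k = the_enat (m j)" using polygon_matrix_edge[OF j] m by (simp add: enat_order_def)
  have "the_enat (m j) > 0" using m2[OF j] m by (cases "m j") (auto simp: numeral_eq_enat)
  then have eqv: "alt ?i ?k (2 * the_enat (m j)) \<approx> []" using alt_eqv_Nil[OF ik(3)] M by simp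
  have "refl_op j = refl_op ?k" by (simp add: refl_op_def)
  then have "(refl_op ?i * refl_op j) ^ n = prod_list (map refl_op (alt ?i ?k (2 * n)))" for n
    by (induction n) (simp_all add: mult.assoc)
  also have "prod_list (map refl_op (alt ?i ?k (2 * n))) = perm_op (foldr refl_perm (alt ?i ?k (2 * n)))" for n
    using set_alt[of ?i ?k "2 * n"] ik by (intro prod_list_refl_op) auto
  finally have "(refl_op ?i * refl_op j) ^ the_enat (m j) = perm_op (foldr refl_perm [])"
    using foldr_refl_perm_eqv[OF eqv] set_alt[of ?i ?k "2 * the_enat (m j)"] ik by fastforce
  then show ?thesis by (simp add: id_def perm_op_id)
qed

lemma foldr_funpow: "foldr f (concat (replicate n g)) = (foldr f g) ^^ n"
  by (induction n) (auto simp: fun_eq_iff)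

lemma polygon_deformation:
  fixes \<tau> :: "nat \<Rightarrow> nat \<Rightarrow> complex fps"
  assumes \<tau>: "\<And>j k. j \<in> {1..r} \<Longrightarrow> m j \<noteq> \<infinity> \<Longrightarrow> k \<in> {1..the_enat (m j)} \<Longrightarrow>
    \<tau> j k $ 0 = cis (2 * pi / real (the_enat (m j))) ^ k"
  shows "\<exists>C. (\<forall>j\<in>{1..r}. (m j \<noteq> \<infinity> \<longrightarrow> (\<Prod>k\<leftarrow>[1..<Suc (the_enat (m j))]. C j - scalar_fps (\<tau> j k)) = 0) \<and>
      C j $ 0 = refl_op (j - 1) * refl_op j) \<and>
    (\<forall>i\<le>N. (\<Prod>j\<leftarrow>[1..<Suc r]. C j) $ i = 1 $ i)"
proof -
  define Q where "Q j C \<longleftrightarrow> (m j \<noteq> \<infinity> \<longrightarrow>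
    (\<Prod>k\<leftarrow>[1..<Suc (the_enat (m j))]. C - scalar_fps (\<tau> j k)) = (0 :: nat linop fps))" for j C
  define c where "c = (\<lambda>j. refl_op (j - 1) * refl_op j)"
  have "\<exists>C0. Q j C0 \<and> C0 $ 0 = c j" if j: "j \<in> {1..r}" for j
  proof (cases "m j = \<infinity>")
    case True
    then show ?thesis by (intro exI[of _ "fps_const (c j)"]) (simp add: Q_def)
  next
    case False
    have "the_enat (m j) > 0" using m2[OF j] False by (cases "m j") (auto simp: numeral_eq_enat)
    then obtain C where "C $ 0 = c j" "(\<Prod>k\<leftarrow>[1..<Suc (the_enat (m j))]. C - scalar_fps (\<tau> j k)) = 0"
      using finite_order_deformation[of "the_enat (m j)" "c j" "\<tau> j"] refl_op_order[OF j False] \<tau>[OF j False]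
      unfolding c_def by blast
    then show ?thesis by (auto simp: Q_def)
  qed
  then obtain C0 where C0: "\<And>j. j \<in> {1..r} \<Longrightarrow> Q j (C0 j)" "\<And>j. j \<in> {1..r} \<Longrightarrow> C0 j $ 0 = c j"
    by metis
  have Q_conj: "Q j (U * C * V)" if UV: "U * V = 1" "V * U = 1" and "Q j C" for j U C V
  proof -
    have conj: "(\<Prod>k\<leftarrow>ks. U * C * V - scalar_fps (\<tau> j k)) = U * (\<Prod>k\<leftarrow>ks. C - scalar_fps (\<tau> j k)) * V" for ks
    proof (induction ks)
      case (Cons k ks)
      have "U * scalar_fps (\<tau> j k) * V = scalar_fps (\<tau> j k) * (U * V)"
        by (simp only: scalar_fps_central[of _ U, symmetric] mult.assoc)
      then have "U * C * V - scalar_fps (\<tau> j k) = U * (C - scalar_fps (\<tau> j k)) * V"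
        using UV by (simp add: right_diff_distrib left_diff_distrib)
      then have "(\<Prod>k\<leftarrow>k # ks. U * C * V - scalar_fps (\<tau> j k)) =
          U * (C - scalar_fps (\<tau> j k)) * (V * U) * (\<Prod>k\<leftarrow>ks. C - scalar_fps (\<tau> j k)) * V"
        using Cons by (simp add: mult.assoc)
      then show ?case using UV by (simp add: mult.assoc)
    qed (simp add: UV)
    then show ?thesis using \<open>Q j C\<close> by (auto simp: Q_def simp del: upt_Suc)
  qed
  obtain g where g: "set g \<subseteq> {..<r}" "even (length g)" "\<And>n. concat (replicate n g) \<approx> [] \<Longrightarrow> n = 0"
    using infinite_order by blast
  have g': "set (rev g) \<subseteq> {..<r}" using g(1) by simp
  have inv: "foldr refl_perm u (foldr refl_perm (rev u) x) = x" if "set u \<subseteq> {..<r}" for u x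
    using foldr_refl_perm_eqv[OF ceq_rev_right[of M u]] that by (simp add: fun_eq_iff)
  have "\<exists>x. prod_list (map refl_op g) * x * prod_list (map refl_op (rev g)) - x = y" for y
    unfolding prod_list_refl_op[OF g(1)] prod_list_refl_op[OF g']
  proof (rule perm_op_conj_surj)
    show "bij (foldr refl_perm g)"
      using inv[OF g(1)] inv[OF g'] by (intro o_bij[of "foldr refl_perm (rev g)"]) (auto simp: fun_eq_iff)
    \<comment> \<open>Left translation is free: a fixed point of the n-th power of \<open>g\<close>
      would make this power trivial in W.\<close>
    show "(foldr refl_perm g ^^ n) x \<noteq> x" if "n > 0" for n x
    proof
      assume *: "(foldr refl_perm g ^^ n) x = x"
      obtain u where u: "set u \<subseteq> {..<r}" "x = pos (nf u)" by (rule pos_cases)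
      let ?w = "concat (replicate n g)"
      have w: "set ?w \<subseteq> {..<r}" using g(1) by auto
      have "foldr refl_perm ?w x = x" using * by (simp only: foldr_funpow)
      then have "?w @ u \<approx> [] @ u" using w u pos_eq_iff[of "?w @ u" u] by (simp add: foldr_refl_perm_pos)
      then have "?w \<approx> []" by (simp only: ceq_append_right_iff)
      then show False using g(3)[of n] that by blast
    qed
    show "foldr refl_perm g (foldr refl_perm (rev g) x) = x" for x by (rule inv[OF g(1)])
  qed
  then have surj: "\<exists>x. perturb c (\<lambda>k. x k * c k - c k * x k) [1..<Suc r] = y" for y
    unfolding c_def by (intro perturb_polygon_surj[OF refl_op_square refl_op_cycle g(1,2)])
  have "(\<Prod>j\<leftarrow>[1..<Suc r]. c j) = refl_op 0 * refl_op 0"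
    using perturb_polygon[of refl_op r 1] refl_op_square refl_op_cycle by (auto simp: c_def)
  then have "prod_list (map c [1..<Suc r]) = 1" using refl_op_square by simp
  have "\<exists>C. (\<forall>j\<in>set [1..<Suc r]. Q j (C j) \<and> C j $ 0 = c j) \<and>
    (\<forall>i\<le>N. prod_list (map C [1..<Suc r]) $ i = 1 $ i)"
  proof (rule deform_product_relation)
    show "Q j (C0 j)" "C0 j $ 0 = c j" if "j \<in> set [1..<Suc r]" for j
      using C0 that unfolding set_upt atLeastLessThanSuc_atLeastAtMost by auto
    show "Q j (U * C * V)" if "U * V = 1" "V * U = 1" "Q j C" for j U C V
      using that by (rule Q_conj)
    show "prod_list (map c [1..<Suc r]) = 1" by fact
    show "\<exists>x. perturb c (\<lambda>j. x j * c j - c j * x j) [1..<Suc r] = y" for y by (rule surj)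
  qed
  then show ?thesis unfolding Q_def c_def set_upt atLeastLessThanSuc_atLeastAtMost .
qed

end
end

section \<open>Specialization of Laurent polynomials\<close>

text \<open>Values in a general ring are allowed because \<open>laurent_fps_nonzero\<close> uses
  weights that are polynomials.\<close>

definition weight :: "('x \<Rightarrow> 'b :: comm_ring_1) \<Rightarrow> ('x \<Rightarrow>\<^sub>0 int) \<Rightarrow> 'b" where
  "weight f e = (\<Sum>x\<in>Poly_Mapping.keys e. of_int (Poly_Mapping.lookup e x) * f x)"

lemma weight_superset:
  "finite A \<Longrightarrow> Poly_Mapping.keys e \<subseteq> A \<Longrightarrow> weight f e = (\<Sum>x\<in>A. of_int (Poly_Mapping.lookup e x) * f x)"
  unfolding weight_def by (intro sum.mono_neutral_left) (auto simp: in_keys_iff)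

lemma weight_zero [simp]: "weight f 0 = 0"
  by (simp add: weight_def)

lemma weight_single [simp]: "weight f (Poly_Mapping.single x n) = of_int n * f x"
  by (simp add: weight_def)

lemma weight_add: "weight f (d + e) = weight f d + weight f e"
proof -
  let ?A = "Poly_Mapping.keys d \<union> Poly_Mapping.keys e"
  show ?thesis
    using weight_superset[of ?A "d + e" f] weight_superset[of ?A d f] weight_superset[of ?A e f] keys_add[of d e]
    by (simp add: lookup_add distrib_right sum.distrib)
qed

text \<open>Substitution of \<open>exp (\<theta> x)\<close> for the variable \<open>x\<close>; the exponential makes negative exponents
  harmless.\<close>

global_interpretation laurent_eval: mapping_eval "\<lambda>z. z" "\<lambda>e. exp (weight \<theta> e)" for \<theta> :: "nat \<times> nat \<Rightarrow> complex"
  defines laurent_eval = laurent_eval.eval_map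
  by standard (auto simp: weight_add exp_add)

lemma laurent_eval_tvar [simp]: "laurent_eval \<theta> (tvar j k) = exp (\<theta> (j, k))"
  by (simp add: tvar_def)

text \<open>The Laurent polynomial along the curve on which the variable x is exp(\<theta>(x) +
  \<nu>(x) X): it starts at the point given by \<open>\<theta>\<close> and moves in the direction
  \<open>\<nu>\<close>.\<close>

global_interpretation laurent_fps: mapping_eval fps_const "\<lambda>e. fps_const (exp (weight \<theta> e)) * fps_exp (weight \<nu> e)"
  for \<theta> \<nu> :: "nat \<times> nat \<Rightarrow> complex"
  defines laurent_fps = laurent_fps.eval_map
proof
  show "fps_const (exp (weight \<theta> (k + l))) * fps_exp (weight \<nu> (k + l)) =
    fps_const (exp (weight \<theta> k)) * fps_exp (weight \<nu> k) *
    (fps_const (exp (weight \<theta> l)) * fps_exp (weight \<nu> l))" for k l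
    unfolding weight_add exp_add fps_exp_add_mult fps_const_mult[symmetric] by (simp only: mult_ac)
  show "fps_const a * (fps_const (exp (weight \<theta> k)) * fps_exp (weight \<nu> k)) =
    fps_const (exp (weight \<theta> k)) * fps_exp (weight \<nu> k) * fps_const a" for a k
    by (rule mult.commute)
  show "fps_const (exp (weight \<theta> 0)) * fps_exp (weight \<nu> 0) = 1"
    by (simp only: weight_zero exp_zero fps_const_1_eq_1 fps_exp_0 mult_1_left)
qed simp_all

lemma laurent_fps_tvar [simp]:
  "laurent_fps \<theta> \<nu> (tvar j k) = fps_const (exp (\<theta> (j, k))) * fps_exp (\<nu> (j, k))"
  by (simp add: tvar_def)

text \<open>The coefficients of the series say that every power sum of the \<mu>_e weighted by the
  a_e vanishes, so the same holds for the values of any polynomial. A polynomial vanishing at all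
  \<mu>_e except the one of \<open>e0\<close> isolates \<open>a e0\<close>.\<close>

lemma exponentials_independent:
  fixes a \<mu> :: "'i \<Rightarrow> complex"
  assumes "finite A" "inj_on \<mu> A" "(\<Sum>e\<in>A. fps_const (a e) * fps_exp (\<mu> e)) = 0" "e0 \<in> A"
  shows "a e0 = 0"
proof -
  have pow: "(\<Sum>e\<in>A. a e * \<mu> e ^ n) = 0" for n
  proof -
    have "(\<Sum>e\<in>A. a e * \<mu> e ^ n) / fact n = (\<Sum>e\<in>A. fps_const (a e) * fps_exp (\<mu> e)) $ n"
      by (simp only: fps_sum_nth fps_mult_left_const_nth fps_exp_nth sum_divide_distrib times_divide_eq_right of_nat_fact)
    also have "\<dots> = 0" by (simp only: assms(3) fps_zero_nth)
    finally show ?thesis by simp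
  qed
  have poly: "(\<Sum>e\<in>A. a e * poly g (\<mu> e)) = 0" for g
  proof -
    have "(\<Sum>e\<in>A. a e * poly g (\<mu> e)) = (\<Sum>i\<le>degree g. coeff g i * (\<Sum>e\<in>A. a e * \<mu> e ^ i))"
      unfolding poly_altdef sum_distrib_left by (subst sum.swap) (intro sum.cong refl, simp only: mult_ac)
    then show ?thesis by (simp add: pow)
  qed
  define g where "g = (\<Prod>e\<in>A - {e0}. [:- \<mu> e, 1:])"
  have g0: "poly g (\<mu> e) = 0" if "e \<in> A - {e0}" for e
    unfolding g_def poly_prod using that assms(1) by (intro prod_zero bexI[of _ e]) auto
  have "poly g (\<mu> e0) \<noteq> 0"
    unfolding g_def poly_prod using assms(1,2,4) by (subst prod_zero_iff) (auto dest: inj_onD)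
  moreover have "(\<Sum>e\<in>A. a e * poly g (\<mu> e)) = a e0 * poly g (\<mu> e0)"
    using assms(1,4) g0 by (subst sum.remove[of _ e0]) auto
  ultimately show ?thesis using poly[of g] by simp
qed

text \<open>With \<nu>(x) = z^(number of x), the weight of an exponent is the value at z of a
  polynomial with the exponent as its list of coefficients. Distinct exponents give distinct
  polynomials, and z only has to avoid the roots of finitely many differences.\<close>

lemma laurent_fps_nonzero:
  assumes "p \<noteq> 0"
  shows "\<exists>\<nu>. laurent_fps \<theta> \<nu> p \<noteq> 0"
proof -
  define q where "q e = weight (\<lambda>x. monom 1 (prod_encode x) :: complex poly) e" for e
  have coeff_q: "coeff (q e) (prod_encode x) = of_int (Poly_Mapping.lookup e x)" for e x
  proof -
    have "coeff (q e) (prod_encode x) = (\<Sum>y\<in>Poly_Mapping.keys e. if y = x then of_int (Poly_Mapping.lookup e x) else 0)"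
      unfolding q_def weight_def coeff_sum
      by (intro sum.cong) (auto simp: of_int_poly prod_encode_eq)
    then show ?thesis by (simp add: in_keys_iff)
  qed
  have q_inj: "d = e" if "q d = q e" for d e
    using coeff_q[of d] coeff_q[of e] that by (intro poly_mapping_eqI) (metis of_int_eq_iff)
  define K where "K = Poly_Mapping.keys p"
  define Z where "Z = (\<Union>(d, e) \<in> {(d, e) \<in> K \<times> K. d \<noteq> e}. {z. poly (q d - q e) z = 0})"
  have "finite Z" unfolding Z_def
  proof (intro finite_UN_I)
    show "finite {(d, e) \<in> K \<times> K. d \<noteq> e}" by (rule finite_subset[of _ "K \<times> K"]) (auto simp: K_def)
    show "finite (case x of (d, e) \<Rightarrow> {z. poly (q d - q e) z = 0})" if "x \<in> {(d, e) \<in> K \<times> K. d \<noteq> e}" for x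
      using that q_inj by (auto split: prod.splits intro!: poly_roots_finite simp: K_def simp del: poly_diff)
  qed
  then obtain z where z: "z \<notin> Z" using ex_new_if_finite infinite_UNIV_char_0 by blast
  define \<nu> where "\<nu> x = z ^ prod_encode x" for x
  have "weight \<nu> e = poly (q e) z" for e
    by (simp add: weight_def q_def \<nu>_def poly_sum of_int_poly poly_monom)
  then have inj: "inj_on (weight \<nu>) K" using z by (auto simp: inj_on_def Z_def)
  have "K \<noteq> {}" using assms by (simp add: K_def)
  then obtain e0 where e0: "e0 \<in> K" by blast
  have "laurent_fps \<theta> \<nu> p \<noteq> 0"
  proof
    assume "laurent_fps \<theta> \<nu> p = 0"
    then have "(\<Sum>e\<in>K. fps_const (Poly_Mapping.lookup p e * exp (weight \<theta> e)) * fps_exp (weight \<nu> e)) = 0"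
      by (simp add: laurent_fps.eval_map_def K_def mult.assoc flip: fps_const_mult)
    from exponentials_independent[OF _ inj this e0] show False
      using e0 by (simp add: K_def in_keys_iff)
  qed
  then show ?thesis by blast
qed

section \<open>Linear independence of the normal forms\<close>

lemma letters_zero [simp]: "letters 0 = []"
  by (simp add: zero_free_mon_def)

lemma letters_plus [simp]: "letters (u + v) = letters u @ letters v"
  by (simp add: plus_free_mon_def)

definition word_value :: "(letter \<Rightarrow> 'b :: ring_1) \<Rightarrow> letter free_mon \<Rightarrow> 'b" where
  "word_value L w = prod_list (map L (letters w))"

lemma word_value_simps:
  "word_value L 0 = 1" "word_value L (u + v) = word_value L u * word_value L v"
  "word_value L (Free_Mon [x]) = L x"
  by (simp_all add: word_value_def)

lemma hecke_ideal_induct: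
  assumes x: "x \<in> hecke_ideal r m"
    and zero: "P 0" and add: "\<And>x y. P x \<Longrightarrow> P y \<Longrightarrow> P (x + y)" and minus: "\<And>x. P x \<Longrightarrow> P (- x)"
    and mult: "\<And>x y. P x \<Longrightarrow> y \<in> carrier (free_algebra r (hecke_vars r m)) \<Longrightarrow> P (y * x)"
      "\<And>x y. P x \<Longrightarrow> y \<in> carrier (free_algebra r (hecke_vars r m)) \<Longrightarrow> P (x * y)"
    and rel: "\<And>x. x \<in> hecke_relators r m \<Longrightarrow> P x"
  shows "P x"
proof -
  let ?F = "free_algebra r (hecke_vars r m)"
  let ?J = "{x \<in> carrier ?F. P x}"
  have "ideal ?J ?F"
  proof (rule idealI[OF ring_free_algebra])
    show "subgroup ?J (add_monoid ?F)"
    proof (rule group.subgroupI)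
      show "group (add_monoid ?F)" by (rule abelian_group.a_group[OF ring.is_abelian_group[OF ring_free_algebra]])
      show "?J \<noteq> {}" using zero free_algebra_closed(1) by blast
      fix a assume a: "a \<in> ?J"
      have "\<ominus>\<^bsub>?F\<^esub> a = - a"
        using a free_algebra_closed(3)[of a r "hecke_vars r m"]
        by (intro abelian_group.minus_equality[OF ring.is_abelian_group[OF ring_free_algebra]]) auto
      then show "inv\<^bsub>add_monoid ?F\<^esub> a \<in> ?J"
        using a minus free_algebra_closed(3) by (simp add: a_inv_def)
    qed (auto simp: free_algebra_closed intro: add)
  qed (auto simp: free_algebra_mult_closed intro: mult)
  then have "hecke_ideal r m \<subseteq> ?J"
    unfolding hecke_ideal_def using hecke_relators_closed rel
    by (intro ring.genideal_minimal[OF ring_free_algebra]) auto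
  then show ?thesis using x by blast
qed

text \<open>\<open>half_turn True i\<close> and \<open>half_turn False i\<close> represent \<open>b\<^sub>i = c\<^sub>1\<dots>c\<^sub>i\<close> and its inverse; in \<open>\<Gamma>\<close>, \<open>b\<^sub>i = s\<^sub>0 s\<^sub>i\<close>.
  Hence \<open>b\<^sub>i\<inverse> b\<^sub>k\<close> lifts \<open>s\<^sub>i s\<^sub>k\<close>, and a word of even length in the reflections lifts to an alternating product.\<close>

definition half_turn :: "bool \<Rightarrow> nat \<Rightarrow> free_elt" where
  "half_turn e i = (if e then \<Prod>j\<leftarrow>[1..<Suc i]. gen j else \<Prod>j\<leftarrow>rev [1..<Suc i]. inv_gen j)"

fun lift_word :: "bool \<Rightarrow> nat list \<Rightarrow> free_elt" where
  "lift_word e [] = 1"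
| "lift_word e (i # w) = half_turn e i * lift_word (\<not> e) w"

context polygon
begin

abbreviation "F \<equiv> free_algebra r (hecke_vars r m)"

definition even_NF :: "nat list set" where
  "even_NF = {w \<in> NF. even (length w)}"

lemma half_turn_closed: "i < r \<Longrightarrow> half_turn e i \<in> carrier F"
  unfolding half_turn_def by (auto intro!: free_algebra_prod_list_closed free_algebra_closed simp del: upt_Suc)

lemma lift_word_closed: "set w \<subseteq> {..<r} \<Longrightarrow> lift_word e w \<in> carrier F"
  by (induction w arbitrary: e) (auto simp: free_algebra_closed intro!: free_algebra_mult_closed half_turn_closed)

end

locale letter_values =
  fixes \<phi> :: "laurent \<Rightarrow> 'b :: ring_1" and L :: "letter \<Rightarrow> 'b"
  assumes \<phi>: "\<phi> 1 = 1" "\<phi> (a + b) = \<phi> a + \<phi> b" "\<phi> (a * b) = \<phi> a * \<phi> b" and central: "\<phi> a * y = y * \<phi> a"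
begin

sublocale mapping_eval \<phi> "word_value L"
proof
  show "\<phi> a * word_value L k = word_value L k * \<phi> a" for a k by (rule central)
qed (simp_all add: \<phi> word_value_simps)

lemma eval_gens [simp]:
  "eval_map (const a) = \<phi> a" "eval_map (gen j) = L (Gen j)" "eval_map (inv_gen j) = L (Inv_Gen j)"
  by (simp_all add: const_def gen_def inv_gen_def \<phi> word_value_simps)

end

context polygon
begin

lemma lift_words_independent:
  assumes inf: "\<exists>g. set g \<subseteq> {..<r} \<and> even (length g) \<and> (\<forall>n. concat (replicate n g) \<approx> [] \<longrightarrow> n = 0)"
    and A: "finite A" "A \<subseteq> even_NF"
    and rel: "(\<Sum>w\<in>A. const (a w) * lift_word False w) \<in> hecke_ideal r m"
    and w0: "w0 \<in> A"
  shows "a w0 = 0"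
proof (rule ccontr)
  assume "a w0 \<noteq> 0"
  \<comment> \<open>Logarithms of the m_j-th roots of unity: at the constant term the relation of
    c_j becomes c_j^(m_j) = 1.\<close>
  define \<theta> :: "nat \<times> nat \<Rightarrow> complex" where "\<theta> = (\<lambda>(j, k). \<i> * complex_of_real (2 * pi / real (the_enat (m j))) * of_nat k)"
  obtain \<nu> where \<nu>: "laurent_fps \<theta> \<nu> (a w0) \<noteq> 0" using laurent_fps_nonzero \<open>a w0 \<noteq> 0\<close> by blast
  define f where "f w = laurent_fps \<theta> \<nu> (a w)" for w
  \<comment> \<open>The lowest order occurring in any coefficient is the order up to which the
    product relation will be needed.\<close>
  have "\<exists>n. \<exists>w\<in>A. f w $ n \<noteq> 0" using \<nu> w0 by (auto simp: f_def fps_eq_iff)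
  then obtain n w1 where w1: "w1 \<in> A" "f w1 $ n \<noteq> 0" and least: "\<And>k w. k < n \<Longrightarrow> w \<in> A \<Longrightarrow> f w $ k = 0"
    using exists_least_iff[of "\<lambda>n. \<exists>w\<in>A. f w $ n \<noteq> 0"] by blast
  define \<tau> where "\<tau> j k = laurent_fps \<theta> \<nu> (tvar j k)" for j k
  have "\<tau> j k $ 0 = cis (2 * pi / real (the_enat (m j))) ^ k" for j k
    by (simp add: \<tau>_def \<theta>_def cis_conv_exp exp_of_nat_mult[symmetric] mult_ac)
  then obtain C where C: "\<And>j. j \<in> {1..r} \<Longrightarrow> m j \<noteq> \<infinity> \<Longrightarrow> (\<Prod>k\<leftarrow>[1..<Suc (the_enat (m j))]. C j - scalar_fps (\<tau> j k)) = 0"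
     "\<And>j. j \<in> {1..r} \<Longrightarrow> C j $ 0 = refl_op (j - 1) * refl_op j"
     "\<And>i. i \<le> n \<Longrightarrow> (\<Prod>j\<leftarrow>[1..<Suc r]. C j) $ i = 1 $ i"
    using polygon_deformation[OF inf, of \<tau> n] by blast
  have sq: "refl_op i * (refl_op i * y) = y" for i y
    using refl_op_square[OF inf, of i] by (simp add: mult.assoc[symmetric])
  have "\<exists>D. j \<in> {1..r} \<longrightarrow> D * C j = 1 \<and> C j * D = 1 \<and> D $ 0 = refl_op j * refl_op (j - 1)" for j
  proof (cases "j \<in> {1..r}")
    case True
    have "refl_op j * refl_op (j - 1) * C j $ 0 = 1" "C j $ 0 * (refl_op j * refl_op (j - 1)) = 1"
      unfolding C(2)[OF True] using refl_op_square[OF inf] by (simp_all add: mult.assoc sq)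
    then show ?thesis using fps_unit_nc by metis
  qed blast
  then obtain D where D: "\<And>j. j \<in> {1..r} \<Longrightarrow> D j * C j = 1" "\<And>j. j \<in> {1..r} \<Longrightarrow> C j * D j = 1"
    "\<And>j. j \<in> {1..r} \<Longrightarrow> D j $ 0 = refl_op j * refl_op (j - 1)"
    by metis
  interpret letter_values "\<lambda>p. scalar_fps (laurent_fps \<theta> \<nu> p)" "\<lambda>l. case l of Gen j \<Rightarrow> C j | Inv_Gen j \<Rightarrow> D j"
  proof
    show "scalar_fps (laurent_fps \<theta> \<nu> a) * y = y * scalar_fps (laurent_fps \<theta> \<nu> a)" for a y
      by (rule scalar_fps_central)
  qed (simp_all add: laurent_fps.eval_map_add laurent_fps.eval_map_mult scalar_fps_hom)
  \<comment> \<open>The ideal is not mapped to 0 but into the series without terms up to order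
    \<open>n\<close>, which form a two-sided ideal.\<close>
  have vanish: "\<forall>i\<le>n. eval_map x $ i = 0" if "x \<in> hecke_ideal r m" for x
    using that
  proof (rule hecke_ideal_induct)
    fix x assume "x \<in> hecke_relators r m"
    then consider j where "j \<in> {1..r}" "x = gen j * inv_gen j - 1" | j where "j \<in> {1..r}" "x = inv_gen j * gen j - 1"
      | j where "j \<in> {1..r}" "m j \<noteq> \<infinity>" "x = (\<Prod>k\<leftarrow>[1..<Suc (the_enat (m j))]. gen j - const (tvar j k))"
      | "x = (\<Prod>j\<leftarrow>[1..<Suc r]. gen j) - 1"
      unfolding hecke_relators_def by blast
    then show "\<forall>i\<le>n. eval_map x $ i = 0"
    proof cases
      case 1 then show ?thesis using D by (simp add: eval_map_diff eval_map_mult)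
    next
      case 2 then show ?thesis using D by (simp add: eval_map_diff eval_map_mult)
    next
      case 3
      have "eval_map x = (\<Prod>k\<leftarrow>[1..<Suc (the_enat (m j))]. C j - scalar_fps (\<tau> j k))"
        unfolding 3(3) by (simp add: eval_map_prod_list eval_map_diff o_def \<tau>_def del: upt_Suc laurent_fps_tvar)
      then show ?thesis using C(1) 3 by simp
    next
      case 4
      have "eval_map x = (\<Prod>j\<leftarrow>[1..<Suc r]. C j) - 1"
        unfolding 4 by (simp add: eval_map_prod_list eval_map_diff o_def del: upt_Suc)
      then show ?thesis using C(3) by simp
    qed
  qed (auto simp: eval_map_add eval_map_uminus eval_map_mult fps_mult_nth)
  have C0: "prod_list (map C [1..<Suc i]) $ 0 = refl_op 0 * refl_op i"
    and D0: "prod_list (map D (rev [1..<Suc i])) $ 0 = refl_op i * refl_op 0" if "i < r" for i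
    using that by (induction i) (auto simp: C(2) D(3) refl_op_square[OF inf] mult.assoc sq)
  have ht0: "eval_map (half_turn e i) $ 0 = (if e then refl_op 0 * refl_op i else refl_op i * refl_op 0)" if "i < r" for e i
    using C0[OF that] D0[OF that] by (simp add: half_turn_def eval_map_prod_list o_def del: upt_Suc)
  have lw0: "eval_map (lift_word False w) $ 0 = prod_list (map refl_op w)" if "set w \<subseteq> {..<r}" "even (length w)" for w
    using that by (induction w rule: induct_list012) (auto simp: eval_map_mult ht0 mult.assoc sq)
  have "0 = eval_map (\<Sum>w\<in>A. const (a w) * lift_word False w) $ n"
    using vanish[OF rel] by simp
  also have "\<dots> = (\<Sum>w\<in>A. (scalar_fps (f w) * eval_map (lift_word False w)) $ n)"
    by (simp add: eval_map_sum eval_map_mult fps_sum_nth f_def)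
  also have "\<dots> = (\<Sum>w\<in>A. scalar_op (f w $ n) * prod_list (map refl_op w))"
  proof (intro sum.cong refl)
    fix w assume w: "w \<in> A"
    have "(scalar_fps (f w) * eval_map (lift_word False w)) $ n =
      (\<Sum>i=0..n. if i = n then scalar_op (f w $ n) * eval_map (lift_word False w) $ 0 else 0)"
      unfolding fps_mult_nth using least[OF _ w] by (intro sum.cong) (auto simp: scalar_op_hom)
    then show "(scalar_fps (f w) * eval_map (lift_word False w)) $ n = scalar_op (f w $ n) * prod_list (map refl_op w)"
      using lw0[of w] w A(2) NF_props(1)[of w] by (auto simp: even_NF_def)
  qed
  finally have *: "(\<Sum>w\<in>A. scalar_op (f w $ n) * prod_list (map refl_op w)) = 0" by simp
  \<comment> \<open>At the basis vector of the identity, the elements of W become distinct basis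
    vectors.\<close>
  have act: "apply_op (scalar_op z * prod_list (map refl_op w)) (Poly_Mapping.single (pos (nf [])) 1) =
    Poly_Mapping.single (pos w) z" if "w \<in> A" for w z
  proof -
    have "w \<in> NF" using that A(2) by (auto simp: even_NF_def)
    from NF_props[OF this] show ?thesis
      by (simp add: prod_list_refl_op[OF inf] apply_op_simps foldr_refl_perm_pos[OF inf] pm_scale_simps)
  qed
  have "(\<Sum>w\<in>A. Poly_Mapping.single (pos w) (f w $ n)) = 0"
  proof -
    have sum_op: "apply_op (\<Sum>w\<in>B. g w) p = (\<Sum>w\<in>B. apply_op (g w) p)" for B p and g :: "nat list \<Rightarrow> nat linop"
      by (induction B rule: infinite_finite_induct) (auto simp: apply_op_simps)
    show ?thesis
      using arg_cong[OF *, of "\<lambda>F. apply_op F (Poly_Mapping.single (pos (nf [])) 1)"] act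
      by (simp add: sum_op apply_op_simps)
  qed
  then have "(\<Sum>w\<in>A. Poly_Mapping.lookup (Poly_Mapping.single (pos w) (f w $ n)) (pos w1)) = 0"
    by (metis lookup_sum lookup_zero)
  moreover have "pos w = pos w1 \<longleftrightarrow> w = w1" if "w \<in> A" for w
    using bij_pos[OF inf] that w1(1) A(2) by (auto simp: bij_betw_def even_NF_def dest: inj_onD)
  then have "(\<Sum>w\<in>A. Poly_Mapping.lookup (Poly_Mapping.single (pos w) (f w $ n)) (pos w1)) =
     (\<Sum>w\<in>A. if w = w1 then f w1 $ n else 0)"
    by (intro sum.cong) (auto simp: lookup_single when_def)
  ultimately show False using w1 A(1) by simp
qed

end

section \<open>Spanning by the normal forms\<close>

abbreviation hecke_free :: "nat \<Rightarrow> (nat \<Rightarrow> enat) \<Rightarrow> (laurent, free_elt) module" where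
  "hecke_free r m \<equiv> free_algebra r (hecke_vars r m)"

lemma hecke_ideal_closed:
  "0 \<in> hecke_ideal r m" "x \<in> hecke_ideal r m \<Longrightarrow> y \<in> hecke_ideal r m \<Longrightarrow> x + y \<in> hecke_ideal r m"
  "x \<in> hecke_ideal r m \<Longrightarrow> - x \<in> hecke_ideal r m"
  "x \<in> hecke_ideal r m \<Longrightarrow> y \<in> carrier (hecke_free r m) \<Longrightarrow> y * x \<in> hecke_ideal r m"
  "x \<in> hecke_ideal r m \<Longrightarrow> y \<in> carrier (hecke_free r m) \<Longrightarrow> x * y \<in> hecke_ideal r m"
  "x \<in> hecke_ideal r m \<Longrightarrow> x \<in> carrier (hecke_free r m)"
proof -
  interpret ideal "hecke_ideal r m" "hecke_free r m" by (rule ideal_hecke_ideal)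
  show "0 \<in> hecke_ideal r m" using additive_subgroup.zero_closed[OF is_additive_subgroup] by simp
  show "x \<in> hecke_ideal r m \<Longrightarrow> y \<in> hecke_ideal r m \<Longrightarrow> x + y \<in> hecke_ideal r m"
    using additive_subgroup.a_closed[OF is_additive_subgroup, of x y] by simp
  show "x \<in> hecke_ideal r m \<Longrightarrow> y \<in> carrier (hecke_free r m) \<Longrightarrow> y * x \<in> hecke_ideal r m"
    using I_l_closed[of x y] by simp
  show "x \<in> hecke_ideal r m \<Longrightarrow> y \<in> carrier (hecke_free r m) \<Longrightarrow> x * y \<in> hecke_ideal r m"
    using I_r_closed[of x y] by simp
  show "x \<in> hecke_ideal r m \<Longrightarrow> x \<in> carrier (hecke_free r m)" using a_subset by blast
  show "- x \<in> hecke_ideal r m" if "x \<in> hecke_ideal r m"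
    using I_l_closed[OF that, of "- 1"] free_algebra_closed(2,3) by simp
qed

lemma relators_in_hecke_ideal: "x \<in> hecke_relators r m \<Longrightarrow> x \<in> hecke_ideal r m"
  unfolding hecke_ideal_def using ring.genideal_self[OF ring_free_algebra hecke_relators_closed] by blast

text \<open>Congruence modulo a two-sided ideal above the Hecke ideal. It is used for the Hecke
  ideal itself in the spanning argument and for the ideal of a fibre in the spherical cases.\<close>

locale hecke_quotient =
  fixes r :: nat and m :: "nat \<Rightarrow> enat" and K :: "free_elt set"
  assumes K_closed:
    "0 \<in> K" "x \<in> K \<Longrightarrow> y \<in> K \<Longrightarrow> x + y \<in> K" "x \<in> K \<Longrightarrow> - x \<in> K"
    "x \<in> K \<Longrightarrow> y \<in> carrier (hecke_free r m) \<Longrightarrow> y * x \<in> K"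
    "x \<in> K \<Longrightarrow> y \<in> carrier (hecke_free r m) \<Longrightarrow> x * y \<in> K"
    and hecke_ideal_subset: "hecke_ideal r m \<subseteq> K"
begin

lemma K_diff: "x \<in> K \<Longrightarrow> y \<in> K \<Longrightarrow> x - y \<in> K"
  using K_closed(2)[of x "- y"] K_closed(3)[of y] by simp

lemma relators_in_K: "x \<in> hecke_relators r m \<Longrightarrow> x \<in> K"
  using relators_in_hecke_ideal hecke_ideal_subset by blast

definition hcong :: "free_elt \<Rightarrow> free_elt \<Rightarrow> bool" (infix "\<doteq>" 50) where
  "x \<doteq> y \<longleftrightarrow> x \<in> carrier (hecke_free r m) \<and> y \<in> carrier (hecke_free r m) \<and> x - y \<in> K"

lemma hcong_refl: "x \<in> carrier (hecke_free r m) \<Longrightarrow> x \<doteq> x"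
  by (simp add: hcong_def K_closed)

lemma hcong_sym: "x \<doteq> y \<Longrightarrow> y \<doteq> x"
  using K_closed(3)[of "x - y"] by (simp add: hcong_def)

lemma hcong_trans [trans]: "x \<doteq> y \<Longrightarrow> y \<doteq> z \<Longrightarrow> x \<doteq> z"
  using K_closed(2)[of "x - y" "y - z"] by (simp add: hcong_def)

lemma hcong_mult: "x \<doteq> y \<Longrightarrow> z \<doteq> w \<Longrightarrow> x * z \<doteq> y * w"
proof -
  assume a: "x \<doteq> y" "z \<doteq> w"
  have "(x - y) * z + y * (z - w) \<in> K" using a by (intro K_closed(2,4,5)) (auto simp: hcong_def)
  then show ?thesis using a by (simp add: hcong_def free_algebra_mult_closed algebra_simps)
qed

lemma hcong_diff: "x \<doteq> y \<Longrightarrow> z \<doteq> w \<Longrightarrow> x - z \<doteq> y - w"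
  using K_diff[of "x - y" "z - w"] by (auto simp: hcong_def free_algebra_closed algebra_simps)

lemma hcong_mult_left: "y \<in> carrier (hecke_free r m) \<Longrightarrow> x \<doteq> z \<Longrightarrow> y * x \<doteq> y * z"
  by (intro hcong_mult hcong_refl)

lemma hcong_mult_right: "y \<in> carrier (hecke_free r m) \<Longrightarrow> x \<doteq> z \<Longrightarrow> x * y \<doteq> z * y"
  by (intro hcong_mult hcong_refl)

lemma hcong_cancel_middle:
  assumes "x * y \<doteq> 1" "a \<in> carrier (hecke_free r m)" "b \<in> carrier (hecke_free r m)"
  shows "a * x * (y * b) \<doteq> a * b"
proof -
  have "a * (x * y) * b \<doteq> a * 1 * b" using assms by (intro hcong_mult hcong_refl)
  then show ?thesis by (simp add: mult.assoc)
qed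

lemma gen_inverse:
  assumes "j \<in> {1..r}"
  shows "gen j * inv_gen j \<doteq> 1" "inv_gen j * gen j \<doteq> 1"
proof -
  have "gen j * inv_gen j - 1 \<in> hecke_relators r m" "inv_gen j * gen j - 1 \<in> hecke_relators r m"
    using assms unfolding hecke_relators_def by blast+
  then show "gen j * inv_gen j \<doteq> 1" "inv_gen j * gen j \<doteq> 1"
    using assms relators_in_K by (auto simp: hcong_def free_algebra_closed free_algebra_mult_closed)
qed

lemma gen_words_inverse:
  assumes "set js \<subseteq> {1..r}"
  shows "prod_list (map gen js) * prod_list (map inv_gen (rev js)) \<doteq> 1"
    "prod_list (map inv_gen (rev js)) * prod_list (map gen js) \<doteq> 1"
proof -
  have cl: "prod_list (map gen js) \<in> carrier (hecke_free r m)" "prod_list (map inv_gen js) \<in> carrier (hecke_free r m)" if "set js \<subseteq> {1..r}" for js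
  proof -
    have "gen ` set js \<subseteq> carrier (hecke_free r m)" "inv_gen ` set js \<subseteq> carrier (hecke_free r m)"
      using that by (intro image_subsetI free_algebra_closed(7,8); blast)+
    then show "prod_list (map gen js) \<in> carrier (hecke_free r m)" "prod_list (map inv_gen js) \<in> carrier (hecke_free r m)"
      by (simp_all add: free_algebra_prod_list_closed)
  qed
  show "prod_list (map gen js) * prod_list (map inv_gen (rev js)) \<doteq> 1" using assms
  proof (induction js)
    case (Cons j js)
    have "gen j * (prod_list (map gen js) * prod_list (map inv_gen (rev js))) * inv_gen j \<doteq> gen j * 1 * inv_gen j"
      using Cons by (intro hcong_mult hcong_refl) (auto simp: free_algebra_closed)
    also have "gen j * 1 * inv_gen j \<doteq> 1" using gen_inverse Cons.prems by simp
    finally show ?case by (simp add: mult.assoc)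
  qed (simp add: hcong_refl free_algebra_closed)
  show "prod_list (map inv_gen (rev js)) * prod_list (map gen js) \<doteq> 1" using assms
  proof (induction js)
    case (Cons j js)
    have "prod_list (map inv_gen (rev js)) * inv_gen j * (gen j * prod_list (map gen js)) \<doteq>
        prod_list (map inv_gen (rev js)) * prod_list (map gen js)"
      using Cons.prems gen_inverse cl[of js] cl[of "rev js"] by (intro hcong_cancel_middle) auto
    also have "prod_list (map inv_gen (rev js)) * prod_list (map gen js) \<doteq> 1" using Cons by simp
    finally show ?case by (simp add: mult.assoc)
  qed (simp add: hcong_refl free_algebra_closed)
qed

end

context polygon
begin

abbreviation "R \<equiv> hecke_coeffs r m"
abbreviation "I \<equiv> hecke_ideal r m"

lemmas I_closed = hecke_ideal_closed[where r = r and m = m]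

sublocale hecke_quotient r m I
  by standard (auto intro: hecke_ideal_closed)

abbreviation polygon_hcong (infix "\<doteq>" 50) where "x \<doteq> y \<equiv> hcong x y"

lemma half_turn_inverse:
  assumes "i < r"
  shows "half_turn e i * half_turn (\<not> e) i \<doteq> 1"
proof -
  have "set [1..<Suc i] \<subseteq> {1..r}" using assms by auto
  from gen_words_inverse[OF this] show ?thesis by (simp add: half_turn_def del: upt_Suc)
qed

text \<open>For \<open>j\<close> below \<open>r\<close> the product merely grows by one factor. For
  \<open>j\<close> equal to \<open>r\<close> this is the relation c_1...c_r = 1, since
  \<open>half_turn True 0\<close> is the empty product.\<close>

lemma half_turn_step:
  assumes "j \<in> {1..r}"
  shows "half_turn True (j - 1) * gen j \<doteq> half_turn True (j mod r)"
proof -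
  have eq: "half_turn True (j - 1) * gen j = (\<Prod>k\<leftarrow>[1..<Suc j]. gen k)"
    using assms by (cases j) (auto simp: half_turn_def)
  show ?thesis
  proof (cases "j = r")
    case True
    have "(\<Prod>k\<leftarrow>[1..<Suc r]. gen k) - 1 \<in> I"
      by (intro relators_in_hecke_ideal) (simp add: hecke_relators_def)
    moreover have "(\<Prod>k\<leftarrow>[1..<Suc r]. gen k) \<in> carrier F"
      by (auto intro!: free_algebra_prod_list_closed free_algebra_closed simp del: upt_Suc)
    ultimately show ?thesis unfolding eq unfolding True hcong_def
      by (simp add: half_turn_def free_algebra_closed del: upt_Suc)
  next
    case False
    then have "j < r" using assms by simp
    then have "(\<Prod>k\<leftarrow>[1..<Suc j]. gen k) = half_turn True (j mod r)" by (simp add: half_turn_def del: upt_Suc)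
    then show ?thesis unfolding eq using half_turn_closed[of "j mod r" True] r3 by (simp add: hcong_refl)
  qed
qed

text \<open>Lifts of the rotation about a vertex in both phases of the alternation: starting with
  \<open>False\<close> it is c_j itself, starting with \<open>True\<close> a conjugate of
  c_j.\<close>

lemma rotation:
  assumes j: "j \<in> {1..r}"
  shows "half_turn False (j - 1) * half_turn True (j mod r) \<doteq> gen j"
    and "half_turn True (j mod r) * half_turn False (j - 1) \<doteq>
      half_turn True (j - 1) * gen j * half_turn False (j - 1)"
    and "half_turn False (j mod r) * half_turn True (j - 1) \<doteq> inv_gen j"
proof -
  have lt: "j - 1 < r" "j mod r < r" and g: "gen j \<in> carrier F" "inv_gen j \<in> carrier F" using j r3 by (auto simp: free_algebra_closed)
  note step = half_turn_step[OF j]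
  have "half_turn False (j - 1) * half_turn True (j mod r) \<doteq> half_turn False (j - 1) * (half_turn True (j - 1) * gen j)"
    using hcong_sym[OF step] half_turn_closed[OF lt(1)] by (rule hcong_mult_left[rotated])
  also have "half_turn False (j - 1) * (half_turn True (j - 1) * gen j) \<doteq> gen j"
    using hcong_mult_right[OF g(1) half_turn_inverse[OF lt(1), of False]] by (simp add: mult.assoc)
  finally show r1: "half_turn False (j - 1) * half_turn True (j mod r) \<doteq> gen j" .
  show "half_turn True (j mod r) * half_turn False (j - 1) \<doteq> half_turn True (j - 1) * gen j * half_turn False (j - 1)"
    using hcong_sym[OF step] half_turn_closed[OF lt(1)] by (rule hcong_mult_right[rotated])
  let ?x = "half_turn False (j mod r) * half_turn True (j - 1)"
  have x: "?x \<in> carrier F" using half_turn_closed lt by (intro free_algebra_mult_closed) auto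
  have "?x \<doteq> ?x * (gen j * inv_gen j)"
    using hcong_mult_left[OF x hcong_sym[OF gen_inverse(1)[OF j]]] by simp
  also have "?x * (gen j * inv_gen j) = half_turn False (j mod r) * (half_turn True (j - 1) * gen j) * inv_gen j"
    by (simp add: mult.assoc)
  also have "half_turn False (j mod r) * (half_turn True (j - 1) * gen j) * inv_gen j \<doteq>
      half_turn False (j mod r) * half_turn True (j mod r) * inv_gen j"
    using step half_turn_closed[OF lt(2)] g by (intro hcong_mult hcong_refl)
  also have "half_turn False (j mod r) * half_turn True (j mod r) * inv_gen j \<doteq> inv_gen j"
    using hcong_mult_right[OF g(2) half_turn_inverse[OF lt(2), of False]] by simp
  finally show "?x \<doteq> inv_gen j" .
qed

text \<open>The span over the coefficient ring taken modulo the Hecke ideal, so that representatives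
  can be exchanged for congruent ones at any time.\<close>

inductive_set lspan :: "free_elt set \<Rightarrow> free_elt set" for A where
  lspan_zero: "0 \<in> lspan A"
| lspan_step: "x \<in> lspan A \<Longrightarrow> a \<in> carrier R \<Longrightarrow> u \<in> A \<Longrightarrow> x + const a * u \<in> lspan A"
| lspan_cong: "x \<in> lspan A \<Longrightarrow> y - x \<in> I \<Longrightarrow> y \<in> lspan A"

lemma lspan_hcong: "x \<in> lspan A \<Longrightarrow> y \<doteq> x \<Longrightarrow> y \<in> lspan A"
  by (rule lspan_cong) (auto simp: hcong_def)

lemma lspan_base: "u \<in> A \<Longrightarrow> u \<in> lspan A"
  using lspan_step[OF lspan_zero, of 1 u A] by (simp add: laurent_closed const_hom)

lemma lspan_add:
  assumes "x \<in> lspan A" "y \<in> lspan A"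
  shows "x + y \<in> lspan A"
  using assms(2)
proof induction
  case (lspan_step y a u)
  then show ?case using lspan.lspan_step[of "x + y" A a u] by (simp add: add.assoc)
next
  case (lspan_cong y z)
  then show ?case using lspan.lspan_cong[of "x + y" A "x + z"] by simp
qed (simp add: assms)

lemma lspan_mono: "A \<subseteq> B \<Longrightarrow> lspan A \<subseteq> lspan B"
proof
  fix x assume "A \<subseteq> B" "x \<in> lspan A"
  from this(2) show "x \<in> lspan B"
    by induction (use \<open>A \<subseteq> B\<close> in \<open>auto intro: lspan.intros\<close>)
qed

lemma lspan_mult_left:
  assumes x: "x \<in> lspan A" and y: "y \<in> carrier F" and A: "\<And>u. u \<in> A \<Longrightarrow> y * u \<in> lspan B"
  shows "y * x \<in> lspan B"
proof -
  have sc: "const a * z \<in> lspan B" if "z \<in> lspan B" and a: "a \<in> carrier R" for a z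
    using that(1)
  proof induction
    case (lspan_step x b u)
    then show ?case using lspan.lspan_step[of "const a * x" B "a * b" u] a
      by (simp add: laurent_mult_closed const_hom distrib_left mult.assoc)
  next
    case (lspan_cong x z)
    have "const a * (z - x) \<in> I" using lspan_cong a by (intro I_closed(4)) (auto simp: free_algebra_closed)
    then show ?case using lspan_cong lspan.lspan_cong[of "const a * x" B "const a * z"] by (simp add: right_diff_distrib)
  qed (simp add: lspan_zero)
  show ?thesis using x
  proof induction
    case (lspan_step x a u)
    have "y * (const a * u) = const a * (y * u)" by (simp only: mult.assoc[symmetric] const_central[of a y])
    then show ?case using lspan_step sc A lspan_add by (simp add: distrib_left)
  next
    case (lspan_cong x z)
    have "y * (z - x) \<in> I" using lspan_cong y by (intro I_closed(4))
    then show ?case using lspan_cong lspan.lspan_cong[of "y * x" B "y * z"] by (simp add: right_diff_distrib)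
  qed (simp add: lspan_zero)
qed

lemma lspan_scale: "x \<in> lspan A \<Longrightarrow> a \<in> carrier R \<Longrightarrow> const a * x \<in> lspan A"
  using lspan_mult_left[of x A "const a" A] lspan_step[OF lspan_zero, of a _ A]
  by (simp add: free_algebra_closed)

lemma lspan_mult_right:
  assumes x: "x \<in> lspan A" and y: "y \<in> carrier F" and A: "\<And>u. u \<in> A \<Longrightarrow> u * y \<in> lspan B"
  shows "x * y \<in> lspan B"
  using x
proof induction
  case (lspan_step x a u)
  then show ?case using lspan_scale A lspan_add by (simp add: distrib_right mult.assoc)
next
  case (lspan_cong x z)
  have "(z - x) * y \<in> I" using lspan_cong y by (intro I_closed(5))
  then show ?case using lspan_cong lspan.lspan_cong[of "x * y" B "z * y"] by (simp add: left_diff_distrib)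
qed (simp add: lspan_zero)

lemma lspan_trans: "x \<in> lspan A \<Longrightarrow> (\<And>u. u \<in> A \<Longrightarrow> u \<in> lspan B) \<Longrightarrow> x \<in> lspan B"
  using lspan_mult_left[of x A 1 B] by (simp add: free_algebra_closed)

lemma lspan_sum: "(\<And>i. i \<in> J \<Longrightarrow> f i \<in> lspan A) \<Longrightarrow> sum f J \<in> lspan A"
  by (induction J rule: infinite_finite_induct) (auto intro: lspan_add lspan_zero)

lemma lspan_uminus: "x \<in> lspan A \<Longrightarrow> - x \<in> lspan A"
proof -
  assume "x \<in> lspan A"
  then have "const (- 1) * x \<in> lspan A" by (intro lspan_scale) (auto simp: laurent_closed)
  moreover have "const (- 1) = - 1" using const_hom(2)[of 1 "- 1"] by (simp add: const_hom(1) const_def eq_neg_iff_add_eq_0 add.commute)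
  ultimately show ?thesis by simp
qed

end

lemma poly_mapping_sum_single: "x = (\<Sum>w\<in>Poly_Mapping.keys x. Poly_Mapping.single w (Poly_Mapping.lookup x w))"
proof (rule poly_mapping_eqI)
  fix k
  have "(\<Sum>w\<in>Poly_Mapping.keys x. Poly_Mapping.lookup (Poly_Mapping.single w (Poly_Mapping.lookup x w)) k) =
    (\<Sum>w\<in>Poly_Mapping.keys x. if w = k then Poly_Mapping.lookup x k else 0)"
    by (intro sum.cong) (auto simp: lookup_single when_def)
  then show "Poly_Mapping.lookup x k = Poly_Mapping.lookup (\<Sum>w\<in>Poly_Mapping.keys x. Poly_Mapping.single w (Poly_Mapping.lookup x w)) k"
    by (simp add: lookup_sum in_keys_iff)
qed

lemma const_uminus: "const (- a) = - const a"
  using const_hom(2)[of a "- a"] by (simp add: const_def eq_neg_iff_add_eq_0 add.commute)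

lemma const_zero: "const 0 = 0"
  by (simp add: const_def)

text \<open>Both ends matter later: the leading coefficient is 1, and the constant one is, up to
  sign, the product of the roots. The vanishing of \<open>p\<close> beyond the degree only supports
  the recursion.\<close>

lemma monic_product_expansion:
  fixes u :: free_elt
  assumes "set ts \<subseteq> carrier (laurent_ring V)"
  shows "\<exists>p. (\<forall>i. p i \<in> carrier (laurent_ring V)) \<and> p (length ts) = 1 \<and>
    p 0 = prod_list (map uminus ts) \<and> (\<forall>i>length ts. p i = 0) \<and>
    (\<Prod>t\<leftarrow>ts. u - const t) = (\<Sum>i\<le>length ts. const (p i) * u ^ i)"
  using assms
proof (induction ts)
  case Nil
  show ?case by (intro exI[of _ "\<lambda>i. if i = 0 then 1 else 0"]) (auto simp: laurent_closed const_hom)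
next
  case (Cons t ts)
  then obtain p where p: "\<And>i. p i \<in> carrier (laurent_ring V)" "p (length ts) = 1"
    "p 0 = prod_list (map uminus ts)" "\<And>i. i > length ts \<Longrightarrow> p i = 0"
    "(\<Prod>t\<leftarrow>ts. u - const t) = (\<Sum>i\<le>length ts. const (p i) * u ^ i)" by auto
  let ?n = "length ts"
  define q where "q i = (case i of 0 \<Rightarrow> 0 | Suc k \<Rightarrow> p k) + (- t) * p i" for i
  have t: "- t \<in> carrier (laurent_ring V)" using Cons.prems by (auto intro: laurent_closed)
  have "q i \<in> carrier (laurent_ring V)" for i
  proof (cases i)
    case 0
    then show ?thesis using laurent_mult_closed[OF t p(1)[of 0]] by (simp add: q_def)
  next
    case (Suc k)
    then show ?thesis using laurent_closed(4)[OF p(1)[of k] laurent_mult_closed[OF t p(1)[of i]]] by (simp add: q_def)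
  qed
  moreover have "q (Suc ?n) = 1" "q 0 = prod_list (map uminus (t # ts))" "\<forall>i>Suc ?n. q i = 0"
    using p by (auto simp: q_def split: nat.splits)
  moreover have "(u - const t) * (\<Sum>i\<le>?n. const (p i) * u ^ i) = (\<Sum>i\<le>Suc ?n. const (q i) * u ^ i)"
  proof -
    have "(\<Sum>i\<le>Suc ?n. const (case i of 0 \<Rightarrow> 0 | Suc k \<Rightarrow> p k) * u ^ i) = (\<Sum>i\<le>?n. const (p i) * u ^ Suc i)"
      by (subst sum.atMost_Suc_shift) (simp add: const_zero)
    also have "\<dots> = u * (\<Sum>i\<le>?n. const (p i) * u ^ i)"
      unfolding sum_distrib_left
      by (intro sum.cong refl) (simp only: power_Suc mult.assoc[symmetric] const_central[of _ u])
    finally have 1: "(\<Sum>i\<le>Suc ?n. const (case i of 0 \<Rightarrow> 0 | Suc k \<Rightarrow> p k) * u ^ i) = u * (\<Sum>i\<le>?n. const (p i) * u ^ i)" .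
    have "(\<Sum>i\<le>Suc ?n. const (- t * p i) * u ^ i) = - const t * (\<Sum>i\<le>?n. const (p i) * u ^ i)"
      using p(4)[of "Suc ?n"] by (simp add: const_zero sum_distrib_left const_hom const_uminus mult.assoc)
    then show ?thesis using 1 unfolding q_def const_hom distrib_right sum.distrib
      by (simp add: left_diff_distrib)
  qed
  ultimately show ?case using p(5) by (intro exI[of _ q]) simp
qed

lemma tvar_unit:
  assumes "(j, k) \<in> V"
  shows "\<exists>b\<in>carrier (laurent_ring V). b * tvar j k = 1"
proof -
  have "Poly_Mapping.single (Poly_Mapping.single (j, k) (- 1)) 1 * tvar j k = 1"
    by (simp add: tvar_def mult_single single_add[symmetric])
  moreover have "Poly_Mapping.single (Poly_Mapping.single (j, k) (- 1)) 1 \<in> carrier (laurent_ring V)"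
    using assms by (simp add: laurent_ring_def)
  ultimately show ?thesis by blast
qed

lemma prod_list_units:
  assumes "\<And>t. t \<in> set ts \<Longrightarrow> \<exists>b\<in>carrier (laurent_ring V). b * t = 1"
  shows "\<exists>b\<in>carrier (laurent_ring V). b * prod_list (map uminus ts) = 1"
  using assms
proof (induction ts)
  case Nil
  show ?case by (intro bexI[of _ 1]) (auto simp: laurent_closed)
next
  case (Cons t ts)
  then obtain b where b: "b \<in> carrier (laurent_ring V)" "b * prod_list (map uminus ts) = 1" by auto
  obtain c where c: "c \<in> carrier (laurent_ring V)" "c * t = 1" using Cons.prems by auto
  have "(- (c * b)) * prod_list (map uminus (t # ts)) = (c * t) * (b * prod_list (map uminus ts))"
    by (simp add: mult_ac)
  then show ?case using b c laurent_closed(3)[OF laurent_mult_closed[OF c(1) b(1)]]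
    by (intro bexI[of _ "- (c * b)"]) simp_all
qed

section \<open>The Hecke relations as deformed braid relations\<close>

context polygon
begin

lemma hcong_prod_list_conj:
  assumes A: "a * b \<doteq> 1" "b * a \<doteq> 1" and cl: "a \<in> carrier F" "b \<in> carrier F" "g \<in> carrier F"
    and ts: "set ts \<subseteq> carrier R" and u: "u \<doteq> a * g * b"
  shows "(\<Prod>t\<leftarrow>ts. u - const t) \<doteq> a * (\<Prod>t\<leftarrow>ts. g - const t) * b"
  using ts
proof (induction ts)
  case Nil
  then show ?case using A(1) by (simp add: hcong_sym)
next
  case (Cons t ts)
  have t: "const t \<in> carrier F" using Cons.prems by (auto intro: free_algebra_closed)
  have P: "(\<Prod>t\<leftarrow>ts. g - const t) \<in> carrier F"
    using Cons.prems cl by (auto intro!: free_algebra_prod_list_closed free_algebra_closed)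
  have "a * const t * b \<doteq> const t * 1"
    using hcong_mult_left[OF t A(1)] by (simp only: mult.assoc[symmetric] const_central[of t a])
  then have "u - const t \<doteq> a * g * b - a * const t * b" using u by (intro hcong_diff) (auto intro: hcong_sym)
  then have "u - const t \<doteq> a * (g - const t) * b" by (simp add: right_diff_distrib left_diff_distrib)
  then have "(\<Prod>t\<leftarrow>t # ts. u - const t) \<doteq> (a * (g - const t) * b) * (a * (\<Prod>t\<leftarrow>ts. g - const t) * b)"
    using Cons by (simp add: hcong_mult)
  also have "(a * (g - const t) * b) * (a * (\<Prod>t\<leftarrow>ts. g - const t) * b) =
    a * (g - const t) * b * (a * ((\<Prod>t\<leftarrow>ts. g - const t) * b))" by (simp add: mult.assoc)
  also have "\<dots> \<doteq> a * (g - const t) * ((\<Prod>t\<leftarrow>ts. g - const t) * b)"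
    using A(2) cl P t by (intro hcong_cancel_middle) (auto simp: free_algebra_closed free_algebra_mult_closed)
  finally show ?case by (simp add: mult.assoc)
qed

lemma lift_word_append: "lift_word e (u @ v) = lift_word e u * lift_word (if even (length u) then e else \<not> e) v"
  by (induction u arbitrary: e) (auto simp: mult.assoc)

lemma half_turn_cancel: "i < r \<Longrightarrow> y \<in> carrier F \<Longrightarrow> half_turn e i * (half_turn (\<not> e) i * y) \<doteq> y"
  using hcong_mult_right[OF _ half_turn_inverse, of y i e] by (simp add: mult.assoc)

text \<open>The alternating words in two letters form a single bi-infinite orbit of one rotation.\<close>

lemma rotation_power_alt:
  fixes e :: bool
  assumes ik: "i < r" "k < r"
  defines "u \<equiv> half_turn e i * half_turn (\<not> e) k"
  assumes "l \<le> n"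
  shows "u ^ l * lift_word e (alt k i n) \<doteq>
    lift_word e (if 2 * l < n then alt k i (n - 2 * l) else alt i k (2 * l - n))"
  using assms(4)
proof (induction l)
  case 0
  have "lift_word e (alt k i n) \<in> carrier F" using set_alt[of k i n] ik by (intro lift_word_closed) auto
  then show ?case by (auto simp: hcong_refl intro: hcong_refl)
next
  case (Suc l)
  have u: "u \<in> carrier F" unfolding u_def using ik by (intro free_algebra_mult_closed half_turn_closed)
  have cl: "lift_word e' (alt x y n) \<in> carrier F" if "{x, y} \<subseteq> {i, k}" for e' x y n
    using set_alt[of x y n] ik that by (intro lift_word_closed) auto
  have "u * (u ^ l * lift_word e (alt k i n)) \<doteq>
    u * lift_word e (if 2 * l < n then alt k i (n - 2 * l) else alt i k (2 * l - n))"
    using Suc by (intro hcong_mult_left[OF u]) auto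
  also have "u * lift_word e (if 2 * l < n then alt k i (n - 2 * l) else alt i k (2 * l - n)) \<doteq>
    lift_word e (if 2 * Suc l < n then alt k i (n - 2 * Suc l) else alt i k (2 * Suc l - n))"
  proof -
    consider q where "n = 2 * l + Suc (Suc q)" | "n = 2 * l + 1" | q where "2 * l = n + q"
    proof (cases "2 * l \<ge> n")
      case True
      then show thesis using that(3) by (auto simp: le_iff_add)
    next
      case False
      then obtain d where "n = 2 * l + Suc d" by (auto simp: not_le less_iff_Suc_add)
      then show thesis using that(1,2) by (cases d) auto
    qed
    then show ?thesis
    proof cases
      case 1
      have "u * lift_word e (alt k i (Suc (Suc q))) \<doteq> half_turn e i * (half_turn (\<not> e) i * lift_word e (alt k i q))"
        using half_turn_cancel[OF ik(2), of "half_turn (\<not> e) i * lift_word e (alt k i q)" "\<not> e"] ik cl[of k i e q]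
        by (simp add: u_def mult.assoc) (intro hcong_mult_left half_turn_closed; simp add: free_algebra_mult_closed half_turn_closed)
      also have "\<dots> \<doteq> lift_word e (alt k i q)" using half_turn_cancel[OF ik(1)] cl[of k i e q] by simp
      finally have "u * lift_word e (alt k i (Suc (Suc q))) \<doteq> lift_word e (alt k i q)" .
      moreover have "(if 2 * l < n then alt k i (n - 2 * l) else alt i k (2 * l - n)) = alt k i (Suc (Suc q))"
        using 1 by (simp del: alt.simps)
      moreover have "(if 2 * Suc l < n then alt k i (n - 2 * Suc l) else alt i k (2 * Suc l - n)) = alt k i q"
        using 1 by (cases q) auto
      ultimately show ?thesis by (simp only:)
    next
      case 2
      have "u * lift_word e (alt k i 1) \<doteq> lift_word e (alt i k 1)"
        using hcong_mult_left[OF half_turn_closed[OF ik(1), of e] half_turn_inverse[OF ik(2), of "\<not> e"]]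
        by (simp add: u_def mult.assoc)
      then show ?thesis using 2 by simp
    next
      case 3
      have "u * lift_word e (alt i k q) = lift_word e (alt i k (Suc (Suc q)))"
        by (simp add: u_def mult.assoc)
      moreover have "2 * Suc l - n = Suc (Suc q)" using 3 by simp
      ultimately show ?thesis using 3 cl[of i k e "Suc (Suc q)"] by (auto simp: hcong_refl simp del: alt.simps)
    qed
  qed
  finally show ?case by (simp only: power_Suc mult.assoc)
qed

lemma lspan_cancel_unit:
  assumes "const a * x \<in> lspan A" "b \<in> carrier R" "b * a = 1"
  shows "x \<in> lspan A"
proof -
  have "const b * (const a * x) \<in> lspan A" by (rule lspan_scale[OF assms(1,2)])
  moreover have "const b * (const a * x) = x"
    using assms(3) by (simp add: mult.assoc[symmetric] const_hom(3)[symmetric] const_hom(1))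
  ultimately show ?thesis by simp
qed

text \<open>The rotation \<open>u\<close> satisfies the Hecke relation of c_j. Multiplying this
  relation by the lift of \<open>alt y x n\<close> turns the powers of \<open>u\<close> into the
  alternating words of length |n - 2l|, running from one side of the braid relation at l = 0 to the
  other at l = n. All intermediate words are shorter by at least 2, and the coefficients at both
  ends are units, so either end can be solved for.\<close>

lemma braid_exchange_oriented:
  assumes j: "j \<in> {1..r}" and mj: "m j = enat n" and n: "n > 0"
    and xy: "(x, y) = (if e then (j mod r, j - 1) else (j - 1, j mod r))"
  defines "low \<equiv> {lift_word e v | v. set v \<subseteq> {x, y} \<and> length v + 2 \<le> n \<and> even (length v) = even n}"
  shows "lift_word e (alt x y n) \<in> lspan (insert (lift_word e (alt y x n)) low)"
    and "lift_word e (alt y x n) \<in> lspan (insert (lift_word e (alt x y n)) low)"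
proof -
  let ?ts = "map (tvar j) [1..<Suc n]"
  define u where "u = half_turn e x * half_turn (\<not> e) y"
  have lt: "x < r" "y < r" using j xy r3 by (auto split: if_splits)
  have hv: "(j, k) \<in> hecke_vars r m" if "k \<in> {1..n}" for k
    using that j mj by (auto simp: hecke_vars_def)
  have ts: "set ?ts \<subseteq> carrier R" using hv by (auto intro!: laurent_closed simp del: upt_Suc)
  have g: "gen j \<in> carrier F" using j by (simp add: free_algebra_closed)
  have rel: "(\<Prod>t\<leftarrow>?ts. gen j - const t) \<in> I"
  proof (rule relators_in_hecke_ideal)
    have "(\<Prod>t\<leftarrow>?ts. gen j - const t) = (\<Prod>k\<leftarrow>[1..<Suc (the_enat (m j))]. gen j - const (tvar j k))"
      by (simp add: mj o_def del: upt_Suc)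
    then show "(\<Prod>t\<leftarrow>?ts. gen j - const t) \<in> hecke_relators r m"
      unfolding hecke_relators_def using j mj by blast
  qed
  \<comment> \<open>\<open>u\<close> is c_j itself or a conjugate of it, depending on the phase;
    conjugates satisfy the same relation.\<close>
  obtain a b where ab: "a * b \<doteq> 1" "b * a \<doteq> 1" "a \<in> carrier F" "b \<in> carrier F" "u \<doteq> a * gen j * b"
  proof (cases e)
    case True
    have "j - 1 < r" using j by auto
    then show ?thesis using True xy rotation(2)[OF j] half_turn_inverse[of "j - 1" True] half_turn_inverse[of "j - 1" False]
        half_turn_closed by (intro that[of "half_turn True (j - 1)" "half_turn False (j - 1)"]) (auto simp: u_def)
  next
    case False
    then show ?thesis using xy rotation(1)[OF j] free_algebra_closed(2)
      by (intro that[of 1 1]) (auto simp: u_def hcong_refl)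
  qed
  have "(\<Prod>t\<leftarrow>?ts. u - const t) \<doteq> a * (\<Prod>t\<leftarrow>?ts. gen j - const t) * b"
    by (rule hcong_prod_list_conj[OF ab(1-4) g ts ab(5)])
  moreover have "a * (\<Prod>t\<leftarrow>?ts. gen j - const t) * b \<in> I" using rel ab by (intro I_closed(4,5))
  ultimately have uI: "(\<Prod>t\<leftarrow>?ts. u - const t) \<in> I"
    using I_closed(2) by (fastforce simp: hcong_def)
  obtain p where p: "\<And>i. p i \<in> carrier R" "p n = 1" "p 0 = prod_list (map uminus ?ts)"
     "(\<Prod>t\<leftarrow>?ts. u - const t) = (\<Sum>i\<le>n. const (p i) * u ^ i)"
    using monic_product_expansion[OF ts, of u] by (auto simp del: upt_Suc)
  obtain b0 where b0: "b0 \<in> carrier R" "b0 * p 0 = 1"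
  proof -
    have "\<exists>b\<in>carrier R. b * t = 1" if "t \<in> set ?ts" for t
      using that hv tvar_unit by (auto simp del: upt_Suc)
    from prod_list_units[OF this] show thesis using that unfolding p(3) by blast
  qed
  define T where "T l = (if 2 * l < n then alt y x (n - 2 * l) else alt x y (2 * l - n))" for l
  let ?w = "lift_word e (alt y x n)"
  have wcl: "?w \<in> carrier F" using set_alt[of y x n] lt by (intro lift_word_closed) auto
  have T: "u ^ l * ?w \<doteq> lift_word e (T l)" if "l \<le> n" for l
    using rotation_power_alt[OF lt that, of e] by (simp add: u_def T_def)
  have T0: "T 0 = alt y x n" using n by (simp add: T_def)
  have Tn: "T n = alt x y n" using n by (simp add: T_def mult_2)
  have mid: "lift_word e (T l) \<in> low" if "0 < l" "l < n" for l
  proof -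
    have "set (T l) \<subseteq> {x, y}" using set_alt[of y x] set_alt[of x y] by (auto simp: T_def)
    moreover have "length (T l) + 2 \<le> n" "even (length (T l)) = even n" using that by (auto simp: T_def)
    ultimately show ?thesis unfolding low_def by blast
  qed
  have sum0: "(\<Sum>i\<le>n. const (p i) * (u ^ i * ?w)) \<in> I"
    using I_closed(5)[OF uI wcl] unfolding p(4) by (simp add: sum_distrib_right mult.assoc)
  have summand: "const (p l) * (u ^ l * ?w) \<in> lspan A" if "l \<le> n" "lift_word e (T l) \<in> lspan A" for l A
    using that lspan_hcong[OF _ T] p(1) lspan_scale by blast
  have others: "const (p l) * (u ^ l * ?w) \<in> lspan A"
    if "{..n} = insert l S" "l \<notin> S" "\<And>i. i \<in> S \<Longrightarrow> lift_word e (T i) \<in> lspan A" for l S A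
  proof -
    have "finite S" using that(1) by (metis finite_atMost finite_insert)
    then have "(\<Sum>i\<le>n. const (p i) * (u ^ i * ?w)) = const (p l) * (u ^ l * ?w) + (\<Sum>i\<in>S. const (p i) * (u ^ i * ?w))"
      using that by simp
    then have "const (p l) * (u ^ l * ?w) - - (\<Sum>i\<in>S. const (p i) * (u ^ i * ?w)) \<in> I" using sum0 by simp
    moreover have "- (\<Sum>i\<in>S. const (p i) * (u ^ i * ?w)) \<in> lspan A"
      using that by (intro lspan_uminus lspan_sum summand) auto
    ultimately show ?thesis using lspan_cong by blast
  qed
  show "lift_word e (alt x y n) \<in> lspan (insert ?w low)"
  proof -
    have "const (p n) * (u ^ n * ?w) \<in> lspan (insert ?w low)"
    proof (rule others[of n "{..<n}"])
      show "lift_word e (T i) \<in> lspan (insert ?w low)" if "i \<in> {..<n}" for i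
        using that mid[of i] T0 by (cases "i = 0") (auto intro: lspan_base)
    qed auto
    then have "u ^ n * ?w \<in> lspan (insert ?w low)" by (simp add: p(2) const_hom(1))
    then show ?thesis using lspan_hcong[OF _ hcong_sym[OF T[of n]]] Tn by simp
  qed
  show "?w \<in> lspan (insert (lift_word e (alt x y n)) low)"
  proof -
    have "const (p 0) * (u ^ 0 * ?w) \<in> lspan (insert (lift_word e (alt x y n)) low)"
    proof (rule others[of 0 "{0<..n}"])
      show "lift_word e (T i) \<in> lspan (insert (lift_word e (alt x y n)) low)" if "i \<in> {0<..n}" for i
        using that mid[of i] Tn by (cases "i = n") (auto intro: lspan_base)
    qed auto
    from lspan_cancel_unit[OF this b0] show ?thesis by simp
  qed
qed

lemma braid_exchange:
  assumes "M i k = n" "n > 0" "i \<noteq> k"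
  shows "lift_word e (alt i k n) \<in> lspan (insert (lift_word e (alt k i n))
    {lift_word e v | v. set v \<subseteq> {i, k} \<and> length v + 2 \<le> n \<and> even (length v) = even n})"
proof -
  obtain j where j: "j \<in> {1..r}" "{i, k} = {j - 1, j mod r}" "m j = enat n"
    using polygon_matrix_pos[of i k] assms by auto
  obtain x y where xy: "(x, y) = (if e then (j mod r, j - 1) else (j - 1, j mod r))" by (metis surj_pair)
  then have "{i, k} = {x, y}" using j(2) by (auto split: if_splits)
  then consider "i = x" "k = y" | "i = y" "k = x" by (auto simp: doubleton_eq_iff)
  then show ?thesis
    using braid_exchange_oriented[OF j(1,3) assms(2) xy] by cases (simp_all add: insert_commute)
qed

end

section \<open>Induction on the length of words\<close>

context polygon
begin

text \<open>Parity makes lengths drop in steps of two: the bound n admits only words properly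
  shorter than n, while the bound n + 2 also admits those of length n.\<close>

definition low_lifts :: "bool \<Rightarrow> nat \<Rightarrow> free_elt set" where
  "low_lifts e n = {lift_word e v | v. v \<in> NF \<and> length v + 2 \<le> n \<and> even (length v) = even n}"

lemma low_lifts_mono: "k \<le> n \<Longrightarrow> even k = even n \<Longrightarrow> lspan (low_lifts e k) \<subseteq> lspan (low_lifts e n)"
  by (intro lspan_mono) (auto simp: low_lifts_def)

lemma NF_reduced_eqv_length: "reduced u \<Longrightarrow> u \<approx> w \<Longrightarrow> reduced w \<Longrightarrow> length u = length w"
  using len_eqv by (simp add: reduced_def)

lemma reduced_Cons: "reduced (i # w) \<Longrightarrow> reduced w"
  using reduced_append2[of "[i]" w] by simp

text \<open>The two halves of a simultaneous induction: every word is a combination of normal forms, and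
  reduced words of the same group element agree up to shorter words. The second half is the
  analogue of Matsumoto's theorem.\<close>

lemma spanning_step:
  assumes span: "\<And>e k w. k < n \<Longrightarrow> set w \<subseteq> {..<r} \<Longrightarrow> length w = k \<Longrightarrow>
      lift_word e w \<in> lspan (low_lifts e (k + 2))"
    and same: "\<And>e k u u'. k < n \<Longrightarrow> set u \<subseteq> {..<r} \<Longrightarrow> set u' \<subseteq> {..<r} \<Longrightarrow> reduced u \<Longrightarrow> reduced u' \<Longrightarrow>
      u \<approx> u' \<Longrightarrow> length u = k \<Longrightarrow> lift_word e u \<in> lspan (insert (lift_word e u') (low_lifts e k))"
  shows "set u \<subseteq> {..<r} \<Longrightarrow> set u' \<subseteq> {..<r} \<Longrightarrow> reduced u \<Longrightarrow> reduced u' \<Longrightarrow>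
      u \<approx> u' \<Longrightarrow> length u = n \<Longrightarrow> lift_word e u \<in> lspan (insert (lift_word e u') (low_lifts e n))"
    and "set w \<subseteq> {..<r} \<Longrightarrow> length w = n \<Longrightarrow> lift_word e w \<in> lspan (low_lifts e (n + 2))"
proof -
  have short: "lift_word e v \<in> lspan (low_lifts e n)" if "set v \<subseteq> {..<r}" "length v + 2 \<le> n" "even (length v) = even n" for e v
    using span[of "length v" v e] that low_lifts_mono[of "length v + 2" n e] by auto
  have low_Cons: "half_turn e i * x \<in> lspan (low_lifts e n)"
    if x_low: "x \<in> low_lifts (\<not> e) k" and k: "k < n" "even k \<noteq> even n" "i < r" for e i x k
  proof -
    obtain v where v: "x = lift_word (\<not> e) v" "v \<in> NF" "length v + 2 \<le> k" "even (length v) = even k"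
      using x_low unfolding low_lifts_def by blast
    then have "lift_word e (i # v) \<in> lspan (low_lifts e n)"
      using k NF_props(1)[OF v(2)] by (intro short) auto
    then show ?thesis by (simp add: v(1))
  qed
  have same_head: "lift_word e (i # u) \<in> lspan (insert (lift_word e (i # u')) (low_lifts e n))"
    if "set (i # u) \<subseteq> {..<r}" "set (i # u') \<subseteq> {..<r}" "reduced (i # u)" "reduced (i # u')" "i # u \<approx> i # u'"
      "length (i # u) = n" for e i u u'
  proof -
    have "lift_word (\<not> e) u \<in> lspan (insert (lift_word (\<not> e) u') (low_lifts (\<not> e) (length u)))"
      using that reduced_Cons by (intro same) (auto simp: ceq_Cons_iff)
    moreover have "half_turn e i \<in> carrier F" using that by (intro half_turn_closed) auto
    ultimately have "half_turn e i * lift_word (\<not> e) u \<in> lspan (insert (lift_word e (i # u')) (low_lifts e n))"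
    proof (rule lspan_mult_left)
      fix x assume "x \<in> insert (lift_word (\<not> e) u') (low_lifts (\<not> e) (length u))"
      then show "half_turn e i * x \<in> lspan (insert (lift_word e (i # u')) (low_lifts e n))"
      proof
        assume "x = lift_word (\<not> e) u'"
        then show ?thesis by (intro lspan_base) simp
      next
        assume "x \<in> low_lifts (\<not> e) (length u)"
        then have "half_turn e i * x \<in> lspan (low_lifts e n)" using that by (intro low_Cons) auto
        then show ?thesis using lspan_mono[of "low_lifts e n"] by blast
      qed
    qed
    then show ?thesis by simp
  qed
  have low_sub: "lspan (low_lifts e n) \<subseteq> lspan (insert x (low_lifts e n))" for x e
    by (rule lspan_mono) blast
  have chain: "a \<in> lspan (insert c (low_lifts e n))"
    if "a \<in> lspan (insert b (low_lifts e n))" "b \<in> lspan (insert c (low_lifts e n))" for a b c e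
    by (rule lspan_trans[OF that(1)]) (use that(2) low_sub in \<open>auto intro: lspan_base\<close>)
  show M: "lift_word e u \<in> lspan (insert (lift_word e u') (low_lifts e n))"
    if u: "set u \<subseteq> {..<r}" "set u' \<subseteq> {..<r}" "reduced u" "reduced u'" "u \<approx> u'" "length u = n" for e u u'
  proof (cases u)
    case Nil
    then have "u' = []" using NF_reduced_eqv_length[OF u(3,5,4)] by simp
    then show ?thesis using Nil by (auto intro: lspan_base)
  next
    case (Cons i u1)
    have len': "length u' = n" using NF_reduced_eqv_length[OF u(3,5,4)] u(6) by simp
    then obtain j u1' where u': "u' = j # u1'" using Cons u(6) by (cases u') auto
    show ?thesis
    proof (cases "i = j")
      case True
      then show ?thesis using same_head[of i u1 u1'] u Cons u' by simp
    next
      case False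
      \<comment> \<open>Both first letters are descents, so the element has a reduced word beginning
        with the braid in \<open>i\<close> and \<open>j\<close>. The passage from \<open>u\<close>
        to \<open>u'\<close> goes via \<open>?v1\<close> (same first letter), \<open>?v2\<close>
        (braid) and back (same first letter).\<close>
      have "len (i # u) < len u"
        using len_eqv[OF ceq_cancel2[of M i u1]] reduced_Cons[of i u1] u(3) Cons by (simp add: reduced_def)
      moreover have "len (j # u) < len u"
      proof -
        have "j # u \<approx> u1'" using u(5) u' ceq_Cons_swap by blast
        then have "len (j # u) = len u1'" by (rule len_eqv)
        then show ?thesis using reduced_Cons[of j u1'] u(3,4,6) len' u' by (simp add: reduced_def)
      qed
      ultimately obtain v where v: "M i j > 0" "set v \<subseteq> {..<r}" "u \<approx> alt i j (M i j) @ v" "length v + M i j = length u"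
        using two_descents[OF u(3,1), of i j] u Cons u' False by auto
      let ?k = "M i j"
      let ?v1 = "alt i j ?k @ v" and ?v2 = "alt j i ?k @ v"
      have ij: "i < r" "j < r" using u Cons u' by auto
      have braid: "?v1 \<approx> ?v2" using v(1) False by (intro ceq_appR ceq_braid)
      have u_v2: "u \<approx> ?v2" using v(3) braid ceq_trans by blast
      have red: "reduced ?v1" "reduced ?v2"
        using len_eqv[OF v(3)] len_eqv[OF u_v2] v(4) u(3) by (simp_all add: reduced_def)
      have sub: "set ?v1 \<subseteq> {..<r}" "set ?v2 \<subseteq> {..<r}"
        using set_alt[of i j ?k] set_alt[of j i ?k] ij v(2) by auto
      obtain k' where k': "?k = Suc k'" using v(1) by (cases ?k) auto
      have 1: "lift_word e u \<in> lspan (insert (lift_word e ?v1) (low_lifts e n))"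
        using same_head[of i u1 "alt j i k' @ v"] u(1,3,6) sub(1) red(1) v(3) k' Cons by simp
      have v2_u': "?v2 \<approx> u'" using u_v2 u(5) ceq_sym ceq_trans by blast
      have 3: "lift_word e ?v2 \<in> lspan (insert (lift_word e u') (low_lifts e n))"
        using same_head[of j "alt i j k' @ v" u1'] u(2,4,6) sub(2) red(2) v2_u' v(4) k' u' by simp
      let ?e = "if even ?k then e else \<not> e"
      have vF: "lift_word ?e v \<in> carrier F" using v(2) by (intro lift_word_closed)
      have 2: "lift_word e (alt i j ?k) * lift_word ?e v \<in> lspan (insert (lift_word e ?v2) (low_lifts e n))"
      proof (rule lspan_mult_right[OF braid_exchange[OF refl v(1) False] vF])
        fix x assume "x \<in> insert (lift_word e (alt j i ?k))
          {lift_word e v | v. set v \<subseteq> {i, j} \<and> length v + 2 \<le> ?k \<and> even (length v) = even ?k}"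
        then consider "x = lift_word e (alt j i ?k)"
          | y where "x = lift_word e y" "set y \<subseteq> {i, j}" "length y + 2 \<le> ?k" "even (length y) = even ?k" by blast
        then show "x * lift_word ?e v \<in> lspan (insert (lift_word e ?v2) (low_lifts e n))"
        proof cases
          case 1
          then show ?thesis by (intro lspan_base) (simp add: lift_word_append)
        next
          case 2
          have "lift_word e (y @ v) \<in> lspan (low_lifts e n)"
            using 2 v ij u(6) by (intro short) auto
          then have "lift_word e (y @ v) \<in> lspan (insert (lift_word e ?v2) (low_lifts e n))"
            using low_sub[of e "lift_word e ?v2"] by blast
          moreover have "lift_word e (y @ v) = x * lift_word ?e v" using 2 by (simp add: lift_word_append)
          ultimately show ?thesis by metis
        qed
      qed
      have 2: "lift_word e ?v1 \<in> lspan (insert (lift_word e ?v2) (low_lifts e n))"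
        using 2 by (simp add: lift_word_append)
      show ?thesis using chain[OF 1 chain[OF 2 3]] .
    qed
  qed
  show "lift_word e w \<in> lspan (low_lifts e (n + 2))" if w: "set w \<subseteq> {..<r}" "length w = n" for e w
  proof (cases w)
    case Nil
    have "nf [] \<in> NF" by simp
    moreover have "nf [] = []"
      using nf(1,2)[of "[]"] len_eqv[of "nf []" "[]"] len_le[of "[]" "[]"] by (simp add: reduced_def)
    ultimately show ?thesis using Nil w by (intro lspan_base) (auto simp: low_lifts_def)
  next
    case (Cons i w1)
    have i: "i < r" and w1: "set w1 \<subseteq> {..<r}" "n = Suc (length w1)" using w Cons by auto
    have "half_turn e i * lift_word (\<not> e) w1 \<in> lspan (low_lifts e (n + 2))"
    proof (rule lspan_mult_left[OF span half_turn_closed[OF i]])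
      show "length w1 < n" "set w1 \<subseteq> {..<r}" "length w1 = length w1" using w1 by auto
      fix x assume "x \<in> low_lifts (\<not> e) (length w1 + 2)"
      then obtain v where v: "x = lift_word (\<not> e) v" "v \<in> NF" "length v \<le> length w1" "even (length v) = even (length w1)"
        by (auto simp: low_lifts_def)
      note vp = NF_props[OF v(2)]
      have iv: "set (i # v) \<subseteq> {..<r}" using vp i by auto
      have low2: "lspan (low_lifts e n) \<subseteq> lspan (low_lifts e (n + 2))" by (rule low_lifts_mono) auto
      have "lift_word e (i # v) \<in> lspan (low_lifts e (n + 2))"
      proof (cases "length v = length w1")
        case False
        then have "length v < length w1" using v(3) by simp
        then have "length (i # v) + 2 \<le> n" using v(4) w1(2) by (auto elim!: evenE oddE)
        then show ?thesis using short[OF iv, of e] low2 v(4) w1(2) by auto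
      next
        case True
        show ?thesis
        proof (cases "reduced (i # v)")
          case red: True
          note nfp = nf[OF iv]
          have "lift_word e (i # v) \<in> lspan (insert (lift_word e (nf (i # v))) (low_lifts e n))"
            using iv nfp red True w1(2) by (intro M) (auto intro: ceq_sym)
          moreover have "length (nf (i # v)) = n"
            using NF_reduced_eqv_length[OF nfp(2,1) red] True w1(2) by simp
          then have "lift_word e (nf (i # v)) \<in> lspan (low_lifts e (n + 2))"
            using iv by (intro lspan_base) (auto simp: low_lifts_def intro!: exI[of _ "nf (i # v)"] nf_in_NF simp del: set_simps)
          ultimately show ?thesis using low2 lspan_base by (blast intro: lspan_trans)
        next
          case notred: False
          \<comment> \<open>Here \<open>i\<close> is a descent of \<open>v\<close>, so
            \<open>v\<close> may be replaced by a reduced word starting with \<open>i\<close>, whose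
            half turn cancels the one in front.\<close>
          have "len (i # v) \<noteq> len v" by (rule len_Cons_ne)
          moreover have "len (i # v) \<le> Suc (len v)" using len_le[of "i # v" "i # v"] vp(2) by (simp add: reduced_def)
          moreover have "len (i # v) \<noteq> Suc (len v)" using notred vp(2) by (simp add: reduced_def)
          ultimately have "len (i # v) < len v" by simp
          then obtain a k b where ab: "v = a @ k # b" "i # v \<approx> a @ b" using exchange[OF vp(2)] by blast
          have v_eq: "v \<approx> i # (a @ b)" using ab(2) ceq_Cons_swap by blast
          have redv: "reduced (i # (a @ b))" using vp(2) ab(1)
            by (intro reducedI[OF ceq_sym[OF v_eq]]) (simp add: reduced_def)
          have subab: "set (i # (a @ b)) \<subseteq> {..<r}" "set (a @ b) \<subseteq> {..<r}" using iv ab(1) by auto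
          have "lift_word (\<not> e) v \<in> lspan (insert (lift_word (\<not> e) (i # (a @ b))) (low_lifts (\<not> e) (length v)))"
            using vp v_eq redv subab True w1(2) by (intro same) auto
          then have "half_turn e i * lift_word (\<not> e) v \<in> lspan (low_lifts e n)"
          proof (rule lspan_mult_left[OF _ half_turn_closed[OF i]])
            fix y assume "y \<in> insert (lift_word (\<not> e) (i # (a @ b))) (low_lifts (\<not> e) (length v))"
            then show "half_turn e i * y \<in> lspan (low_lifts e n)"
            proof
              assume y: "y = lift_word (\<not> e) (i # (a @ b))"
              have "n = length (a @ b) + 2" using ab(1) True w1(2) by simp
              then have "lift_word e (a @ b) \<in> lspan (low_lifts e n)"
                using subab(2) by (intro short) simp_all
              moreover have "half_turn e i * y \<doteq> lift_word e (a @ b)"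
                using half_turn_cancel[OF i lift_word_closed[OF subab(2)], of e e] by (simp add: y)
              ultimately show ?thesis by (rule lspan_hcong)
            next
              assume "y \<in> low_lifts (\<not> e) (length v)"
              then show ?thesis using True w1(2) i by (intro low_Cons) auto
            qed
          qed
          then show ?thesis using low2 by auto
        qed
      qed
      then show "half_turn e i * x \<in> lspan (low_lifts e (n + 2))" by (simp add: v(1))
    qed
    then show ?thesis using Cons by simp
  qed
qed

lemma lift_word_spanned:
  assumes "set w \<subseteq> {..<r}"
  shows "lift_word e w \<in> lspan (low_lifts e (length w + 2))"
proof -
  have "(\<forall>e w. set w \<subseteq> {..<r} \<and> length w = n \<longrightarrow> lift_word e w \<in> lspan (low_lifts e (n + 2))) \<and>
    (\<forall>e u u'. set u \<subseteq> {..<r} \<and> set u' \<subseteq> {..<r} \<and> reduced u \<and> reduced u' \<and> u \<approx> u' \<and> length u = n \<longrightarrow>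
      lift_word e u \<in> lspan (insert (lift_word e u') (low_lifts e n)))" for n
  proof (induction n rule: less_induct)
    case (less n)
    have span: "lift_word e w \<in> lspan (low_lifts e (k + 2))" if "k < n" "set w \<subseteq> {..<r}" "length w = k" for e k w
      using less that by blast
    have same: "lift_word e u \<in> lspan (insert (lift_word e u') (low_lifts e k))"
      if "k < n" "set u \<subseteq> {..<r}" "set u' \<subseteq> {..<r}" "reduced u" "reduced u'" "u \<approx> u'" "length u = k" for e k u u'
      using less that by blast
    show ?case using spanning_step[OF span same] by blast
  qed
  then show ?thesis using assms by blast
qed

text \<open>Each letter, c_j or its inverse, is congruent to a product of two half turns, so every
  monomial is congruent to the lift of a word of even length.\<close>

lemma even_words_span:
  assumes x: "x \<in> carrier F"
  shows "x \<in> lspan (lift_word False ` even_NF)"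
proof -
  let ?B = "lift_word False ` even_NF"
  have word: "\<exists>w. set w \<subseteq> {..<r} \<and> even (length w) \<and> Poly_Mapping.single (Free_Mon ls) 1 \<doteq> lift_word False w"
    if "set ls \<subseteq> Gen ` {1..r} \<union> Inv_Gen ` {1..r}" for ls
    using that
  proof (induction ls)
    case Nil
    have "Poly_Mapping.single (Free_Mon []) 1 = (1 :: free_elt)" by (simp add: zero_free_mon_def[symmetric])
    then show ?case by (intro exI[of _ "[]"]) (simp add: hcong_refl free_algebra_closed)
  next
    case (Cons l ls)
    then obtain w where w: "set w \<subseteq> {..<r}" "even (length w)" "Poly_Mapping.single (Free_Mon ls) 1 \<doteq> lift_word False w" by auto
    have split: "Poly_Mapping.single (Free_Mon (l # ls)) 1 =
      (Poly_Mapping.single (Free_Mon [l]) 1 * Poly_Mapping.single (Free_Mon ls) 1 :: free_elt)"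
      by (simp add: mult_single plus_free_mon_def)
    have "\<exists>i k. i < r \<and> k < r \<and> Poly_Mapping.single (Free_Mon [l]) 1 \<doteq> half_turn False i * half_turn True k"
    proof -
      consider j where "j \<in> {1..r}" "l = Gen j" | j where "j \<in> {1..r}" "l = Inv_Gen j" using Cons.prems by auto
      then show ?thesis
      proof cases
        case 1
        then show ?thesis using rotation(1)[OF 1(1)] r3
          by (intro exI[of _ "j - 1"] exI[of _ "j mod r"]) (auto simp: gen_def intro: hcong_sym)
      next
        case 2
        then show ?thesis using rotation(3)[OF 2(1)] r3
          by (intro exI[of _ "j mod r"] exI[of _ "j - 1"]) (auto simp: inv_gen_def intro: hcong_sym)
      qed
    qed
    then obtain i k where ik: "i < r" "k < r" "Poly_Mapping.single (Free_Mon [l]) 1 \<doteq> half_turn False i * half_turn True k" by blast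
    have "Poly_Mapping.single (Free_Mon (l # ls)) 1 \<doteq> lift_word False (i # k # w)"
      unfolding split using hcong_mult[OF ik(3) w(3)] by (simp add: mult.assoc)
    then show ?case using w ik by (intro exI[of _ "i # k # w"]) auto
  qed
  have "Poly_Mapping.single v (Poly_Mapping.lookup x v) \<in> lspan ?B" if "v \<in> Poly_Mapping.keys x" for v
  proof -
    obtain ls where ls: "v = Free_Mon ls" by (cases v)
    have "set ls \<subseteq> Gen ` {1..r} \<union> Inv_Gen ` {1..r}" and a: "Poly_Mapping.lookup x v \<in> carrier R"
      using x that ls by (force simp: free_algebra_def)+
    then obtain w where w: "set w \<subseteq> {..<r}" "even (length w)" "Poly_Mapping.single v 1 \<doteq> lift_word False w"
      using word ls by blast
    have "low_lifts False (length w + 2) \<subseteq> ?B" using w(2) by (auto simp: low_lifts_def even_NF_def)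
    then have "lift_word False w \<in> lspan ?B" using lift_word_spanned[OF w(1)] lspan_mono by blast
    then have "const (Poly_Mapping.lookup x v) * Poly_Mapping.single v 1 \<in> lspan ?B"
      using lspan_hcong[OF _ w(3)] a by (intro lspan_scale) auto
    then show ?thesis by (simp add: const_def mult_single)
  qed
  then have "(\<Sum>v\<in>Poly_Mapping.keys x. Poly_Mapping.single v (Poly_Mapping.lookup x v)) \<in> lspan ?B"
    by (rule lspan_sum)
  then show ?thesis by (simp only: poly_mapping_sum_single[of x, symmetric])
qed

end

section \<open>Freeness\<close>

definition hecke_class :: "nat \<Rightarrow> (nat \<Rightarrow> enat) \<Rightarrow> free_elt \<Rightarrow> free_elt set" where
  "hecke_class r m x = hecke_ideal r m +>\<^bsub>hecke_free r m\<^esub> x"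

lemma hecke_class_carrier:
  "x \<in> carrier (hecke_free r m) \<Longrightarrow> hecke_class r m x \<in> carrier (hecke_algebra r m)"
  by (auto simp: hecke_class_def hecke_algebra_simps FactRing_def A_RCOSETS_def')

lemma hecke_class_cases:
  assumes "X \<in> carrier (hecke_algebra r m)"
  obtains x where "x \<in> carrier (hecke_free r m)" "X = hecke_class r m x"
  using assms by (auto simp: hecke_class_def hecke_algebra_simps FactRing_def A_RCOSETS_def')

lemma hecke_class_add:
  assumes "x \<in> carrier (hecke_free r m)" "y \<in> carrier (hecke_free r m)"
  shows "hecke_class r m x \<oplus>\<^bsub>hecke_algebra r m\<^esub> hecke_class r m y = hecke_class r m (x + y)"
proof -
  interpret ideal "hecke_ideal r m" "hecke_free r m" by (rule ideal_hecke_ideal)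
  show ?thesis using a_rcos_sum[OF assms] by (simp add: hecke_class_def hecke_algebra_simps FactRing_def)
qed

lemma hecke_class_smult:
  assumes "a \<in> carrier (hecke_coeffs r m)" "x \<in> carrier (hecke_free r m)"
  shows "a \<odot>\<^bsub>hecke_algebra r m\<^esub> hecke_class r m x = hecke_class r m (const a * x)"
  unfolding hecke_class_def by (rule hecke_smult_coset[OF assms])

lemma hecke_class_eq_iff:
  assumes "x \<in> carrier (hecke_free r m)" "y \<in> carrier (hecke_free r m)"
  shows "hecke_class r m x = hecke_class r m y \<longleftrightarrow> x - y \<in> hecke_ideal r m"
proof -
  interpret ideal "hecke_ideal r m" "hecke_free r m" by (rule ideal_hecke_ideal)
  have "x \<ominus>\<^bsub>hecke_free r m\<^esub> y = x - y"
  proof -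
    have "\<ominus>\<^bsub>hecke_free r m\<^esub> y = - y"
      using assms free_algebra_closed(3) by (intro minus_equality) auto
    then show ?thesis by (simp add: a_minus_def)
  qed
  then show ?thesis
    using quotient_eq_iff_same_a_r_cos[OF ideal_axioms assms] by (simp add: hecke_class_def)
qed

lemma hecke_class_zero: "\<zero>\<^bsub>hecke_algebra r m\<^esub> = hecke_class r m 0"
proof -
  interpret ideal "hecke_ideal r m" "hecke_free r m" by (rule ideal_hecke_ideal)
  have "hecke_class r m \<zero>\<^bsub>hecke_free r m\<^esub> = hecke_ideal r m"
    unfolding hecke_class_def using additive_subgroup.zero_closed[OF is_additive_subgroup] a_subset
    by (intro a_rcos_zero[OF ideal_axioms])
  then show ?thesis by (simp add: hecke_algebra_simps FactRing_def)
qed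

lemma const_mult_closed:
  "a \<in> carrier (hecke_coeffs r m) \<Longrightarrow> x \<in> carrier (hecke_free r m) \<Longrightarrow> const a * x \<in> carrier (hecke_free r m)"
  by (intro free_algebra_mult_closed free_algebra_closed)

lemma free_algebra_sum_closed:
  "(\<And>i. i \<in> A \<Longrightarrow> f i \<in> carrier (free_algebra r V)) \<Longrightarrow> sum f A \<in> carrier (free_algebra r V)"
  by (induction A rule: infinite_finite_induct) (auto simp: free_algebra_closed)

lemma hecke_class_lincomb:
  assumes "finite A" "\<And>i. i \<in> A \<Longrightarrow> f i \<in> carrier (hecke_free r m)" "\<And>i. i \<in> A \<Longrightarrow> a i \<in> carrier (hecke_coeffs r m)"
  shows "(\<Oplus>\<^bsub>hecke_algebra r m\<^esub>i\<in>A. a i \<odot>\<^bsub>hecke_algebra r m\<^esub> hecke_class r m (f i)) =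
    hecke_class r m (\<Sum>i\<in>A. const (a i) * f i)"
  using assms
proof (induction A)
  case empty
  interpret ring "hecke_algebra r m" by (rule ring_hecke_algebra)
  show ?case by (simp add: hecke_class_zero)
next
  case (insert i A)
  interpret ring "hecke_algebra r m" by (rule ring_hecke_algebra)
  have cl: "a j \<odot>\<^bsub>hecke_algebra r m\<^esub> hecke_class r m (f j) \<in> carrier (hecke_algebra r m)" if "j \<in> insert i A" for j
    using insert.prems that by (simp add: hecke_class_smult hecke_class_carrier const_mult_closed)
  have "(\<Oplus>\<^bsub>hecke_algebra r m\<^esub>j\<in>insert i A. a j \<odot>\<^bsub>hecke_algebra r m\<^esub> hecke_class r m (f j)) =
    a i \<odot>\<^bsub>hecke_algebra r m\<^esub> hecke_class r m (f i) \<oplus>\<^bsub>hecke_algebra r m\<^esub> hecke_class r m (\<Sum>j\<in>A. const (a j) * f j)"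
    using insert cl by (subst finsum_insert) auto
  also have "\<dots> = hecke_class r m (const (a i) * f i + (\<Sum>j\<in>A. const (a j) * f j))"
    using insert.prems by (simp add: hecke_class_smult hecke_class_add const_mult_closed free_algebra_sum_closed)
  finally show ?case using insert.hyps by simp
qed

context polygon
begin

lemma hecke_free_module:
  assumes inf: "\<exists>g. set g \<subseteq> {..<r} \<and> even (length g) \<and> (\<forall>n. concat (replicate n g) \<approx> [] \<longrightarrow> n = 0)"
  shows "free_module R (hecke_algebra r m)"
proof -
  let ?H = "hecke_algebra r m" and ?cl = "hecke_class r m"
  let ?B = "(\<lambda>w. ?cl (lift_word False w)) ` even_NF"
  interpret H: Module.module R ?H by (rule module_hecke_algebra)
  have lw: "lift_word False w \<in> carrier F" if "w \<in> even_NF" for w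
    using that NF_props(1) by (auto simp: even_NF_def intro: lift_word_closed)
  have B: "?B \<subseteq> carrier ?H" using lw hecke_class_carrier by auto
  have sub: "submodule R (H.span ?B) ?H" by (rule H.span_is_submodule[OF B])
  have in_span: "x \<in> carrier F \<and> ?cl x \<in> H.span ?B" if "x \<in> lspan (lift_word False ` even_NF)" for x
    using that
  proof induction
    case lspan_zero
    show ?case using submodule.zero_closed[OF sub] by (simp add: free_algebra_closed hecke_class_zero)
  next
    case (lspan_step x a u)
    then have u: "u \<in> carrier F" "?cl u \<in> H.span ?B" using lw H.in_own_span[OF B] by auto
    then have "a \<odot>\<^bsub>?H\<^esub> ?cl u \<in> H.span ?B" using lspan_step by (intro submodule.smult_closed[OF sub])
    then have "?cl x \<oplus>\<^bsub>?H\<^esub> (a \<odot>\<^bsub>?H\<^esub> ?cl u) \<in> H.span ?B"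
      using lspan_step by (intro submodule.m_closed[OF sub]) auto
    then show ?case using lspan_step u
      by (simp add: hecke_class_smult hecke_class_add const_mult_closed free_algebra_closed)
  next
    case (lspan_cong x y)
    have "y = (y - x) + x" by simp
    then have y: "y \<in> carrier F" using lspan_cong I_closed(6) free_algebra_closed(4) by metis
    then have "?cl y = ?cl x" using lspan_cong hecke_class_eq_iff by blast
    then show ?case using lspan_cong y by simp
  qed
  have "H.span ?B = carrier ?H"
  proof
    show "H.span ?B \<subseteq> carrier ?H" by (rule H.span_is_subset2[OF B])
    show "carrier ?H \<subseteq> H.span ?B"
    proof
      fix X assume "X \<in> carrier ?H"
      then obtain x where "x \<in> carrier F" "X = ?cl x" by (rule hecke_class_cases)
      then show "X \<in> H.span ?B" using in_span even_words_span by blast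
    qed
  qed
  moreover have "\<not> H.lin_dep ?B"
  proof
    assume "H.lin_dep ?B"
    then obtain A a v where A: "finite A" "A \<subseteq> ?B" "a \<in> A \<rightarrow> carrier R" "H.lincomb a A = \<zero>\<^bsub>?H\<^esub>" "v \<in> A" "a v \<noteq> 0"
      unfolding H.lin_dep_def by auto
    \<comment> \<open>One word for each class carries the dependence back from the basis to normal
      forms.\<close>
    define sel where "sel = inv_into even_NF (\<lambda>w. ?cl (lift_word False w))"
    have sel: "sel X \<in> even_NF" "?cl (lift_word False (sel X)) = X" if "X \<in> A" for X
    proof -
      have X: "X \<in> ?B" using that A(2) by blast
      show "sel X \<in> even_NF" "?cl (lift_word False (sel X)) = X"
        unfolding sel_def by (rule inv_into_into[OF X]) (rule f_inv_into_f[OF X])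
    qed
    have inj: "inj_on sel A" by (rule inj_on_inverseI[of A "\<lambda>w. ?cl (lift_word False w)"]) (rule sel)
    let ?x = "\<Sum>X\<in>A. const (a X) * lift_word False (sel X)"
    have aR: "a X \<in> carrier R" if "X \<in> A" for X using A(3) that by auto
    have "H.lincomb a A = (\<Oplus>\<^bsub>?H\<^esub>X\<in>A. a X \<odot>\<^bsub>?H\<^esub> ?cl (lift_word False (sel X)))"
      unfolding H.lincomb_def using A(2) B aR sel hecke_class_carrier lw
      by (intro H.finsum_cong') auto
    also have "\<dots> = ?cl ?x" using A(1) aR sel lw by (intro hecke_class_lincomb) auto
    finally have "?cl ?x = ?cl 0" using A(4) by (simp add: hecke_class_zero)
    moreover have "?x \<in> carrier F" using aR sel lw by (intro free_algebra_sum_closed const_mult_closed) auto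
    ultimately have "?x - 0 \<in> I" using hecke_class_eq_iff free_algebra_closed(1) by blast
    moreover have "?x = (\<Sum>w\<in>sel ` A. const (a (?cl (lift_word False w))) * lift_word False w)"
      using sel by (subst sum.reindex[OF inj]) simp
    ultimately have "(\<Sum>w\<in>sel ` A. const (a (?cl (lift_word False w))) * lift_word False w) \<in> I" by simp
    from lift_words_independent[OF inf _ _ this, of "sel v"] have "a (?cl (lift_word False (sel v))) = 0"
      using A(1,5) sel by auto
    then show False using sel A(5,6) by simp
  qed
  ultimately show ?thesis
    unfolding free_module_def using B module_hecke_algebra by blast
qed

end

section \<open>Fibres of a free Hecke algebra\<close>

text \<open>The two-sided ideal of the fibre at the point \<open>t\<^sub>j\<^sub>k = exp (\<theta> (j, k))\<close>.\<close>

inductive_set fibre_ideal :: "nat \<Rightarrow> (nat \<Rightarrow> enat) \<Rightarrow> (nat \<times> nat \<Rightarrow> complex) \<Rightarrow> free_elt set"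
  for r m \<theta> where
  fibre_zero: "0 \<in> fibre_ideal r m \<theta>"
| fibre_step: "x \<in> fibre_ideal r m \<theta> \<Longrightarrow> a \<in> carrier (hecke_coeffs r m) \<Longrightarrow> laurent_eval \<theta> a = 0 \<Longrightarrow>
    y \<in> carrier (hecke_free r m) \<Longrightarrow> x + const a * y \<in> fibre_ideal r m \<theta>"
| fibre_cong: "x \<in> fibre_ideal r m \<theta> \<Longrightarrow> y - x \<in> hecke_ideal r m \<Longrightarrow> y \<in> fibre_ideal r m \<theta>"

lemma fibre_ideal_quotient: "hecke_quotient r m (fibre_ideal r m \<theta>)"
proof
  let ?J = "fibre_ideal r m \<theta>" and ?F = "hecke_free r m"
  show "0 \<in> ?J" by (rule fibre_zero)
  show "x + y \<in> ?J" if "x \<in> ?J" "y \<in> ?J" for x y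
    using that(2)
  proof induction
    case (fibre_step y a z)
    then show ?case using fibre_ideal.fibre_step[of "x + y" r m \<theta> a z] by (simp add: add.assoc)
  next
    case (fibre_cong y z)
    then show ?case using fibre_ideal.fibre_cong[of "x + y" r m \<theta> "x + z"] by simp
  qed (simp add: that)
  show "- x \<in> ?J" if "x \<in> ?J" for x
    using that
  proof induction
    case (fibre_step x a y)
    then show ?case using fibre_ideal.fibre_step[of "- x" r m \<theta> a "- y"] by (simp add: free_algebra_closed)
  next
    case (fibre_cong x y)
    have "- y - - x \<in> hecke_ideal r m" using hecke_ideal_closed(3)[OF fibre_cong(2)] by simp
    then show ?case using fibre_cong fibre_ideal.fibre_cong by blast
  qed (simp add: fibre_zero)
  show "z * x \<in> ?J" if "x \<in> ?J" and z: "z \<in> carrier ?F" for x z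
    using that(1)
  proof induction
    case (fibre_step x a y)
    have "z * (const a * y) = const a * (z * y)" by (simp only: mult.assoc[symmetric] const_central[of a z])
    then show ?case using fibre_step fibre_ideal.fibre_step[of "z * x" r m \<theta> a "z * y"] z
      by (simp add: distrib_left free_algebra_mult_closed)
  next
    case (fibre_cong x y)
    have "z * y - z * x \<in> hecke_ideal r m"
      using hecke_ideal_closed(4)[OF fibre_cong(2) z] by (simp add: right_diff_distrib)
    then show ?case using fibre_cong fibre_ideal.fibre_cong by blast
  qed (simp add: fibre_zero)
  show "x * z \<in> ?J" if "x \<in> ?J" and z: "z \<in> carrier ?F" for x z
    using that(1)
  proof induction
    case (fibre_step x a y)
    then show ?case using fibre_ideal.fibre_step[of "x * z" r m \<theta> a "y * z"] z
      by (simp add: distrib_right mult.assoc free_algebra_mult_closed)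
  next
    case (fibre_cong x y)
    have "y * z - x * z \<in> hecke_ideal r m"
      using hecke_ideal_closed(5)[OF fibre_cong(2) z] by (simp add: left_diff_distrib)
    then show ?case using fibre_cong fibre_ideal.fibre_cong by blast
  qed (simp add: fibre_zero)
  show "hecke_ideal r m \<subseteq> ?J"
    using fibre_cong[OF fibre_zero] by auto
qed

text \<open>The trivial character: all variables and all generators are sent to 1.\<close>

lemma one_notin_hecke_ideal:
  assumes m: "\<And>j. j \<in> {1..r} \<Longrightarrow> m j \<ge> 2"
  shows "1 \<notin> hecke_ideal r m"
proof
  assume 1: "1 \<in> hecke_ideal r m"
  interpret letter_values "laurent_eval (\<lambda>_. 0)" "\<lambda>_. 1 :: complex"
    by standard (simp_all add: laurent_eval.eval_map_add laurent_eval.eval_map_mult)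
  have "eval_map 1 = 0" using 1
  proof (rule hecke_ideal_induct)
    fix x assume "x \<in> hecke_relators r m"
    then consider j where "j \<in> {1..r}" "x = gen j * inv_gen j - 1" | j where "j \<in> {1..r}" "x = inv_gen j * gen j - 1"
      | j where "j \<in> {1..r}" "m j \<noteq> \<infinity>" "x = (\<Prod>k\<leftarrow>[1..<Suc (the_enat (m j))]. gen j - const (tvar j k))"
      | "x = (\<Prod>j\<leftarrow>[1..<Suc r]. gen j) - 1"
      unfolding hecke_relators_def by blast
    then show "eval_map x = 0"
    proof cases
      case 3
      have "the_enat (m j) > 0" using m[OF 3(1)] 3(2) by (cases "m j") (auto simp: numeral_eq_enat)
      then have "0 \<in> (\<lambda>_. 0 :: complex) ` set [1..<Suc (the_enat (m j))]" by (intro image_eqI[of _ _ 1]) auto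
      then show ?thesis unfolding 3(3)
        by (simp add: eval_map_prod_list eval_map_diff prod_list_zero_iff o_def del: upt_Suc)
    next
      case 4
      have "prod_list (map (\<lambda>_. 1 :: complex) js) = 1" for js :: "nat list" by (induction js) auto
      then show ?thesis unfolding 4 by (simp add: eval_map_prod_list eval_map_diff o_def del: upt_Suc)
    qed (simp_all add: eval_map_diff eval_map_mult)
  qed (simp_all add: eval_map_add eval_map_uminus eval_map_mult)
  then show False by simp
qed

text \<open>Elements of the fibre ideal have coordinates vanishing at the point. If 1 belongs to it,
  so does every basis vector, which has a coordinate equal to 1. Hence the basis is empty and the
  Hecke algebra is zero, contradicting the trivial character.\<close>

lemma free_imp_fibre_nonzero:
  assumes free: "free_module (hecke_coeffs r m) (hecke_algebra r m)"
    and m: "\<And>j. j \<in> {1..r} \<Longrightarrow> m j \<ge> 2"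
  shows "1 \<notin> fibre_ideal r m \<theta>"
proof
  assume one: "1 \<in> fibre_ideal r m \<theta>"
  let ?H = "hecke_algebra r m" and ?cl = "hecke_class r m" and ?F = "hecke_free r m"
    and ?R = "hecke_coeffs r m" and ?I = "hecke_ideal r m"
  note I = hecke_ideal_closed[where r = r and m = m]
  interpret H: Module.module ?R ?H by (rule module_hecke_algebra)
  obtain B where B: "B \<subseteq> carrier ?H" "H.span B = carrier ?H" "\<not> H.lin_dep B"
    using free unfolding free_module_def by blast
  define lift where "lift b = (SOME x. x \<in> carrier ?F \<and> b = ?cl x)" for b
  have lift: "lift b \<in> carrier ?F" "?cl (lift b) = b" if "b \<in> B" for b
  proof -
    have "\<exists>x. x \<in> carrier ?F \<and> b = ?cl x" using that B(1) hecke_class_cases by blast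
    from someI_ex[OF this] show "lift b \<in> carrier ?F" "?cl (lift b) = b" unfolding lift_def by auto
  qed
  \<comment> \<open>\<open>f\<close> lists the coordinates of \<open>x\<close>, extended by 0: they
    exist by spanning and are unique by independence.\<close>
  define rep where "rep f x \<longleftrightarrow> (\<exists>A. finite A \<and> A \<subseteq> B \<and> (\<forall>v. f v \<in> carrier ?R) \<and> (\<forall>v. v \<notin> A \<longrightarrow> f v = 0) \<and>
    x - (\<Sum>v\<in>A. const (f v) * lift v) \<in> ?I)" for f x
  have repI: "rep f x" if "finite A" "A \<subseteq> B" "\<And>v. f v \<in> carrier ?R" "\<And>v. v \<notin> A \<Longrightarrow> f v = 0"
    "x - (\<Sum>v\<in>A. const (f v) * lift v) \<in> ?I" for f x A
    unfolding rep_def using that by blast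
  have lincomb: "H.lincomb f A = ?cl (\<Sum>v\<in>A. const (f v) * lift v)"
    if "finite A" "A \<subseteq> B" "\<And>v. v \<in> A \<Longrightarrow> f v \<in> carrier ?R" for f A
  proof -
    have "H.lincomb f A = (\<Oplus>\<^bsub>?H\<^esub>v\<in>A. f v \<odot>\<^bsub>?H\<^esub> ?cl (lift v))"
      unfolding H.lincomb_def using that B(1) lift by (intro H.finsum_cong') (auto simp: subset_iff)
    also have "\<dots> = ?cl (\<Sum>v\<in>A. const (f v) * lift v)"
      using that lift by (intro hecke_class_lincomb) auto
    finally show ?thesis .
  qed
  have sumF: "(\<Sum>v\<in>A. const (f v) * lift v) \<in> carrier ?F"
    if "A \<subseteq> B" "\<And>v. v \<in> A \<Longrightarrow> f v \<in> carrier ?R" for f A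
    using that lift by (intro free_algebra_sum_closed const_mult_closed) auto
  have rep_ex: "\<exists>f. rep f x" if x: "x \<in> carrier ?F" for x
  proof -
    have "?cl x \<in> H.span B" using hecke_class_carrier[OF x] B(2) by simp
    then obtain a A where A: "finite A" "A \<subseteq> B" "a \<in> A \<rightarrow> carrier ?R" "H.lincomb a A = ?cl x"
      unfolding H.span_def by blast
    define f where "f v = (if v \<in> A then a v else 0)" for v
    have f: "f v \<in> carrier ?R" for v using A(3) by (auto simp: f_def laurent_closed)
    have aR: "a v \<in> carrier ?R" if "v \<in> A" for v using A(3) that by auto
    have "?cl x = ?cl (\<Sum>v\<in>A. const (a v) * lift v)" using lincomb[OF A(1,2) aR] A(4) by simp
    moreover have "(\<Sum>v\<in>A. const (a v) * lift v) \<in> carrier ?F" using aR by (intro sumF[OF A(2)])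
    ultimately have "x - (\<Sum>v\<in>A. const (a v) * lift v) \<in> ?I"
      using hecke_class_eq_iff[OF x] by blast
    moreover have "(\<Sum>v\<in>A. const (a v) * lift v) = (\<Sum>v\<in>A. const (f v) * lift v)"
      by (intro sum.cong) (auto simp: f_def)
    ultimately have "x - (\<Sum>v\<in>A. const (f v) * lift v) \<in> ?I" by simp
    from repI[OF A(1,2) f _ this] show ?thesis by (auto simp: f_def)
  qed
  have superset: "(\<Sum>v\<in>A. const (f v) * lift v) = (\<Sum>v\<in>A'. const (f v) * lift v)"
    if "finite A'" "A \<subseteq> A'" "\<forall>v. v \<notin> A \<longrightarrow> f v = 0" for f A A'
    using that by (intro sum.mono_neutral_left) (auto simp: const_def)
  have rep_unique: "f v = g v" if fx: "rep f x" and gx: "rep g x" for f g x v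
  proof -
    obtain A where A: "finite A" "A \<subseteq> B" "\<forall>v. f v \<in> carrier ?R" "\<forall>v. v \<notin> A \<longrightarrow> f v = 0"
      "x - (\<Sum>v\<in>A. const (f v) * lift v) \<in> ?I" using fx unfolding rep_def by blast
    obtain A' where A': "finite A'" "A' \<subseteq> B" "\<forall>v. g v \<in> carrier ?R" "\<forall>v. v \<notin> A' \<longrightarrow> g v = 0"
      "x - (\<Sum>v\<in>A'. const (g v) * lift v) \<in> ?I" using gx unfolding rep_def by blast
    let ?U = "A \<union> A'"
    define h where "h v = f v + - g v" for v
    have h: "h v \<in> carrier ?R" for v unfolding h_def using A(3) A'(3) by (intro laurent_closed) auto
    have U: "finite ?U" "?U \<subseteq> B" using A(1,2) A'(1,2) by auto
    have "(\<Sum>v\<in>?U. const (h v) * lift v) =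
       (x - (\<Sum>v\<in>A'. const (g v) * lift v)) - (x - (\<Sum>v\<in>A. const (f v) * lift v))"
      using superset[OF U(1) _ A(4)] superset[OF U(1) _ A'(4)]
      unfolding h_def const_hom const_uminus distrib_right sum.distrib by (simp add: sum_negf)
    also have "\<dots> \<in> ?I" using hecke_ideal_closed(2)[OF A'(5) hecke_ideal_closed(3)[OF A(5)]] by simp
    finally have "?cl (\<Sum>v\<in>?U. const (h v) * lift v) = ?cl 0"
      using hecke_class_eq_iff[OF sumF[OF U(2) h] free_algebra_closed(1)] by simp
    then have "H.lincomb h ?U = \<zero>\<^bsub>?H\<^esub>" using lincomb[OF U h] by (simp add: hecke_class_zero)
    then have "H.lin_dep B" if "v \<in> ?U" "h v \<noteq> 0" for v
      unfolding H.lin_dep_def using U h that by (intro exI[of _ ?U] exI[of _ h] exI[of _ v]) simp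
    then have "h v = 0" if "v \<in> ?U" for v using B(3) that by blast
    then show "f v = g v" using A(4) A'(4) by (cases "v \<in> ?U") (auto simp: h_def)
  qed
  have vanish: "\<exists>f. rep f x \<and> (\<forall>v. laurent_eval \<theta> (f v) = 0)" if "x \<in> fibre_ideal r m \<theta>" for x
    using that
  proof induction
    case fibre_zero
    have "rep (\<lambda>_. 0) 0" by (rule repI[of "{}"]) (simp_all add: I(1) laurent_closed)
    then show ?case by (intro exI[of _ "\<lambda>_. 0"]) simp
  next
    case (fibre_step x a y)
    then obtain f where f: "rep f x" "\<And>v. laurent_eval \<theta> (f v) = 0" by blast
    obtain g where g: "rep g y" using rep_ex fibre_step by blast
    obtain A where A: "finite A" "A \<subseteq> B" "\<forall>v. f v \<in> carrier ?R" "\<forall>v. v \<notin> A \<longrightarrow> f v = 0"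
      "x - (\<Sum>v\<in>A. const (f v) * lift v) \<in> ?I" using f(1) unfolding rep_def by blast
    obtain A' where A': "finite A'" "A' \<subseteq> B" "\<forall>v. g v \<in> carrier ?R" "\<forall>v. v \<notin> A' \<longrightarrow> g v = 0"
      "y - (\<Sum>v\<in>A'. const (g v) * lift v) \<in> ?I" using g unfolding rep_def by blast
    let ?U = "A \<union> A'"
    define h where "h v = f v + a * g v" for v
    have eq: "(x + const a * y) - (\<Sum>v\<in>?U. const (h v) * lift v) =
      (x - (\<Sum>v\<in>A. const (f v) * lift v)) + const a * (y - (\<Sum>v\<in>A'. const (g v) * lift v))"
      using superset[of ?U A f] superset[of ?U A' g] A(1,4) A'(1,4)
      by (simp add: h_def const_hom distrib_right sum.distrib right_diff_distrib sum_distrib_left mult.assoc)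
    have "const a * (y - (\<Sum>v\<in>A'. const (g v) * lift v)) \<in> ?I"
      using fibre_step by (intro hecke_ideal_closed(4)[OF A'(5)] free_algebra_closed(6))
    then have "(x + const a * y) - (\<Sum>v\<in>?U. const (h v) * lift v) \<in> ?I"
      unfolding eq by (rule hecke_ideal_closed(2)[OF A(5)])
    moreover have "h v \<in> carrier ?R" for v
      unfolding h_def using A(3) A'(3) fibre_step by (intro laurent_closed(4) laurent_mult_closed) blast+
    moreover have "h v = 0" if "v \<notin> ?U" for v using that A(4) A'(4) by (simp add: h_def)
    ultimately have "rep h (x + const a * y)" using A(1,2) A'(1,2) by (intro repI[of ?U]) blast+
    moreover have "laurent_eval \<theta> (h v) = 0" for v
      using f(2) fibre_step by (simp add: h_def laurent_eval.eval_map_add laurent_eval.eval_map_mult)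
    ultimately show ?case by blast
  next
    case (fibre_cong x y)
    then obtain f where f: "rep f x" "\<And>v. laurent_eval \<theta> (f v) = 0" by blast
    then obtain A where A: "finite A" "A \<subseteq> B" "\<forall>v. f v \<in> carrier ?R" "\<forall>v. v \<notin> A \<longrightarrow> f v = 0"
      "x - (\<Sum>v\<in>A. const (f v) * lift v) \<in> ?I" unfolding rep_def by blast
    have "y - (\<Sum>v\<in>A. const (f v) * lift v) \<in> ?I"
      using hecke_ideal_closed(2)[OF fibre_cong(2) A(5)] by simp
    then have "rep f y" unfolding rep_def using A by blast
    then show ?case using f(2) by blast
  qed
  have "B = {}"
  proof (rule ccontr)
    assume "B \<noteq> {}"
    then obtain b where b: "b \<in> B" by blast
    interpret hecke_quotient r m "fibre_ideal r m \<theta>" by (rule fibre_ideal_quotient)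
    have "lift b \<in> fibre_ideal r m \<theta>" using K_closed(5)[OF one lift(1)[OF b]] by simp
    then obtain f where f: "rep f (lift b)" "laurent_eval \<theta> (f b) = 0" using vanish by blast
    have "rep (\<lambda>v. if v = b then 1 else 0) (lift b)"
      using b by (intro repI[of "{b}"]) (simp_all add: I(1) const_hom(1) laurent_closed)
    from rep_unique[OF f(1) this, of b] f(2) show False by simp
  qed
  moreover have "?cl 1 \<in> H.span B" using hecke_class_carrier[OF free_algebra_closed(2)] B(2) by simp
  ultimately have "?cl 1 = \<zero>\<^bsub>?H\<^esub>" unfolding H.span_def H.lincomb_def by auto
  then have "1 - 0 \<in> ?I"
    using hecke_class_eq_iff[OF free_algebra_closed(2,1)] unfolding hecke_class_zero by blast
  then show False using one_notin_hecke_ideal[of r m] m by simp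
qed

definition scal :: "complex \<Rightarrow> free_elt" where
  "scal z = const (Poly_Mapping.single 0 z)"

lemma scal_hom: "scal 1 = 1" "scal (a + b) = scal a + scal b" "scal (a * b) = scal a * scal b" "scal 0 = 0"
  "scal (- a) = - scal a" "scal (a - b) = scal a - scal b"
proof -
  show add: "scal (a + b) = scal a + scal b" for a b by (simp add: scal_def const_hom single_add)
  show "scal 1 = 1" by (simp add: scal_def const_hom)
  show "scal (a * b) = scal a * scal b" by (simp add: scal_def const_hom[symmetric] mult_single)
  show "scal 0 = 0" by (simp add: scal_def const_zero)
  show neg: "scal (- a) = - scal a" for a by (simp add: scal_def const_uminus single_uminus)
  show "scal (a - b) = scal a - scal b" using add[of a "- b"] neg[of b] by simp
qed

lemma scal_coeff: "Poly_Mapping.single 0 z \<in> carrier (laurent_ring V)"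
  by (auto simp: laurent_ring_def)

lemma scal_closed: "scal z \<in> carrier (free_algebra r V)"
  unfolding scal_def by (intro free_algebra_closed scal_coeff)

lemma scal_central: "scal z * x = x * scal z"
  unfolding scal_def by (rule const_central)

section \<open>Words in two generators of orders two and three\<close>

text \<open>The letters \<open>0\<close>, \<open>1\<close>, \<open>2\<close> stand for \<open>x\<close>, \<open>y\<close>, \<open>y\<^sup>2\<close> with \<open>x\<^sup>2 = y\<^sup>3 = 1\<close>.\<close>

fun push_letter :: "nat \<Rightarrow> nat list \<Rightarrow> nat list" where
  "push_letter c [] = [c]"
| "push_letter c (d # w) =
    (if c = 0 \<and> d = 0 then w
     else if c \<noteq> 0 \<and> d \<noteq> 0 then if (c + d) mod 3 = 0 then w else ((c + d) mod 3) # w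
     else c # d # w)"

definition reduce_word :: "nat list \<Rightarrow> nat list" where
  "reduce_word w = foldr push_letter w []"

text \<open>If \<open>(x y)\<^sup>n\<close> is a scalar \<open>\<kappa>\<close>, inserting this relator multiplies a word by \<open>\<kappa>\<close>. Peeling off the faces
  of a tetrahedron, cube or dodecahedron one at a time leads from the empty word back to itself, whence
  \<open>\<kappa>\<close> to the power of the number of faces is \<open>1\<close>.\<close>

fun insert_relators :: "nat \<Rightarrow> (nat \<times> bool) list \<Rightarrow> nat list \<Rightarrow> nat list" where
  "insert_relators n [] w = w"
| "insert_relators n ((i, b) # ps) w =
    insert_relators n ps (reduce_word (take i w @ concat (replicate n (if b then [1, 0] else [0, 1])) @ drop i w))"

lemma polyhedron_peeling:
  assumes "n \<in> {3, 4, 5}"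
  shows "\<exists>ps. ps \<noteq> [] \<and> insert_relators n ps [] = []"
proof -
  have witness: "\<exists>ps. ps \<noteq> [] \<and> insert_relators k ps [] = []" if "insert_relators k (p # ps) [] = []" for k p ps
    using that by blast
  \<comment> \<open>One entry per n-gonal face: its position on the current boundary word, and
    whether the relator is inserted as powers of y x or of x y. There are 4, 6 and 12 faces.\<close>
  have tetrahedron: "insert_relators 3 [(0, False), (2, True), (4, True), (0, True)] [] = []"
    by code_simp
  have cube: "insert_relators 4 [(0, True), (3, True), (7, True), (5, True), (1, True), (0, False)] [] = []"
    by code_simp
  have dodecahedron: "insert_relators 5 [(0, True), (1, True), (5, True), (11, True), (9, True), (13, True),
      (15, True), (11, True), (13, True), (7, True), (3, True), (0, False)] [] = []"
    by code_simp
  from assms consider "n = 3" | "n = 4" | "n = 5" by auto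
  then show ?thesis
    by cases (simp_all only: witness[OF tetrahedron] witness[OF cube] witness[OF dodecahedron])
qed

definition pair_word :: "free_elt \<Rightarrow> free_elt \<Rightarrow> nat list \<Rightarrow> free_elt" where
  "pair_word x y w = (\<Prod>c\<leftarrow>w. if c = 0 then x else y ^ c)"

context hecke_quotient
begin

lemma power_closed: "x \<in> carrier (hecke_free r m) \<Longrightarrow> x ^ n \<in> carrier (hecke_free r m)"
  by (induction n) (auto simp: free_algebra_closed free_algebra_mult_closed)

lemma scal_hcong_one:
  assumes "scal z \<doteq> 1" "z \<noteq> 1"
  shows "1 \<in> K"
proof -
  have "scal (z - 1) \<in> K" using assms(1) by (simp add: hcong_def scal_hom)
  then have "scal (inverse (z - 1)) * scal (z - 1) \<in> K" by (intro K_closed(4) scal_closed)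
  moreover have "scal (inverse (z - 1)) * scal (z - 1) = 1"
    using assms(2) by (simp add: scal_hom(3)[symmetric] scal_hom(1))
  ultimately show ?thesis by simp
qed

context
  fixes x y :: free_elt
  assumes xy: "x \<in> carrier (hecke_free r m)" "y \<in> carrier (hecke_free r m)" "x * x \<doteq> 1" "y ^ 3 \<doteq> 1"
begin

lemma pair_word_closed: "pair_word x y w \<in> carrier (hecke_free r m)"
  using xy by (induction w) (auto simp: pair_word_def free_algebra_closed free_algebra_mult_closed power_closed)

lemma pair_word_push: "c \<le> 2 \<Longrightarrow> set w \<subseteq> {..2} \<Longrightarrow>
  pair_word x y (push_letter c w) \<doteq> pair_word x y (c # w) \<and> set (push_letter c w) \<subseteq> {..2}"
proof (induction c w rule: push_letter.induct)
  case (1 c)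
  then show ?case using pair_word_closed by (simp add: hcong_refl)
next
  case (2 c d w)
  let ?v = "pair_word x y"
  show ?case
  proof (cases "c = 0 \<and> d = 0")
    case True
    have "?v w \<doteq> (x * x) * ?v w"
      using hcong_mult_right[OF pair_word_closed hcong_sym[OF xy(3)], of w] by simp
    then show ?thesis using True 2 by (simp add: pair_word_def mult.assoc)
  next
    case nz: False
    show ?thesis
    proof (cases "c \<noteq> 0 \<and> d \<noteq> 0")
      case True
      have v: "?v (c # d # w) = y ^ (c + d) * ?v w" using True by (simp add: pair_word_def power_add mult.assoc)
      have four: "y ^ 3 * y * ?v w \<doteq> 1 * y * ?v w"
        using xy pair_word_closed by (intro hcong_mult hcong_refl)
      have three: "y ^ 3 * ?v w \<doteq> 1 * ?v w" using xy pair_word_closed by (intro hcong_mult hcong_refl)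
      have "(c, d) \<in> {1, 2} \<times> {1, 2}" using True 2 by auto
      then consider "c + d = 2" | "c + d = 3" | "c + d = 4" by auto
      then show ?thesis
      proof cases
        case 1
        then have "(c + d) mod 3 = 2" by simp
        then show ?thesis using True 2 v 1 pair_word_closed[of "2 # w"] by (simp add: hcong_refl pair_word_def)
      next
        case two: 2
        then show ?thesis using True 2 v three by (simp add: hcong_sym)
      next
        case 3
        then have "y ^ (c + d) = y ^ 3 * y" by (simp add: eval_nat_numeral mult.assoc)
        moreover have "(c + d) mod 3 = 1" using 3 by simp
        ultimately show ?thesis using True 2 v four by (simp add: pair_word_def hcong_sym)
      qed
    next
      case False
      then show ?thesis using nz 2 pair_word_closed by (auto simp: hcong_refl)
    qed
  qed
qed

lemma pair_word_reduce:
  "set w \<subseteq> {..2} \<Longrightarrow> pair_word x y (reduce_word w) \<doteq> pair_word x y w \<and> set (reduce_word w) \<subseteq> {..2}"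
proof (induction w)
  case Nil
  then show ?case using pair_word_closed[of "[]"] by (simp add: reduce_word_def hcong_refl)
next
  case (Cons c w)
  then have IH: "pair_word x y (reduce_word w) \<doteq> pair_word x y w" "set (reduce_word w) \<subseteq> {..2}" by auto
  have p: "pair_word x y (push_letter c (reduce_word w)) \<doteq> pair_word x y (c # reduce_word w)"
    "set (push_letter c (reduce_word w)) \<subseteq> {..2}"
    using pair_word_push[of c "reduce_word w"] IH(2) Cons.prems by auto
  have "pair_word x y (c # reduce_word w) \<doteq> pair_word x y (c # w)"
    using hcong_mult_left[OF pair_word_closed[of "[c]"] IH(1)] by (simp add: pair_word_def)
  then show ?case using hcong_trans[OF p(1)] p(2) by (simp add: reduce_word_def)
qed

lemma pair_word_insert:
  assumes rel: "(x * y) ^ n \<doteq> scal \<kappa>" "(y * x) ^ n \<doteq> scal \<kappa>"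
  shows "set w \<subseteq> {..2} \<Longrightarrow> pair_word x y w \<doteq> scal c \<Longrightarrow>
    pair_word x y (insert_relators n ps w) \<doteq> scal (c * \<kappa> ^ length ps)"
proof (induction ps arbitrary: w c)
  case (Cons p ps)
  obtain i b where p: "p = (i, b)" by (cases p)
  let ?r = "concat (replicate n (if b then [1, 0] else [0, 1 :: nat]))"
  have app: "pair_word x y (u @ v) = pair_word x y u * pair_word x y v" for u v by (simp add: pair_word_def)
  have "pair_word x y ?r = (if b then y * x else x * y) ^ n"
    by (induction n) (auto simp: pair_word_def mult.assoc)
  then have r: "pair_word x y ?r \<doteq> scal \<kappa>" using rel by simp
  have sub: "set (take i w @ ?r @ drop i w) \<subseteq> {..2}"
    using Cons.prems(1) set_take_subset[of i w] set_drop_subset[of i w] by auto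
  have "pair_word x y (reduce_word (take i w @ ?r @ drop i w)) \<doteq> pair_word x y (take i w @ ?r @ drop i w)"
    using pair_word_reduce[OF sub] by blast
  also have "\<dots> = pair_word x y (take i w) * pair_word x y ?r * pair_word x y (drop i w)"
    by (simp add: app mult.assoc)
  also have "\<dots> \<doteq> pair_word x y (take i w) * scal \<kappa> * pair_word x y (drop i w)"
    using r pair_word_closed by (intro hcong_mult hcong_refl)
  also have "pair_word x y (take i w) * scal \<kappa> * pair_word x y (drop i w) = scal \<kappa> * pair_word x y w"
    by (simp only: scal_central[of \<kappa>, symmetric] mult.assoc app[symmetric] append_take_drop_id)
  also have "\<dots> \<doteq> scal \<kappa> * scal c" using Cons.prems by (intro hcong_mult_left scal_closed)
  also have "scal \<kappa> * scal c = scal (c * \<kappa>)" by (simp only: mult.commute[of c \<kappa>] scal_hom(3))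
  finally have "pair_word x y (insert_relators n ps (reduce_word (take i w @ ?r @ drop i w))) \<doteq> scal (c * \<kappa> * \<kappa> ^ length ps)"
    using pair_word_reduce[OF sub] by (intro Cons.IH) auto
  then show ?case by (simp add: p mult.assoc)
qed simp

lemma polyhedral_scalar:
  assumes "n \<in> {3, 4, 5}" and rel: "(x * y) ^ n \<doteq> scal \<kappa>" "(y * x) ^ n \<doteq> scal \<kappa>"
  shows "\<exists>k>0. scal (\<kappa> ^ k) \<doteq> 1"
proof -
  obtain ps where ps: "ps \<noteq> []" "insert_relators n ps [] = []" using polyhedron_peeling[OF assms(1)] by blast
  have Nil: "pair_word x y [] = 1" by (simp add: pair_word_def)
  have "pair_word x y [] \<doteq> scal 1" unfolding Nil scal_hom(1) by (rule hcong_refl[OF free_algebra_closed(2)])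
  then have "pair_word x y (insert_relators n ps []) \<doteq> scal (1 * \<kappa> ^ length ps)"
    by (intro pair_word_insert[OF rel]) simp_all
  then have "scal (\<kappa> ^ length ps) \<doteq> 1" unfolding ps(2) Nil mult_1_left by (rule hcong_sym)
  then show ?thesis using ps(1) by blast
qed

end

text \<open>For involutions, y x is the inverse of x y, so the same scalar is its own
  inverse.\<close>

lemma dihedral_scalar:
  assumes xy: "x \<in> carrier (hecke_free r m)" "y \<in> carrier (hecke_free r m)" "x * x \<doteq> 1" "y * y \<doteq> 1"
    and rel: "(x * y) ^ n \<doteq> scal \<kappa>" "(y * x) ^ n \<doteq> scal \<kappa>"
  shows "scal (\<kappa> ^ 2) \<doteq> 1"
proof -
  have cl: "(x * y) ^ n \<in> carrier (hecke_free r m)" "(y * x) ^ n \<in> carrier (hecke_free r m)" for n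
    using xy by (auto intro!: power_closed free_algebra_mult_closed)
  have "(x * y) ^ n * (y * x) ^ n \<doteq> 1" for n
  proof (induction n)
    case (Suc n)
    have "(x * y) ^ Suc n * (y * x) ^ Suc n = (x * y) ^ n * (x * (y * y) * x) * (y * x) ^ n"
      by (simp only: power_Suc2[of "x * y"] power_Suc[of "y * x"] mult.assoc)
    also have "\<dots> \<doteq> (x * y) ^ n * (x * 1 * x) * (y * x) ^ n"
      using xy cl by (intro hcong_mult hcong_refl)
    also have "\<dots> \<doteq> (x * y) ^ n * 1 * (y * x) ^ n"
    proof -
      have "x * 1 * x \<doteq> 1" using xy(3) by simp
      then show ?thesis by (rule hcong_mult_right[OF cl(2) hcong_mult_left[OF cl(1)]])
    qed
    also have "(x * y) ^ n * 1 * (y * x) ^ n \<doteq> 1" using Suc by simp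
    finally show ?case .
  qed (simp add: hcong_refl free_algebra_closed)
  then have "1 \<doteq> (x * y) ^ n * (y * x) ^ n" by (rule hcong_sym)
  also have "\<dots> \<doteq> scal \<kappa> * scal \<kappa>" using rel by (rule hcong_mult)
  finally have "scal \<kappa> * scal \<kappa> \<doteq> 1" by (rule hcong_sym)
  then show ?thesis by (simp only: scal_hom(3) power2_eq_square)
qed

text \<open>Conjugation by \<open>y\<close> turns x y into y x and fixes scalars.\<close>

lemma power_swap:
  assumes "x \<in> carrier (hecke_free r m)" "y \<in> carrier (hecke_free r m)" "y' \<in> carrier (hecke_free r m)"
    and y': "y * y' \<doteq> 1" and rel: "(x * y) ^ n \<doteq> scal \<kappa>"
  shows "(y * x) ^ n \<doteq> scal \<kappa>"
proof -
  have cl: "(x * y) ^ n \<in> carrier (hecke_free r m)" "(y * x) ^ n \<in> carrier (hecke_free r m)"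
    using assms by (auto intro!: power_closed free_algebra_mult_closed)
  have eq: "y * (x * y) ^ n = (y * x) ^ n * y" by (induction n) (simp_all add: mult.assoc)
  have "(y * x) ^ n \<doteq> (y * x) ^ n * (y * y')"
    using hcong_mult_left[OF cl(2) hcong_sym[OF y']] by simp
  also have "(y * x) ^ n * (y * y') = y * (x * y) ^ n * y'" by (simp only: eq mult.assoc[symmetric])
  also have "\<dots> \<doteq> y * scal \<kappa> * y'" using assms by (intro hcong_mult hcong_refl)
  also have "y * scal \<kappa> * y' = scal \<kappa> * (y * y')" by (simp only: scal_central[of \<kappa>, symmetric] mult.assoc)
  also have "\<dots> \<doteq> scal \<kappa> * 1" using y' by (intro hcong_mult_left scal_closed)
  finally show ?thesis by simp
qed

lemma product_relation_scalar:
  assumes u: "u \<in> carrier (hecke_free r m)" and w: "w \<in> carrier (hecke_free r m)" and "u * w \<doteq> 1" and wn: "w ^ n \<doteq> scal \<kappa>" and "\<kappa> \<noteq> 0"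
  shows "u ^ n \<doteq> scal (inverse \<kappa>)"
proof -
  have "u ^ n * w ^ n \<doteq> 1" for n
  proof (induction n)
    case (Suc n)
    have "u ^ Suc n * w ^ Suc n = u ^ n * (u * w) * w ^ n"
      by (simp only: power_Suc2[of u] power_Suc[of w] mult.assoc)
    also have "\<dots> \<doteq> u ^ n * 1 * w ^ n" using assms by (intro hcong_mult hcong_refl power_closed)
    also have "u ^ n * 1 * w ^ n \<doteq> 1" using Suc by simp
    finally show ?case .
  qed (simp add: hcong_refl free_algebra_closed)
  then have 1: "scal (inverse \<kappa>) * (u ^ n * w ^ n) \<doteq> scal (inverse \<kappa>) * 1"
    by (intro hcong_mult_left scal_closed)
  have "u ^ n * scal \<kappa> \<doteq> u ^ n * w ^ n" by (rule hcong_mult_left[OF power_closed[OF u] hcong_sym[OF wn]])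
  then have "scal (inverse \<kappa>) * (u ^ n * scal \<kappa>) \<doteq> scal (inverse \<kappa>) * (u ^ n * w ^ n)"
    by (rule hcong_mult_left[OF scal_closed])
  then have 2: "scal (inverse \<kappa>) * (u ^ n * scal \<kappa>) \<doteq> scal (inverse \<kappa>) * 1"
    by (rule hcong_trans[OF _ 1])
  have "scal (inverse \<kappa>) * (u ^ n * scal \<kappa>) = u ^ n"
  proof -
    have "scal (inverse \<kappa>) * (u ^ n * scal \<kappa>) = scal (inverse \<kappa>) * scal \<kappa> * u ^ n"
      by (simp only: scal_central[of \<kappa> "u ^ n"] mult.assoc)
    also have "scal (inverse \<kappa>) * scal \<kappa> = 1"
      using assms(5) by (simp add: scal_hom(3)[symmetric] scal_hom(1))
    finally show ?thesis by simp
  qed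
  then show ?thesis using 2 by simp
qed

lemma rotate_relation:
  assumes "a * b \<doteq> 1" and cl: "a \<in> carrier (hecke_free r m)" "b \<in> carrier (hecke_free r m)" "a' \<in> carrier (hecke_free r m)"
    and a': "a' * a \<doteq> 1"
  shows "b * a \<doteq> 1"
proof -
  have "b * a \<doteq> (a' * a) * (b * a)"
    using hcong_mult_right[OF free_algebra_mult_closed[OF cl(2,1)] hcong_sym[OF a']] by simp
  also have "(a' * a) * (b * a) = a' * (a * b) * a" by (simp add: mult.assoc)
  also have "\<dots> \<doteq> a' * 1 * a" using assms by (intro hcong_mult hcong_refl)
  also have "a' * 1 * a \<doteq> 1" using a' by simp
  finally show ?thesis .
qed

text \<open>The product relation may be rotated cyclically, so the product of \<open>gen p\<close>
  and \<open>gen q\<close> in one of the two orders is inverse to \<open>gen s\<close>, and its n-th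
  power is 1/2. The dihedral or polyhedral computation makes a positive power of 1/2 equal to
  1.\<close>

lemma spherical_collapse:
  assumes r: "r = 3" and pqs: "{p, q, s} = {1, 2, 3 :: nat}"
    and x2: "gen p ^ 2 \<doteq> 1" and wn: "gen s ^ n \<doteq> scal 2"
    and y: "gen q ^ 2 \<doteq> 1 \<or> gen q ^ 3 \<doteq> 1 \<and> n \<in> {3, 4, 5}"
  shows "1 \<in> K"
proof -
  let ?F = "carrier (hecke_free r m)"
  have "{p, q, s} \<subseteq> {1..r}" unfolding pqs using r by auto
  then have in3: "p \<in> {1..r}" "q \<in> {1..r}" "s \<in> {1..r}" by auto
  have g: "gen j \<in> ?F" "inv_gen j \<in> ?F" if "j \<in> {1..r}" for j using that by (simp_all add: free_algebra_closed)
  note inv = gen_inverse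
  have rot: "gen j * b \<doteq> 1 \<Longrightarrow> b * gen j \<doteq> 1" if "j \<in> {1..r}" "b \<in> ?F" for j b
    using rotate_relation[OF _ g(1)[OF that(1)] that(2) g(2)[OF that(1)] inv(2)[OF that(1)]] .
  have "(\<Prod>j\<leftarrow>[1..<Suc r]. gen j) - 1 \<in> K" by (intro relators_in_K) (simp add: hecke_relators_def)
  then have "gen 1 * (gen 2 * gen 3) - 1 \<in> K" by (simp add: r numeral_3_eq_3 numeral_2_eq_2)
  moreover have "gen 1 * (gen 2 * gen 3) \<in> ?F" using r by (intro free_algebra_mult_closed free_algebra_closed) auto
  ultimately have r123: "gen 1 * (gen 2 * gen 3) \<doteq> 1" by (simp add: hcong_def free_algebra_closed)
  then have r231: "gen 2 * (gen 3 * gen 1) \<doteq> 1"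
    using rot[of 1 "gen 2 * gen 3"] r by (simp add: free_algebra_closed free_algebra_mult_closed mult.assoc)
  then have r312: "gen 3 * (gen 1 * gen 2) \<doteq> 1"
    using rot[of 2 "gen 3 * gen 1"] r by (simp add: free_algebra_closed free_algebra_mult_closed mult.assoc)
  have "card {p, q, s} = 3" "{p, q, s} \<subseteq> {1, 2, 3}" unfolding pqs by auto
  then have "(p, q, s) \<in> {(1, 2, 3), (2, 3, 1), (3, 1, 2), (2, 1, 3), (3, 2, 1), (1, 3, 2)}"
    by (auto simp: card_insert_if split: if_splits)
  then have "gen s * (gen p * gen q) \<doteq> 1 \<or> gen s * (gen q * gen p) \<doteq> 1"
    using r123 r231 r312 by auto
  then have "(gen p * gen q) * gen s \<doteq> 1 \<or> (gen q * gen p) * gen s \<doteq> 1"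
    using rot[OF in3(3)] g in3 by (auto simp: free_algebra_mult_closed)
  then have "(gen p * gen q) ^ n \<doteq> scal (1 / 2) \<or> (gen q * gen p) ^ n \<doteq> scal (1 / 2)"
    using product_relation_scalar[OF _ g(1)[OF in3(3)] _ wn] g in3 by (auto simp: free_algebra_mult_closed inverse_eq_divide)
  then have rel: "(gen p * gen q) ^ n \<doteq> scal (1 / 2)" "(gen q * gen p) ^ n \<doteq> scal (1 / 2)"
    using power_swap[OF g(1)[OF in3(1)] g(1)[OF in3(2)] g(2)[OF in3(2)] inv(1)[OF in3(2)], of n "1 / 2"]
      power_swap[OF g(1)[OF in3(2)] g(1)[OF in3(1)] g(2)[OF in3(1)] inv(1)[OF in3(1)], of n "1 / 2"]
    by blast+
  have "\<exists>k>0. scal ((1 / 2) ^ k) \<doteq> 1"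
  proof (cases "gen q ^ 2 \<doteq> 1")
    case True
    then show ?thesis using dihedral_scalar[OF _ _ _ _ rel] g in3 x2
      by (intro exI[of _ 2]) (simp add: power2_eq_square)
  next
    case False
    then show ?thesis using y g in3 x2 by (intro polyhedral_scalar[OF _ _ _ _ _ rel]) (auto simp: power2_eq_square)
  qed
  then obtain k where k: "k > 0" "scal ((1 / 2) ^ k) \<doteq> 1" by blast
  have "((1 / 2) ^ k :: complex) \<noteq> 1"
  proof
    assume "((1 / 2) ^ k :: complex) = 1"
    then have "norm ((1 / 2) ^ k :: complex) = 1" by simp
    then have "(1 / 2 :: real) ^ k = 1" by (simp add: norm_power norm_divide)
    then show False using power_strict_decreasing[of 0 k "1 / 2 :: real"] k(1) by simp
  qed
  then show ?thesis using scal_hcong_one k(2) by blast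
qed

end

section \<open>A point of the torus over which the fibre vanishes\<close>

text \<open>The roots are the values of the t_jk that turn the Hecke relation into c^n = \<kappa>.
  They are nonzero, so they define a point of the torus.\<close>

lemma power_minus_const_factorization:
  fixes \<kappa> :: complex
  assumes "n > 0" "\<kappa> \<noteq> 0"
  obtains as where "length as = n" "(\<Prod>a\<leftarrow>as. [:- a, 1:]) = monom 1 n - [:\<kappa>:]" "\<And>a. a \<in> set as \<Longrightarrow> a \<noteq> 0"
proof -
  let ?p = "monom 1 n - [:\<kappa>:]"
  have p: "?p = monom 1 n + [:- \<kappa>:]" by simp
  have deg: "degree ?p = n"
    unfolding p using assms(1) by (subst degree_add_eq_left) (simp_all add: degree_monom_eq)
  have lc: "lead_coeff ?p = 1" unfolding deg using assms(1) by (cases n) auto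
  then have "?p \<noteq> 0" by (metis leading_coeff_0_iff zero_neq_one)
  then obtain A where A: "size A = n" "?p = (\<Prod>x\<in>#A. [:- x, 1:])"
    using alg_closed_imp_factorization[of ?p] lc deg by auto
  obtain as where as: "mset as = A" using ex_mset by blast
  have prod: "(\<Prod>a\<leftarrow>as. [:- a, 1:]) = ?p" unfolding A(2) as[symmetric] by (simp add: prod_mset_prod_list[symmetric])
  have "a \<noteq> 0" if "a \<in> set as" for a
  proof
    assume "a = 0"
    then have "poly (\<Prod>a\<leftarrow>as. [:- a, 1:]) 0 = 0"
      using that by (induction as) auto
    then show False unfolding prod using assms by (simp add: poly_monom zero_power)
  qed
  then show thesis using that prod A(1) as by (metis size_mset)
qed

text \<open>Horner evaluation of a complex polynomial at an element of the noncommutative free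
  algebra.\<close>

definition poly_at :: "free_elt \<Rightarrow> complex poly \<Rightarrow> free_elt" where
  "poly_at g p = fold_coeffs (\<lambda>a y. scal a + g * y) p 0"

lemma poly_at_simps: "poly_at g 0 = 0" "poly_at g (pCons a p) = scal a + g * poly_at g p"
proof -
  show z: "poly_at g 0 = 0" by (simp add: poly_at_def)
  show "poly_at g (pCons a p) = scal a + g * poly_at g p"
    by (cases "p = 0 \<and> a = 0") (auto simp: poly_at_def scal_hom)
qed

lemma poly_at_add: "poly_at g (p + q) = poly_at g p + poly_at g q"
  by (induction p q rule: poly_induct2) (simp_all add: poly_at_simps scal_hom algebra_simps)

lemma poly_at_smult: "poly_at g (smult a p) = scal a * poly_at g p"
proof (induction p)
  case (pCons b p)
  have "scal a * (g * y) = g * (scal a * y)" for y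
    by (simp only: mult.assoc[symmetric] scal_central[of a g])
  then show ?case using pCons by (simp add: poly_at_simps scal_hom distrib_left)
qed (simp add: poly_at_simps)

lemma poly_at_linear: "poly_at g ([:- a, 1:] * p) = (g - scal a) * poly_at g p"
proof -
  have "[:- a, 1:] * p = smult (- a) p + pCons 0 p" by simp
  then show ?thesis by (simp only: poly_at_add poly_at_smult poly_at_simps scal_hom) (simp add: algebra_simps)
qed

lemma poly_at_prod: "poly_at g (\<Prod>a\<leftarrow>as. [:- a, 1:]) = (\<Prod>a\<leftarrow>as. g - scal a)"
proof (induction as)
  case Nil
  then show ?case by (simp add: poly_at_simps scal_hom one_pCons)
next
  case (Cons a as)
  show ?case unfolding list.map prod_list.Cons poly_at_linear Cons ..
qed

lemma poly_at_monom: "poly_at g (monom 1 n) = g ^ n"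
  by (induction n) (simp_all add: poly_at_simps monom_0 monom_Suc scal_hom)

lemma exp_surj: "z \<noteq> 0 \<Longrightarrow> \<exists>w. exp w = (z :: complex)"
proof -
  assume "z \<noteq> 0"
  then have "exp (of_real (ln (cmod z)) + \<i> * of_real (Arg z)) = z"
    by (simp add: exp_add exp_of_real cis_conv_exp[symmetric] rcis_def[symmetric] rcis_cmod_Arg)
  then show ?thesis by blast
qed

lemma spherical_not_free:
  assumes r: "r = 3" and pqs: "{p, q, s} = {1, 2, 3 :: nat}"
    and m: "m p = 2" "m q = 2 \<or> m q = 3 \<and> n \<in> {3, 4, 5}" "m s = enat n" "n \<ge> 2"
  shows "\<not> free_module (hecke_coeffs r m) (hecke_algebra r m)"
proof
  assume free: "free_module (hecke_coeffs r m) (hecke_algebra r m)"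
  have "card {p, q, s} = 3" unfolding pqs by simp
  then have ne: "p \<noteq> s" "q \<noteq> s" by (auto simp: card_insert_if split: if_splits)
  \<comment> \<open>Only the generator of order n gets a scalar other than 1; any nonzero number
    that is not a root of unity would serve instead of 2.\<close>
  define \<kappa> :: "nat \<Rightarrow> complex" where "\<kappa> j = (if j = s then 2 else 1)" for j
  have jc: "j = p \<or> j = q \<or> j = s" if "j \<in> {1..r}" for j
  proof -
    have "j \<in> {p, q, s}" unfolding pqs using that r by auto
    then show ?thesis by auto
  qed
  have m2: "m j \<ge> 2" and fin: "m j \<noteq> \<infinity>" "the_enat (m j) > 0" if "j \<in> {1..r}" for j
    using jc[OF that] m by (auto simp: numeral_eq_enat)
  have "\<exists>as. j \<in> {1..r} \<longrightarrow> length as = the_enat (m j) \<and>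
    (\<Prod>a\<leftarrow>as. [:- a, 1:]) = monom 1 (the_enat (m j)) - [:\<kappa> j:] \<and> (\<forall>a\<in>set as. a \<noteq> 0)" for j
  proof (cases "j \<in> {1..r}")
    case True
    have "\<kappa> j \<noteq> 0" by (simp add: \<kappa>_def)
    with fin(2)[OF True] show ?thesis by (rule power_minus_const_factorization) blast
  qed blast
  then obtain as where as: "\<And>j. j \<in> {1..r} \<Longrightarrow> length (as j) = the_enat (m j)"
    "\<And>j. j \<in> {1..r} \<Longrightarrow> (\<Prod>a\<leftarrow>as j. [:- a, 1:]) = monom 1 (the_enat (m j)) - [:\<kappa> j:]"
    "\<And>j a. j \<in> {1..r} \<Longrightarrow> a \<in> set (as j) \<Longrightarrow> a \<noteq> 0" by metis
  \<comment> \<open>Logarithms of the chosen roots. The variables are numbered from 1, the list from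
    0.\<close>
  define \<theta> where "\<theta> jk = (SOME w. exp w = as (fst jk) ! (snd jk - 1))" for jk
  have exp\<theta>: "exp (\<theta> (j, k)) = as j ! (k - 1)" if "j \<in> {1..r}" "k \<in> {1..the_enat (m j)}" for j k
  proof -
    have "as j ! (k - 1) \<noteq> 0" using that as(1)[OF that(1)] by (intro as(3)[OF that(1)] nth_mem) auto
    then have "\<exists>w. exp w = as j ! (k - 1)" by (rule exp_surj)
    from someI_ex[OF this] show ?thesis by (simp add: \<theta>_def)
  qed
  let ?J = "fibre_ideal r m \<theta>"
  interpret hecke_quotient r m ?J by (rule fibre_ideal_quotient)
  have power: "hcong (gen j ^ the_enat (m j)) (scal (\<kappa> j))" if j: "j \<in> {1..r}" for j
  proof -
    let ?n = "the_enat (m j)"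
    have g: "gen j \<in> carrier (hecke_free r m)" using j by (simp add: free_algebra_closed)
    \<comment> \<open>The variable minus its value at the point vanishes there, so it lies in the
      ideal of the fibre.\<close>
    have lin: "hcong (gen j - const (tvar j k)) (gen j - scal (as j ! (k - 1)))" if k: "k \<in> {1..?n}" for k
    proof -
      have hv: "(j, k) \<in> hecke_vars r m" using j k fin(1)[OF j] by (cases "m j") (auto simp: hecke_vars_def)
      define a where "a = tvar j k + - Poly_Mapping.single 0 (as j ! (k - 1))"
      have aR: "a \<in> carrier (hecke_coeffs r m)" unfolding a_def by (intro laurent_closed hv scal_coeff)
      have "laurent_eval \<theta> a = 0"
        unfolding a_def laurent_eval.eval_map_add laurent_eval.eval_map_uminus laurent_eval_tvar exp\<theta>[OF j k] by simp
      then have "0 + const a * 1 \<in> ?J" using aR by (intro fibre_step fibre_zero free_algebra_closed)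
      then have "const (tvar j k) - scal (as j ! (k - 1)) \<in> ?J"
        unfolding a_def const_hom const_uminus scal_def by simp
      then have "hcong (const (tvar j k)) (scal (as j ! (k - 1)))"
        using hv by (simp add: hcong_def scal_closed free_algebra_closed laurent_closed)
      then show ?thesis using g by (intro hcong_diff hcong_refl)
    qed
    have "hcong (\<Prod>k\<leftarrow>ks. gen j - const (tvar j k)) (\<Prod>k\<leftarrow>ks. gen j - scal (as j ! (k - 1)))"
      if "set ks \<subseteq> {1..?n}" for ks
      using that
    proof (induction ks)
      case (Cons k ks)
      then show ?case unfolding list.map prod_list.Cons by (intro hcong_mult lin) simp_all
    qed (simp add: hcong_refl free_algebra_closed)
    moreover have "set [1..<Suc ?n] \<subseteq> {1..?n}" by auto
    ultimately have "hcong (\<Prod>k\<leftarrow>[1..<Suc ?n]. gen j - const (tvar j k)) (\<Prod>k\<leftarrow>[1..<Suc ?n]. gen j - scal (as j ! (k - 1)))"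
      by blast
    also have "map (\<lambda>k. gen j - scal (as j ! (k - 1))) [1..<Suc ?n] = map (\<lambda>a. gen j - scal a) (as j)"
      using as(1)[OF j] by (intro nth_equalityI) (auto simp del: upt_Suc)
    also have "prod_list \<dots> = gen j ^ ?n - scal (\<kappa> j)"
      unfolding poly_at_prod[symmetric] as(2)[OF j]
    proof -
      have "monom 1 ?n - [:\<kappa> j:] = monom 1 ?n + [:- \<kappa> j:]" by simp
      then show "poly_at (gen j) (monom 1 ?n - [:\<kappa> j:]) = gen j ^ ?n - scal (\<kappa> j)"
        by (simp only: poly_at_add poly_at_monom poly_at_simps scal_hom) simp
    qed
    finally have c: "hcong (\<Prod>k\<leftarrow>[1..<Suc ?n]. gen j - const (tvar j k)) (gen j ^ ?n - scal (\<kappa> j))" .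
    have "(\<Prod>k\<leftarrow>[1..<Suc ?n]. gen j - const (tvar j k)) \<in> ?J"
      using j fin(1)[OF j] by (intro relators_in_K) (auto simp: hecke_relators_def simp del: upt_Suc)
    from K_diff[OF this, of "(\<Prod>k\<leftarrow>[1..<Suc ?n]. gen j - const (tvar j k)) - (gen j ^ ?n - scal (\<kappa> j))"] c
    have "gen j ^ ?n - scal (\<kappa> j) \<in> ?J" by (simp add: hcong_def del: upt_Suc)
    then show ?thesis using g by (simp add: hcong_def power_closed scal_closed)
  qed
  have "{p, q, s} \<subseteq> {1..r}" unfolding pqs using r by auto
  then have in3: "p \<in> {1..r}" "q \<in> {1..r}" "s \<in> {1..r}" by auto
  have "1 \<in> ?J"
  proof (rule spherical_collapse[OF r pqs])
    show "hcong (gen p ^ 2) 1" using power[OF in3(1)] m ne by (simp add: \<kappa>_def numeral_eq_enat scal_hom)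
    show "hcong (gen s ^ n) (scal 2)" using power[OF in3(3)] m by (simp add: \<kappa>_def)
    show "hcong (gen q ^ 2) 1 \<or> hcong (gen q ^ 3) 1 \<and> n \<in> {3, 4, 5}"
      using power[OF in3(2)] m ne by (auto simp: \<kappa>_def numeral_eq_enat scal_hom)
  qed
  then show False using free_imp_fibre_nonzero[OF free, of \<theta>] m2 by blast
qed

text \<open>Three orders of at least 3 have reciprocal sum at most 1, so one order is 2 and the
  other two have reciprocal sum above 1/2; this excludes pairs dominating (4,4), (3,6) or (6,3). The
  conclusion spells out all assignments of the roles p, q, s of
  \<open>spherical_not_free\<close>.\<close>

lemma spherical_triples:
  fixes a b c :: nat
  assumes "a \<ge> 2" "b \<ge> 2" "c \<ge> 2" and sum: "1 / real a + 1 / real b + 1 / real c > 1"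
  shows "a = 2 \<and> (b = 2 \<or> b = 3 \<and> c \<in> {3, 4, 5} \<or> c = 2 \<or> c = 3 \<and> b \<in> {3, 4, 5}) \<or>
    b = 2 \<and> (c = 2 \<or> c = 3 \<and> a \<in> {3, 4, 5} \<or> a = 2 \<or> a = 3 \<and> c \<in> {3, 4, 5}) \<or>
    c = 2 \<and> (a = 2 \<or> a = 3 \<and> b \<in> {3, 4, 5} \<or> b = 2 \<or> b = 3 \<and> a \<in> {3, 4, 5})"
proof -
  have bound: "1 / real n \<le> 1 / 3" if "n \<ge> 3" for n using that frac_le[of 1 1 3 "real n"] by simp
  have bound4: "1 / real n \<le> 1 / 4" if "n \<ge> 4" for n using that frac_le[of 1 1 4 "real n"] by simp
  have bound6: "1 / real n \<le> 1 / 6" if "n \<ge> 6" for n using that frac_le[of 1 1 6 "real n"] by simp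
  have two: "x = 2 \<or> y = 2 \<or> x = 3 \<and> y \<in> {3, 4, 5} \<or> y = 3 \<and> x \<in> {3, 4, 5}"
    if "x \<ge> 2" "y \<ge> 2" "1 / real x + 1 / real y > 1 / 2" for x y
  proof (rule ccontr)
    assume no: "\<not> ?thesis"
    then have ge3: "x \<ge> 3" "y \<ge> 3" using that(1,2) by linarith+
    have ge6: "z \<ge> 6" if "z \<ge> 3" "z \<notin> {3, 4, 5}" for z :: nat using that by simp
    have "x \<ge> 4 \<and> y \<ge> 4 \<or> x \<ge> 3 \<and> y \<ge> 6 \<or> x \<ge> 6 \<and> y \<ge> 3"
    proof (cases "x = 3 \<or> y = 3")
      case True
      then show ?thesis using no ge3 ge6 by blast
    next
      case False
      then have "x \<ge> 4" "y \<ge> 4" using ge3 by linarith+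
      then show ?thesis by blast
    qed
    then show False
    proof (elim disjE conjE)
      assume "x \<ge> 4" "y \<ge> 4"
      from this[THEN bound4] show False using that(3) by linarith
    next
      assume "x \<ge> 3" "y \<ge> 6"
      from bound[OF this(1)] bound6[OF this(2)] show False using that(3) by linarith
    next
      assume "x \<ge> 6" "y \<ge> 3"
      from bound6[OF this(1)] bound[OF this(2)] show False using that(3) by linarith
    qed
  qed
  have "a = 2 \<or> b = 2 \<or> c = 2"
  proof (rule ccontr)
    assume "\<not> ?thesis"
    then have "a \<ge> 3" "b \<ge> 3" "c \<ge> 3" using assms by auto
    from this[THEN bound] show False using sum by linarith
  qed
  then show ?thesis
  proof (elim disjE)
    assume "a = 2"
    then have "1 / real b + 1 / real c > 1 / 2" using sum by simp
    from two[OF assms(2,3) this] show ?thesis using \<open>a = 2\<close> by blast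
  next
    assume "b = 2"
    then have "1 / real c + 1 / real a > 1 / 2" using sum by simp
    from two[OF assms(3,1) this] show ?thesis using \<open>b = 2\<close> by blast
  next
    assume "c = 2"
    then have "1 / real a + 1 / real b > 1 / 2" using sum by simp
    from two[OF assms(1,2) this] show ?thesis using \<open>c = 2\<close> by blast
  qed
qed

theorem theorem3p11:
  fixes r :: nat and m :: "nat \<Rightarrow> enat"
  assumes "r \<ge> 3" and "\<And>j. j \<in> {1..r} \<Longrightarrow> m j \<ge> 2"
  shows "free_module (hecke_coeffs r m) (hecke_algebra r m) \<longleftrightarrow>
    (\<Sum>j=1..r. 1 - 1 / ereal_of_enat (m j)) \<ge> 2"
proof
  interpret polygon r m by (rule polygon.intro[OF assms])
  assume "(\<Sum>j=1..r. 1 - 1 / ereal_of_enat (m j)) \<ge> 2"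
  then show "free_module (hecke_coeffs r m) (hecke_algebra r m)"
    by (rule hecke_free_module[OF infinite_order_word])
next
  assume free: "free_module (hecke_coeffs r m) (hecke_algebra r m)"
  show "(\<Sum>j=1..r. 1 - 1 / ereal_of_enat (m j)) \<ge> 2"
  proof (rule ccontr)
    assume "\<not> ?thesis"
    then have *: "\<not> (r \<ge> 4 \<or> (\<exists>j\<in>{1..r}. m j = \<infinity>) \<or>
      1 / real (the_enat (m 1)) + 1 / real (the_enat (m 2)) + 1 / real (the_enat (m 3)) \<le> 1)"
      using angle_sum_ge_2_iff[of r m] assms by blast
    then have r: "r = 3" using assms(1) by simp
    have no_inf: "\<forall>j\<in>{1..r}. m j \<noteq> \<infinity>"
      using * unfolding de_Morgan_disj by simp
    define n where "n j = the_enat (m j)" for j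
    have fin: "m j = enat (n j)" "n j \<ge> 2" if "j \<in> {1, 2, 3}" for j
    proof -
      have j: "j \<in> {1..r}" using that r by auto
      then have "m j \<noteq> \<infinity>" using no_inf by simp
      then show m: "m j = enat (n j)" by (cases "m j") (auto simp: n_def)
      show "n j \<ge> 2" using assms(2)[OF j] unfolding m by (simp add: numeral_eq_enat)
    qed
    have no: "\<not> (n p = 2 \<and> (n q = 2 \<or> n q = 3 \<and> n s \<in> {3, 4, 5}))" if pqs: "{p, q, s} = {1, 2, 3 :: nat}" for p q s
    proof
      assume npq: "n p = 2 \<and> (n q = 2 \<or> n q = 3 \<and> n s \<in> {3, 4, 5})"
      have "p \<in> {1, 2, 3}" "q \<in> {1, 2, 3}" "s \<in> {1, 2, 3}" unfolding pqs[symmetric] by auto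
      note j = this
      have pq: "m p = 2" "m q = 2 \<or> m q = 3 \<and> n s \<in> {3, 4, 5}"
        unfolding fin(1)[OF j(1)] fin(1)[OF j(2)] using npq by (simp_all add: numeral_eq_enat)
      show False
        using spherical_not_free[where m = m and n = "n s", OF r pqs pq fin[OF j(3)]] free ..
    qed
    have perms: "{1, 3, 2} = {1, 2, 3 :: nat}" "{2, 1, 3} = {1, 2, 3 :: nat}" "{2, 3, 1} = {1, 2, 3 :: nat}"
      "{3, 1, 2} = {1, 2, 3 :: nat}" "{3, 2, 1} = {1, 2, 3 :: nat}" by auto
    have ge: "n 1 \<ge> 2" "n 2 \<ge> 2" "n 3 \<ge> 2" by (simp_all add: fin(2))
    have "1 / real (n 1) + 1 / real (n 2) + 1 / real (n 3) > 1"
      using * unfolding n_def de_Morgan_disj not_le by blast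
    from spherical_triples[OF ge this]
    show False
      using no[OF refl] no[OF perms(1)] no[OF perms(2)] no[OF perms(3)] no[OF perms(4)] no[OF perms(5)] by argo
  qed
qed

end
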